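(* Let $n\ge 3$ be an integer. (Spherical case) Let $0<P<n\pi$. For every $r=(r_1,\ldots,r_n)$ with $0<r_i<\pi$ for all $i$ and $\sum_{i=1}^n r_i=P$, one has $$V^{\mathbb{S}^3}(r)\le V^{\mathbb{S}^3}\left(\tfrac{P}{n},\ldots,\tfrac{P}{n}\right).$$ Moreover, if $n$ is even, then equality holds only if $r=(\tfrac{P}{n},\ldots,\tfrac{P}{n})$. (Euclidean case) Let $P>0$. For every $r=(r_1,\ldots,r_n)$ with $r_i>0$ for all $i$ and $\sum_{i=1}^n r_i=P$, one has $$V^{\mathbb{E}^3}(r)\le V^{\mathbb{E}^3}\left(\tfrac{P}{n},\ldots,\tfrac{P}{n}\right).$$ Moreover, if $n$ is even, then equality holds only if $r=(\tfrac{P}{n},\ldots,\tfrac{P}{n})$. That is, among all spherical (respectively Euclidean) $n$-gons with fixed perimeter, the regular one is one of the most flexible, and it is the unique most flexible one if $n$ is even.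
   Context: An $n$-gon in $\mathbb{S}^3$ (unit 3-sphere) or $\mathbb{E}^3$ (Euclidean 3-space) is given by vertices $(v_1,\ldots,v_n)$ joined in cyclic order by geodesic segments $e_i$ from $v_i$ to $v_{i+1}$ (indices mod $n$). Its side-lengths are $r_i=\mathrm{length}(e_i)$, and its perimeter is $\sum_i r_i$. It is regular if all its side-lengths are equal. The moduli space of polygons with side-lengths $r=(r_1,\ldots,r_n)$ is the space of all such polygons modulo orientation-preserving isometries. For $\mathbb{S}^3$ we take $0<r_i<\pi$ and quotient by $SO(4)$; for $\mathbb{E}^3$ we take $r_i>0$ and quotient by $\mathbb{E}^+(3)$. The flexibility of a polygon with side-lengths $r$ is measured by the symplectic volume $V^{\mathbb{S}^3}(r)$ (resp. $V^{\mathbb{E}^3}(r)$) of its moduli space, so larger volume means more flexible. An empty moduli space has volume $0$. Spherical case: the moduli space is identified with $$\{(g_1,\ldots,g_n)\in SU(2)^n : g_1\cdots g_n=\mathrm{Id},\ \mathrm{Tr}(g_j)=2\cos r_j\ \forall j\}/SU(2)$$ (diagonal conjugation). This is the moduli space of flat $SU(2)$ connections on the $n$-punctured sphere with holonomy around the $j$-th puncture conjugate to $\mathrm{diag}(e^{ir_j},e^{-ir_j})$, and it carries the Atiyah-Bott symplectic structure. The volume is normalized so that it is given by Witten's formula (a known result, which may be taken as the definition of $V^{\mathbb{S}^3}$): $$V^{\mathbb{S}^3}(r)=\frac{2^{n-1}}{\pi}\sum_{k=1}^\infty\frac{\sin kr_1\cdots\sin kr_n}{k^{n-2}}.$$ Euclidean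 case: the moduli space is identified with $\mu_r^{-1}(0)/SO(3)$, where $\mu_r:(S^2)^n\to\mathbb{R}^3$, $\mu_r(u_1,\ldots,u_n)=\sum_i r_iu_i$. This is the symplectic quotient of $(S^2)^n$ with symplectic form $\sum_i r_i\omega_i$ ($\omega_i$ the area form of the $i$-th unit sphere) by the diagonal $SO(3)$ action. $V^{\mathbb{E}^3}$ is its symplectic volume, normalized (Liouville volume divided by $(2\pi)^{n-3}$) to agree with the spherical one for small side-lengths: $V^{\mathbb{E}^3}(\lambda r)=\lambda^{n-3}V^{\mathbb{E}^3}(r)$ for all $\lambda>0$, and $V^{\mathbb{E}^3}(r)=V^{\mathbb{S}^3}(r)$ whenever all $r_i$ are sufficiently small. *)

theory Defs
  imports "HOL-Analysis.Analysis"
begin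

text \<open>
  The sides of an \<open>n\<close>-gon are indexed by a finite type \<open>'n\<close> with \<open>n = CARD('n)\<close>; the side-lengths
  form a vector \<open>r :: real^'n\<close>. The cyclic order of the sides is irrelevant for both volumes
  below, so the index type carries no order.
\<close>

text \<open>
  Witten's formula. The summation index \<open>k \<ge> 1\<close> is written \<open>Suc k\<close>. For \<open>n = 3\<close> the series
  converges only conditionally; \<open>suminf\<close> is the limit of the partial sums in the natural order.
\<close>

definition V_S3 :: "real^'n::finite \<Rightarrow> real" where
  "V_S3 r = 2 ^ (CARD('n) - 1) / pi *
     (\<Sum>k. (\<Prod>i\<in>UNIV. sin (real (Suc k) * r $ i)) / real (Suc k) ^ (CARD('n) - 2))"

text \<open>
  A Euclidean polygon up to translation is given by its unit edge vectors
  \<open>u :: (real^3)^'n\<close>; it closes up iff the moment map vanishes.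
\<close>

definition moment_map :: "real^'n::finite \<Rightarrow> (real^3)^'n \<Rightarrow> real^3" where
  "moment_map r u = (\<Sum>i\<in>UNIV. r $ i *\<^sub>R u $ i)"

definition zero_level :: "real^'n::finite \<Rightarrow> ((real^3)^'n) set" where
  "zero_level r = {u. (\<forall>i. norm (u $ i) = 1) \<and> moment_map r u = 0}"

definition so3_rel :: "(((real^3)^'n::finite) \<times> ((real^3)^'n)) set" where
  "so3_rel = {(u, v). \<exists>A. rotation_matrix A \<and> v = (\<chi> i. A *v u $ i)}"

text \<open>
  The polygons that are not contained in a line are exactly those on which \<open>SO(3)\<close> acts freely.
  On this locus the quotient \<open>zero_level r // so3_rel\<close> is a smooth symplectic manifold of dimension
  \<open>2(n - 3)\<close>; the remaining classes are finitely many points.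
\<close>

definition degenerate :: "(real^3)^'n::finite \<Rightarrow> bool" where
  "degenerate u \<longleftrightarrow> collinear (insert 0 (range (($) u)))"

definition regular_level :: "real^'n::finite \<Rightarrow> ((real^3)^'n) set" where
  "regular_level r = {u \<in> zero_level r. \<not> degenerate u}"

text \<open>
  The form \<open>\<Sum>\<^sub>i r\<^sub>i \<omega>\<^sub>i\<close> at the point \<open>u\<close>, on vectors tangent to the product of spheres.
\<close>

definition symp_form ::
    "real^'n::finite \<Rightarrow> (real^3)^'n \<Rightarrow> (real^3)^'n \<Rightarrow> (real^3)^'n \<Rightarrow> real" where
  "symp_form r u v w = (\<Sum>i\<in>UNIV. r $ i * (u $ i \<bullet> cross3 (v $ i) (w $ i)))"

text \<open>
  An index type with \<open>2(n - 3)\<close> elements, used for coordinates on the moduli space if \<open>n \<ge> 4\<close>.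
\<close>

typedef 'n chart_dim = "{k::nat. k < max 1 (2 * (CARD('n::finite) - 3))}"
  by (rule exI[of _ 0]) simp

lemma CARD_chart_dim: "CARD('n::finite chart_dim) = max 1 (2 * (CARD('n) - 3))"
  using type_definition.card[OF type_definition_chart_dim[where 'n = 'n]]
  by simp

instance chart_dim :: (finite) finite
proof
  show "finite (UNIV :: 'a chart_dim set)"
    using CARD_chart_dim[where 'n = 'a] by (intro card_ge_0_finite) simp
qed

text \<open>
  A parametrization of a part of the quotient, given by a lift to the zero level: \<open>\<phi>\<close> is
  continuously differentiable with derivative \<open>\<phi>'\<close>, and it is injective modulo \<open>SO(3)\<close>. The domain
  \<open>U\<close> need not be connected.
\<close>

definition local_section ::
    "real^'n::finite \<Rightarrow> (real^('n chart_dim)) set \<Rightarrow> (real^('n chart_dim) \<Rightarrow> (real^3)^'n) \<Rightarrow>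
     (real^('n chart_dim) \<Rightarrow> real^('n chart_dim) \<Rightarrow> (real^3)^'n) \<Rightarrow> bool" where
  "local_section r U \<phi> \<phi>' \<longleftrightarrow>
     open U \<and> \<phi> ` U \<subseteq> regular_level r \<and>
     (\<forall>x\<in>U. (\<phi> has_derivative \<phi>' x) (at x)) \<and>
     (\<forall>h. continuous_on U (\<lambda>x. \<phi>' x h)) \<and>
     (\<forall>x\<in>U. \<forall>y\<in>U. (\<phi> x, \<phi> y) \<in> so3_rel \<longrightarrow> x = y)"

text \<open>
  The Liouville volume \<open>\<integral> \<omega>\<^sup>m / m!\<close>, where \<open>m = n - 3\<close>, of the part of the quotient parametrized by
  \<open>\<phi>\<close>. The pull-back under \<open>\<phi>\<close> of the reduced symplectic form is the pull-back of \<open>symp_form\<close>; its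
  coefficient matrix \<open>\<Omega>\<close> is skew-symmetric and the density of \<open>\<omega>\<^sup>m / m!\<close> is its Pfaffian, of absolute
  value \<open>sqrt \<bar>det \<Omega>\<bar>\<close>.
\<close>

definition liouville_volume ::
    "real^'n::finite \<Rightarrow> (real^('n chart_dim)) set \<Rightarrow> (real^('n chart_dim) \<Rightarrow> (real^3)^'n) \<Rightarrow>
     (real^('n chart_dim) \<Rightarrow> real^('n chart_dim) \<Rightarrow> (real^3)^'n) \<Rightarrow> ennreal" where
  "liouville_volume r U \<phi> \<phi>' =
     (\<integral>\<^sup>+x\<in>U. ennreal (sqrt \<bar>det (\<chi> i j. symp_form r (\<phi> x) (\<phi>' x (axis i 1)) (\<phi>' x (axis j 1)))\<bar>)
        \<partial>lborel)"

text \<open>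
  The symplectic volume of the moduli space. For \<open>n \<ge> 4\<close>, it is the supremum of the volumes of the
  parametrized parts. Disjoint coordinate patches can be combined into a single parametrization,
  because domains may be disconnected, and countably many disjoint patches exhaust the
  manifold up to a null set.

  For \<open>n = 3\<close> the moduli space has dimension \<open>0\<close> and its volume is the number of its points. A
  degenerate triangle is not a regular point and is counted with weight \<open>1/2\<close>; this is the
  value forced by agreement with Witten's formula for small side-lengths.
\<close>

definition symplectic_volume :: "real^'n::finite \<Rightarrow> ennreal" where
  "symplectic_volume r =
     (if CARD('n) = 3 then
        emeasure (count_space UNIV) (regular_level r // so3_rel) +
        emeasure (count_space UNIV) ({u \<in> zero_level r. degenerate u} // so3_rel) / 2
      else Sup {liouville_volume r U \<phi> \<phi>' | U \<phi> \<phi>'. local_section r U \<phi> \<phi>'})"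

definition V_E3 :: "real^'n::finite \<Rightarrow> ennreal" where
  "V_E3 r = symplectic_volume r / ennreal ((2 * pi) ^ (CARD('n) - 3))"

end

theory Submission
  imports Defs
begin

text \<open>
  Any \<open>r\<close> can be turned into the regular side-lengths by finitely many steps that keep the sum of two
  sides \<open>r\<^sub>i, r\<^sub>j\<close> and decrease \<open>\<bar>r\<^sub>i - r\<^sub>j\<bar>\<close>, so it suffices that such a step does not decrease the volume,
  and that the last one increases it if \<open>n\<close> is even.

  In the spherical case, the product formula for \<open>sin\<close> turns Witten's series into a positive multiple of
  \<open>g (r\<^sub>i - r\<^sub>j) - g (r\<^sub>i + r\<^sub>j)\<close>, where \<open>g\<close> is a convolution on the circle of the indicators of the arcs
  \<open>[-r\<^sub>l, r\<^sub>l]\<close> for the other sides \<open>l\<close>. Such a convolution is symmetric and unimodal. An Abel factor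
  \<open>\<rho> < 1\<close>, that is, a convolution with the Poisson kernel, makes all series converge.
  For even \<open>n\<close>, the difference of the series in the last step has nonnegative terms.

  In the Euclidean case, the diagonal \<open>f = r\<^sub>i u\<^sub>i + r\<^sub>j u\<^sub>j\<close> is kept and the triangle over it is replaced by one
  with the new side-lengths in the same oriented half-plane. The triangle inequalities for the new triangle are weaker, so this
  embeds the moduli space, up to a null set, and it preserves the symplectic form.
  The image misses the open set of polygons with \<open>\<bar>f\<bar> < \<bar>r\<^sub>i - r\<^sub>j\<bar>\<close>, which is nonempty
  if the new polygon is regular and \<open>n\<close> is even. As the volume for \<open>r\<^sub>i \<noteq> r\<^sub>j\<close> is finite, it increases strictly.
\<close>

section \<open>Averaging pairs of sides\<close>

text \<open>The Euclidean volume is a supremum over sections, not an integral over a manifold, and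
  this shapes the Euclidean part. A weak inequality can be proved section by section. For a strict
  one, the transferred section and a section of the missed polygons have to be merged into a single
  section; bounded domains are used, so that one of them can be translated away from the other. The
  gain is then a fixed positive number, but it makes the supremum larger only if the smaller
  supremum is finite. Finiteness is obtained for \<open>r\<^sub>i \<noteq> r\<^sub>j\<close>, where
  the lower bound on the diagonal keeps the coordinates away from their singularities.

  The polygons left out by the embedding are not shown to be a null set of the moduli space.
  Instead, in the domain of each section, parallel edges occur only on a null set or where the
  density is zero.

  In the spherical case, unimodality alone cannot give strictness, because a convolution of arcs may
  have plateaus. The last step is accessible in closed form, since its two sides are
  \<open>a + d\<close> and \<open>a - d\<close> and all others equal \<open>a\<close>.\<close>

lemma robin_hood_chain:
  fixes V :: "real^'n::finite \<Rightarrow> 'b::linorder" and a :: real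
  assumes A: "is_interval A"
    and step: "\<And>r s i j. \<lbrakk>i \<noteq> j; \<forall>k. r $ k \<in> A; \<forall>k. s $ k \<in> A; \<forall>k. k \<noteq> i \<longrightarrow> k \<noteq> j \<longrightarrow> s $ k = r $ k;
        s $ i + s $ j = r $ i + r $ j; \<bar>s $ i - s $ j\<bar> \<le> \<bar>r $ i - r $ j\<bar>\<rbrakk> \<Longrightarrow> V r \<le> V s"
    and r: "\<forall>k. r $ k \<in> A" "(\<Sum>k\<in>UNIV. r $ k) = real CARD('n) * a"
  shows "V r \<le> V (\<chi> k. a)"
    and "\<lbrakk>\<And>s i j. \<lbrakk>i \<noteq> j; \<forall>k. s $ k \<in> A; a \<in> A; s $ i \<noteq> a; s $ i + s $ j = 2 * a;
            \<forall>k. k \<noteq> i \<longrightarrow> k \<noteq> j \<longrightarrow> s $ k = a\<rbrakk> \<Longrightarrow> V s < V (\<chi> k. a);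
          r \<noteq> (\<chi> k. a)\<rbrakk> \<Longrightarrow> V r < V (\<chi> k. a)"
proof -
  \<comment> \<open>The strictness hypothesis becomes a formula so that one induction delivers both
    conclusions.\<close>
  define Q where "Q \<longleftrightarrow> (\<forall>s i j. i \<noteq> j \<longrightarrow> (\<forall>k. s $ k \<in> A) \<longrightarrow> a \<in> A \<longrightarrow> s $ i \<noteq> a \<longrightarrow> s $ i + s $ j = 2 * a \<longrightarrow>
            (\<forall>k. k \<noteq> i \<longrightarrow> k \<noteq> j \<longrightarrow> s $ k = a) \<longrightarrow> V s < V (\<chi> k. a))"
  have "V r \<le> V (\<chi> k. a) \<and> (Q \<longrightarrow> r \<noteq> (\<chi> k. a) \<longrightarrow> V r < V (\<chi> k. a))"
    using r
  proof (induction "card {k. r $ k \<noteq> a}" arbitrary: r rule: less_induct)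
    case less
    show ?case
    proof (cases "r = (\<chi> k. a)")
      case False
      then obtain k0 where k0: "r $ k0 \<noteq> a" by (auto simp: vec_eq_iff)
      have sum0: "(\<Sum>k\<in>UNIV. r $ k - a) = 0" using less.prems by (simp add: sum_subtractf)
      have "\<exists>i. r $ i < a"
      proof (rule ccontr)
        assume "\<not> ?thesis"
        then have "\<forall>k. r $ k - a \<ge> 0" by (simp add: not_less)
        then have "\<forall>k\<in>UNIV. r $ k - a = 0" using sum0 by (subst (asm) sum_nonneg_eq_0_iff) auto
        then show False using k0 by simp
      qed
      then obtain i where i: "r $ i < a" by blast
      have "\<exists>i. r $ i > a"
      proof (rule ccontr)
        assume "\<not> ?thesis"
        then have "\<forall>k. a - r $ k \<ge> 0" by (simp add: not_less)
        moreover have "(\<Sum>k\<in>UNIV. a - r $ k) = 0" using sum0 by (simp add: sum_subtractf)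
        ultimately have "\<forall>k\<in>UNIV. a - r $ k = 0" by (subst (asm) sum_nonneg_eq_0_iff) auto
        then show False using k0 by simp
      qed
      then obtain j where j: "r $ j > a" by blast
      have ij: "i \<noteq> j" using i j by auto
      \<comment> \<open>Of two entries on either side of \<open>a\<close>, the one closer to
        \<open>a\<close> is moved to \<open>a\<close> exactly. The other ends between its old value
        and \<open>a\<close>, so it stays in the interval, and the number of entries different from
        \<open>a\<close> drops.\<close>
      define i' j' where "i' = (if a - r $ i \<le> r $ j - a then i else j)"
        and "j' = (if a - r $ i \<le> r $ j - a then j else i)"
      define s where "s = (\<chi> k. if k = i' then a else if k = j' then r $ i + r $ j - a else r $ k)"
      have ij': "i' \<noteq> j'" using ij by (auto simp: i'_def j'_def)
      have aA: "a \<in> A" by (rule mem_is_interval_1_I[OF A, of "r $ i" "r $ j"]) (use less.prems i j in auto)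
      have bA: "r $ i + r $ j - a \<in> A" by (rule mem_is_interval_1_I[OF A, of "r $ i" "r $ j"]) (use less.prems i j in auto)
      have sA: "\<forall>k. s $ k \<in> A" using aA bA less.prems by (auto simp: s_def)
      have ss: "s $ i' + s $ j' = r $ i' + r $ j'" using ij' by (auto simp: s_def i'_def j'_def)
      have so: "\<forall>k. k \<noteq> i' \<longrightarrow> k \<noteq> j' \<longrightarrow> s $ k = r $ k" by (simp add: s_def)
      have le: "V r \<le> V s"
      proof (rule step[OF ij'])
        show "\<bar>s $ i' - s $ j'\<bar> \<le> \<bar>r $ i' - r $ j'\<bar>"
          using ij' i j by (auto simp: s_def i'_def j'_def)
      qed (use less.prems sA so ss in auto)
      have "(\<Sum>k\<in>UNIV. s $ k) = (\<Sum>k\<in>UNIV. r $ k)"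
      proof -
        have "(\<Sum>k\<in>UNIV. s $ k - r $ k) = (\<Sum>k\<in>{i', j'}. s $ k - r $ k)"
          by (rule sum.mono_neutral_right) (auto simp: so)
        also have "\<dots> = 0" using ij' ss by simp
        finally show ?thesis by (simp add: sum_subtractf)
      qed
      then have sum_s: "(\<Sum>k\<in>UNIV. s $ k) = real CARD('n) * a" using less.prems by simp
      have "{k. s $ k \<noteq> a} \<subset> {k. r $ k \<noteq> a}"
      proof
        show "{k. s $ k \<noteq> a} \<subseteq> {k. r $ k \<noteq> a}" using i j by (auto simp: s_def i'_def j'_def)
        have "i' \<in> {k. r $ k \<noteq> a}" "i' \<notin> {k. s $ k \<noteq> a}" using i j by (auto simp: s_def i'_def)
        then show "{k. s $ k \<noteq> a} \<noteq> {k. r $ k \<noteq> a}" by blast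
      qed
      then have "card {k. s $ k \<noteq> a} < card {k. r $ k \<noteq> a}" by (intro psubset_card_mono) auto
      from less.hyps[OF this sA sum_s]
      have IH: "V s \<le> V (\<chi> k. a)" "Q \<Longrightarrow> s \<noteq> (\<chi> k. a) \<Longrightarrow> V s < V (\<chi> k. a)" by auto
      have "V r < V (\<chi> k. a)" if Q: "Q"
      \<comment> \<open>Either this step reaches the constant vector, and then all entries other
        than \<open>i\<close>, \<open>j\<close> were already equal to \<open>a\<close>, or the
        strict increase comes from the induction hypothesis.\<close>
      proof (cases "s = (\<chi> k. a)")
        case True
        have "V r < V (\<chi> k. a)"
        proof (rule Q[unfolded Q_def, rule_format, of i j])
          show "r $ i \<noteq> a" using i by simp
          show "r $ i + r $ j = 2 * a" using ss unfolding True by (simp add: i'_def j'_def split: if_splits)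
          show "r $ k = a" if "k \<noteq> i" "k \<noteq> j" for k
          proof -
            have "s $ k = r $ k" using so that by (auto simp: i'_def j'_def)
            then show ?thesis unfolding True by simp
          qed
        qed (use ij less.prems(1) aA in simp_all)
        then show ?thesis .
      qed (use IH le Q in auto)
      then show ?thesis using le IH by auto
    qed auto
  qed
  then have V: "V r \<le> V (\<chi> k. a)" "Q \<Longrightarrow> r \<noteq> (\<chi> k. a) \<Longrightarrow> V r < V (\<chi> k. a)" by auto
  show "V r \<le> V (\<chi> k. a)" by (rule V)
  show "V r < V (\<chi> k. a)"
    if strict: "\<And>s i j. \<lbrakk>i \<noteq> j; \<forall>k. s $ k \<in> A; a \<in> A; s $ i \<noteq> a; s $ i + s $ j = 2 * a;
            \<forall>k. k \<noteq> i \<longrightarrow> k \<noteq> j \<longrightarrow> s $ k = a\<rbrakk> \<Longrightarrow> V s < V (\<chi> k. a)"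
      and "r \<noteq> (\<chi> k. a)"
  proof (rule V(2))
    show Q unfolding Q_def using strict by (intro allI impI)
  qed fact
qed

section \<open>Spherical volumes\<close>

lemma Abel_limit:
  fixes a :: "nat \<Rightarrow> real"
  assumes a: "summable a"
  shows "((\<lambda>\<rho>. \<Sum>k. a k * \<rho> ^ k) \<longlongrightarrow> suminf a) (at_left 1)"
proof (rule tendstoI)
  fix e :: real assume e: "e > 0"
  define s where "s n = (\<Sum>k\<le>n. a k)" for n
  have s: "s \<longlonglongrightarrow> suminf a"
    unfolding s_def by (rule summable_LIMSEQ'[OF a])
  obtain N where N: "\<And>n. n \<ge> N \<Longrightarrow> \<bar>s n - suminf a\<bar> < e / 2"
    using s e unfolding LIMSEQ_def dist_real_def by (meson half_gt_zero)
  define C where "C = (\<Sum>n<N. \<bar>s n - suminf a\<bar>)"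
  have C: "C \<ge> 0" by (auto simp: C_def intro: sum_nonneg)
  \<comment> \<open>The threshold makes \<open>(1 - \<rho>) * C\<close> smaller than
    \<open>e / 2\<close>; the summand 1 keeps the quotient meaningful for
    \<open>C = 0\<close>.\<close>
  have "eventually (\<lambda>\<rho>::real. \<rho> \<in> {max 0 (1 - e / (2 * (C + 1)))<..<1}) (at_left 1)"
    using e C by (intro eventually_at_leftI[of "max 0 (1 - e / (2 * (C + 1)))"]) auto
  then show "eventually (\<lambda>\<rho>. dist (\<Sum>k. a k * \<rho> ^ k) (suminf a) < e) (at_left 1)"
  proof eventually_elim
    case (elim \<rho>)
    then have \<rho>: "0 < \<rho>" "\<rho> < 1" and \<rho>C: "(1 - \<rho>) * (2 * (C + 1)) < e"
      using C by (auto simp: field_simps)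
    have conv: "summable (\<lambda>k. norm (a k * \<rho> ^ k))"
      using powser_insidea[of a 1 \<rho>] a \<rho> by simp
    have geo: "(\<lambda>k. \<rho> ^ k) sums (1 / (1 - \<rho>))" using \<rho> by (intro geometric_sums) auto
    have "(\<lambda>k. \<Sum>i\<le>k. (a i * \<rho> ^ i) * \<rho> ^ (k - i)) sums ((\<Sum>k. a k * \<rho> ^ k) * (\<Sum>k. \<rho> ^ k))"
      by (rule Cauchy_product_sums[OF conv]) (use geo \<rho> in \<open>auto simp: sums_iff power_abs\<close>)
    also have "(\<lambda>k. \<Sum>i\<le>k. (a i * \<rho> ^ i) * \<rho> ^ (k - i)) = (\<lambda>k. s k * \<rho> ^ k)"
      by (auto simp: s_def sum_distrib_right fun_eq_iff mult.assoc simp flip: power_add intro!: sum.cong)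
    finally have S1: "(\<lambda>k. s k * \<rho> ^ k) sums ((\<Sum>k. a k * \<rho> ^ k) / (1 - \<rho>))"
      using geo by (simp add: sums_iff)
    have S2: "(\<lambda>k. (s k - suminf a) * \<rho> ^ k) sums (((\<Sum>k. a k * \<rho> ^ k) - suminf a) / (1 - \<rho>))"
      using sums_diff[OF S1 sums_mult[OF geo, of "suminf a"]] by (simp add: algebra_simps diff_divide_distrib)
    define t where "t k = (if k < N then \<bar>s k - suminf a\<bar> else 0) + e / 2 * \<rho> ^ k" for k
    have S3: "t sums (C + e / 2 * (1 / (1 - \<rho>)))"
      unfolding t_def C_def
      using sums_If_finite_set[of "{..<N}" "\<lambda>k. \<bar>s k - suminf a\<bar>"] by (intro sums_add sums_mult geo) simp
    have t: "norm ((s k - suminf a) * \<rho> ^ k) \<le> t k" for k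
    proof (cases "k < N")
      case True
      have "\<bar>s k - suminf a\<bar> * \<rho> ^ k \<le> \<bar>s k - suminf a\<bar>"
        using \<rho> by (simp add: mult_left_le power_le_one)
      moreover have "e / 2 * \<rho> ^ k \<ge> 0" using e \<rho> by simp
      ultimately show ?thesis using True \<rho> by (simp add: t_def abs_mult)
    next
      case False
      then have "\<bar>s k - suminf a\<bar> * \<rho> ^ k \<le> e / 2 * \<rho> ^ k"
        using N[of k] \<rho> by (intro mult_right_mono) auto
      then show ?thesis using False \<rho> by (simp add: t_def abs_mult)
    qed
    have "\<bar>(\<Sum>k. (s k - suminf a) * \<rho> ^ k)\<bar> \<le> (\<Sum>k. t k)"
      using norm_suminf_le[of "\<lambda>k. (s k - suminf a) * \<rho> ^ k" t, OF t] S3 by (simp add: sums_iff)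
    then have "\<bar>((\<Sum>k. a k * \<rho> ^ k) - suminf a) / (1 - \<rho>)\<bar> \<le> C + e / 2 * (1 / (1 - \<rho>))"
      using S2 S3 by (simp add: sums_iff)
    then have "\<bar>(\<Sum>k. a k * \<rho> ^ k) - suminf a\<bar> \<le> (C + e / 2 * (1 / (1 - \<rho>))) * (1 - \<rho>)"
      using \<rho> by (simp add: abs_divide divide_le_eq)
    also have "\<dots> = C * (1 - \<rho>) + e / 2" proof -
      have "1 / (1 - \<rho>) * (1 - \<rho>) = 1" using \<rho> by simp
      then show ?thesis unfolding distrib_right mult.assoc by simp
    qed
    also have "\<dots> < e"
    proof -
      have "C * (1 - \<rho>) \<le> (C + 1) * (1 - \<rho>)" using \<rho> by (intro mult_right_mono) auto
      then show ?thesis using \<rho>C by (simp add: algebra_simps)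
    qed
    finally show ?case by (simp add: dist_real_def)
  qed
qed

text \<open>Summation by parts against the bounded partial sums of \<open>\<Sum> sin (k t)\<close>.\<close>

lemma summable_sin_over: "summable (\<lambda>k. sin (real (Suc k) * t) / real (Suc k))"
proof (cases "sin (t / 2) = 0")
  case True
  then obtain i where "t / 2 = of_int i * pi" by (auto simp: sin_zero_iff_int2)
  then have t: "t = of_int (2 * i) * pi" by simp
  have "sin (real (Suc k) * t) = 0" for k
    unfolding t using sin_zero_iff_int2 by (metis mult.assoc of_int_mult of_int_of_nat_eq)
  then show ?thesis by simp
next
  case False
  define D where "D n = (\<Sum>k<n. sin (real (Suc k) * t))" for n
  \<comment> \<open>Multiplication by \<open>2 * sin (t / 2)\<close> makes the sum telescope. The
    resulting bound depends on \<open>t\<close> but not on \<open>n\<close>.\<close>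
  have D: "D n = (cos (t / 2) - cos ((real n + 1 / 2) * t)) / (2 * sin (t / 2))" for n
  proof (induction n)
    case (Suc n)
    have "2 * sin (t / 2) * sin (real (Suc n) * t) = cos ((real n + 1 / 2) * t) - cos ((real (Suc n) + 1 / 2) * t)"
      unfolding cos_diff_cos by (simp add: algebra_simps) (simp add: add_divide_distrib)
    then show ?case using Suc False by (simp add: D_def field_simps)
  qed (simp add: D_def)
  define M where "M = 1 / \<bar>sin (t / 2)\<bar>"
  have M0: "M \<ge> 0" by (simp add: M_def)
  have M: "\<bar>D n\<bar> \<le> M" for n
  proof -
    have "\<bar>cos (t / 2) - cos ((real n + 1 / 2) * t)\<bar> \<le> 2"
      using abs_cos_le_one[of "t/2"] abs_cos_le_one[of "(real n + 1 / 2) * t"] by linarith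
    then show ?thesis using False unfolding D M_def by (simp add: abs_divide abs_mult divide_simps)
  qed
  define c where "c n = D (Suc n) * (1 / real (Suc n) - 1 / real (Suc (Suc n)))" for n
  have "summable (\<lambda>n. M * (1 / real (Suc n) - 1 / real (Suc (Suc n))))"
    using telescope_summable'[of "\<lambda>n. 1 / real (Suc n)" 0] LIMSEQ_inverse_real_of_nat
    by (intro summable_mult) (simp add: inverse_eq_divide)
  moreover have "norm (c n) \<le> M * (1 / real (Suc n) - 1 / real (Suc (Suc n)))" for n
    unfolding c_def real_norm_def abs_mult
    by (intro mult_mono M) (auto simp: field_simps M0)
  ultimately have "summable c" by (blast intro: summable_comparison_test'[where N = 0])
  then have "(\<lambda>n. \<Sum>k<n. c k) \<longlonglongrightarrow> suminf c" by (rule summable_LIMSEQ)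
  moreover have "(\<lambda>n. D n / real (Suc n)) \<longlonglongrightarrow> 0"
  proof (rule Lim_null_comparison)
    show "eventually (\<lambda>n. norm (D n / real (Suc n)) \<le> M * inverse (real (Suc n))) sequentially"
      using M by (intro always_eventually) (auto simp: abs_divide divide_simps)
    show "(\<lambda>n. M * inverse (real (Suc n))) \<longlonglongrightarrow> 0"
      using tendsto_mult[OF tendsto_const LIMSEQ_inverse_real_of_nat, of M] by simp
  qed
  ultimately have "(\<lambda>n. (\<Sum>k<n. c k) + D n / real (Suc n)) \<longlonglongrightarrow> suminf c + 0" by (rule tendsto_add)
  moreover have "(\<Sum>k<n. c k) + D n / real (Suc n) = (\<Sum>k<n. sin (real (Suc k) * t) / real (Suc k))" for n
  proof (induction n)
    case (Suc n)
    have "D (Suc n) = D n + sin (real (Suc n) * t)" by (simp add: D_def)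
    then have "c n + D (Suc n) / real (Suc (Suc n)) = D n / real (Suc n) + sin (real (Suc n) * t) / real (Suc n)"
      by (simp add: c_def right_diff_distrib add_divide_distrib distrib_right)
    then show ?case using Suc by simp
  qed (simp add: D_def)
  ultimately show ?thesis unfolding summable_def sums_def by auto
qed

text \<open>The coefficients \<open>sin (k r) / k\<close> are, up to a factor 2, the Fourier coefficients of the indicator of
  the arc \<open>[-r, r]\<close>, so \<open>arc_conv \<rho> r S\<close> is the Poisson kernel convolved with the arcs of \<open>S\<close>
  (without its constant term).\<close>

definition arc_conv :: "real \<Rightarrow> ('n \<Rightarrow> real) \<Rightarrow> 'n set \<Rightarrow> real \<Rightarrow> real" where
  "arc_conv \<rho> r S x = (\<Sum>k. \<rho> ^ Suc k * cos (real (Suc k) * x) * (\<Prod>l\<in>S. sin (real (Suc k) * r l) / real (Suc k)))"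

lemma abs_prod_sin_over_le:
  "\<bar>\<Prod>l\<in>S. sin (real (Suc k) * r l) / real (Suc k)\<bar> \<le> 1"
  unfolding abs_prod
  by (rule prod_le_1) (auto simp: abs_divide divide_le_eq intro: order_trans[OF abs_sin_le_one])

lemma summable_arc_conv:
  assumes "0 \<le> \<rho>" "\<rho> < 1" "\<And>k. \<bar>f k\<bar> \<le> (1::real)"
  shows "summable (\<lambda>k. \<rho> ^ Suc k * f k * (\<Prod>l\<in>S. sin (real (Suc k) * r l) / real (Suc k)))"
proof (rule summable_comparison_test')
  show "summable (\<lambda>k. \<rho> ^ Suc k)" using assms by (subst summable_Suc_iff) (simp add: summable_geometric)
  show "norm (\<rho> ^ Suc k * f k * (\<Prod>l\<in>S. sin (real (Suc k) * r l) / real (Suc k))) \<le> \<rho> ^ Suc k" for k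
  proof -
    have "\<bar>f k\<bar> * \<bar>\<Prod>l\<in>S. sin (real (Suc k) * r l) / real (Suc k)\<bar> \<le> 1 * 1"
      by (intro mult_mono assms abs_prod_sin_over_le) auto
    then show ?thesis unfolding real_norm_def abs_mult mult.assoc
      using assms mult_left_le[of "\<bar>f k\<bar> * \<bar>\<Prod>l\<in>S. sin (real (Suc k) * r l) / real (Suc k)\<bar>" "\<rho> ^ Suc k"]
      by (simp add: mult.assoc)
  qed
qed

lemma summable_arc_conv_cos:
  assumes "0 \<le> \<rho>" "\<rho> < 1"
  shows "summable (\<lambda>k. \<rho> ^ Suc k * cos (real (Suc k) * x) * (\<Prod>l\<in>S. sin (real (Suc k) * r l) / real (Suc k)))"
  by (rule summable_arc_conv[OF assms]) (rule abs_cos_le_one)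

text \<open>Each \<open>cos (k x)\<close> is even and has period 2 pi. Angles can therefore be
  compared through their cosines, without reducing them to an interval.\<close>

lemma arc_conv_cos_cong:
  assumes "cos x = cos y" shows "arc_conv \<rho> r S x = arc_conv \<rho> r S y"
proof -
  obtain n where n: "n \<in> \<int>" "x = y + 2 * n * pi \<or> x = - y + 2 * n * pi" using assms by (auto simp: cos_eq)
  have "cos (real k * x) = cos (real k * y)" for k
  proof -
    have "cos (real k * x) = cos (real k * y + 2 * (real k * n) * pi) \<or> cos (real k * x) = cos (- (real k * y) + 2 * (real k * n) * pi)"
    proof (cases "x = y + 2 * n * pi")
      case True
      then have "real k * x = real k * y + 2 * (real k * n) * pi" by (simp add: algebra_simps)
      then show ?thesis by simp
    next
      case False
      then have "x = - y + 2 * n * pi" using n(2) by simp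
      then have "real k * x = real k * (- y + 2 * n * pi)" by simp
      also have "\<dots> = - (real k * y) + 2 * (real k * n) * pi" by (simp add: algebra_simps)
      finally have "real k * x = - (real k * y) + 2 * (real k * n) * pi" .
      then show ?thesis by simp
    qed
    moreover have "real k * n \<in> \<int>" using n by auto
    ultimately show ?thesis by (metis cos_eq cos_minus)
  qed
  then show ?thesis unfolding arc_conv_def by metis
qed

text \<open>Adding the arc of \<open>l\<close> amounts to half the integral over
  \<open>[x - r l, x + r l]\<close>, so the derivative is a difference of end values. In the series,
  the factor \<open>k\<close> from differentiating the cosine cancels the \<open>1 / k\<close> of
  the new coefficient.\<close>

lemma arc_conv_insert_deriv:
  assumes \<rho>: "0 \<le> \<rho>" "\<rho> < 1" and S: "finite S" "l \<notin> S"
  shows "(arc_conv \<rho> r (insert l S) has_real_derivative (arc_conv \<rho> r S (x + r l) - arc_conv \<rho> r S (x - r l)) / 2) (at x)"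
proof -
  let ?c = "\<lambda>S k. (\<Prod>l\<in>S. sin (real (Suc k) * r l) / real (Suc k))"
  define f where "f k x = \<rho> ^ Suc k * cos (real (Suc k) * x) * ?c (insert l S) k" for k x
  define f' where "f' k x = \<rho> ^ Suc k * (- sin (real (Suc k) * x) * sin (real (Suc k) * r l)) * ?c S k" for k x
  have cI: "?c (insert l S) k = sin (real (Suc k) * r l) / real (Suc k) * ?c S k" for k
    using S by (rule prod.insert)
  have "((\<lambda>x. \<Sum>k. f k x) has_real_derivative (\<Sum>k. f' k x)) (at x)"
  proof (rule has_field_derivative_series'[of UNIV f f' x, simplified])
    show "(f k has_real_derivative f' k x) (at x)" for k x
      unfolding f_def f'_def cI by (auto intro!: derivative_eq_intros)
    show "uniformly_convergent_on UNIV (\<lambda>n x. \<Sum>k<n. f' k x)"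
    proof (rule Weierstrass_m_test')
      show "summable (\<lambda>k. \<rho> ^ Suc k)" using \<rho> by (subst summable_Suc_iff) (simp add: summable_geometric)
      show "norm (f' k x) \<le> \<rho> ^ Suc k" for k x
      proof -
        have "\<bar>sin (real (Suc k) * x)\<bar> * \<bar>sin (real (Suc k) * r l)\<bar> * \<bar>?c S k\<bar> \<le> 1 * 1 * 1"
          by (intro mult_mono abs_prod_sin_over_le) auto
        then show ?thesis unfolding f'_def real_norm_def abs_mult abs_minus_cancel
          using \<rho> mult_left_le[of "\<bar>sin (real (Suc k) * x)\<bar> * \<bar>sin (real (Suc k) * r l)\<bar> * \<bar>?c S k\<bar>" "\<rho> ^ Suc k"]
          by (simp add: mult.assoc)
      qed
    qed
    show "summable (\<lambda>k. f k x)" unfolding f_def by (rule summable_arc_conv_cos[OF \<rho>])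
  qed
  moreover have "(\<lambda>x. \<Sum>k. f k x) = arc_conv \<rho> r (insert l S)" by (simp add: f_def arc_conv_def fun_eq_iff)
  moreover have "(\<Sum>k. f' k x) = (arc_conv \<rho> r S (x + r l) - arc_conv \<rho> r S (x - r l)) / 2"
  proof -
    have "arc_conv \<rho> r S (x + r l) - arc_conv \<rho> r S (x - r l) =
       (\<Sum>k. \<rho> ^ Suc k * cos (real (Suc k) * (x + r l)) * ?c S k - \<rho> ^ Suc k * cos (real (Suc k) * (x - r l)) * ?c S k)"
      unfolding arc_conv_def by (intro suminf_diff summable_arc_conv_cos \<rho>)
    also have "\<dots> = (\<Sum>k. 2 * f' k x)"
    proof (intro suminf_cong)
      fix k
      have c: "cos (real (Suc k) * (x + r l)) = cos (real (Suc k) * x) * cos (real (Suc k) * r l) - sin (real (Suc k) * x) * sin (real (Suc k) * r l)"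
        "cos (real (Suc k) * (x - r l)) = cos (real (Suc k) * x) * cos (real (Suc k) * r l) + sin (real (Suc k) * x) * sin (real (Suc k) * r l)"
        unfolding distrib_left right_diff_distrib cos_add cos_diff by auto
      show "\<rho> ^ Suc k * cos (real (Suc k) * (x + r l)) * ?c S k - \<rho> ^ Suc k * cos (real (Suc k) * (x - r l)) * ?c S k = 2 * f' k x"
        unfolding f'_def c by algebra
    qed
    also have "\<dots> = 2 * (\<Sum>k. f' k x)"
      unfolding f'_def by (intro suminf_mult summable_arc_conv \<rho>) (simp add: abs_mult mult_le_one)
    finally show ?thesis by simp
  qed
  ultimately show ?thesis by simp
qed

text \<open>Real part of the geometric series in \<open>\<rho> * cis x\<close>. The sum is
  \<open>(p - 1) / 2\<close> for the Poisson kernel \<open>p = (1 - \<rho>\<^sup>2) / (1 - 2 *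
  \<rho> * cos x + \<rho>\<^sup>2)\<close>.\<close>

lemma Poisson_sums:
  assumes \<rho>: "0 \<le> \<rho>" "\<rho> < 1"
  shows "(\<lambda>k. \<rho> ^ Suc k * cos (real (Suc k) * x)) sums ((\<rho> * cos x - \<rho>\<^sup>2) / (1 - 2 * \<rho> * cos x + \<rho>\<^sup>2))"
proof -
  define z where "z = of_real \<rho> * cis x"
  have nz: "norm z < 1" using \<rho> by (simp add: z_def norm_mult)
  have "(\<lambda>k. Re (z * z ^ k)) sums Re (z * (1 / (1 - z)))"
    by (intro sums_Re sums_mult geometric_sums nz)
  moreover have "Re (z * z ^ k) = \<rho> ^ Suc k * cos (real (Suc k) * x)" for k
  proof -
    have "z * z ^ k = z ^ Suc k" by simp
    also have "\<dots> = of_real (\<rho> ^ Suc k) * cis (real (Suc k) * x)"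
      unfolding z_def power_mult_distrib Complex.DeMoivre of_real_power ..
    finally have "z * z ^ k = of_real (\<rho> ^ Suc k) * cis (real (Suc k) * x)" .
    moreover have "Re (of_real t * cis u) = t * cos u" for t u by simp
    ultimately show ?thesis by metis
  qed
  moreover have "Re (z * (1 / (1 - z))) = (\<rho> * cos x - \<rho>\<^sup>2) / (1 - 2 * \<rho> * cos x + \<rho>\<^sup>2)"
  proof -
    have "(1 - \<rho> * cos x)\<^sup>2 + (\<rho> * sin x)\<^sup>2 = 1 - 2 * \<rho> * cos x + \<rho>\<^sup>2 * ((sin x)\<^sup>2 + (cos x)\<^sup>2)"
      by (simp add: power2_eq_square algebra_simps del: sin_cos_squared_add3)
    then have D: "(1 - \<rho> * cos x)\<^sup>2 + (\<rho> * sin x)\<^sup>2 = 1 - 2 * \<rho> * cos x + \<rho>\<^sup>2" by simp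
    have "\<rho> * cos x * (1 - \<rho> * cos x) - (\<rho> * sin x)\<^sup>2 = \<rho> * cos x - \<rho>\<^sup>2 * ((sin x)\<^sup>2 + (cos x)\<^sup>2)"
      by (simp add: power2_eq_square algebra_simps del: sin_cos_squared_add3)
    then have N: "\<rho> * cos x * (1 - \<rho> * cos x) - (\<rho> * sin x)\<^sup>2 = \<rho> * cos x - \<rho>\<^sup>2" by simp
    show ?thesis using D N by (simp add: Re_divide z_def power2_eq_square)
  qed
  ultimately show ?thesis by simp
qed

text \<open>Induction on the arcs. The Poisson kernel itself increases with the cosine. When an arc
  of half-width \<open>r l\<close> is added, the derivative at \<open>t\<close> between 0 and pi
  compares the previous function at \<open>t + r l\<close> and \<open>t - r l\<close>, and the first
  point has the smaller cosine because \<open>sin t * sin (r l) \<ge> 0\<close>. As everything is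
  phrased by cosines, these points may leave \<open>[0, pi]\<close>.\<close>

lemma arc_conv_mono:
  assumes \<rho>: "0 \<le> \<rho>" "\<rho> < 1" and "finite S" "\<And>l. l \<in> S \<Longrightarrow> 0 < r l \<and> r l < pi" "cos y \<le> cos x"
  shows "arc_conv \<rho> r S y \<le> arc_conv \<rho> r S x"
  using assms(3-)
proof (induction S arbitrary: x y rule: finite_induct)
  case empty
  have pos: "1 - 2 * \<rho> * cos t + \<rho>\<^sup>2 > 0" for t
  proof -
    have "2 * \<rho> * cos t \<le> 2 * \<rho>" using \<rho> by (simp add: mult_left_le)
    moreover have "(1 - \<rho>)\<^sup>2 > 0" using \<rho> by simp
    ultimately show ?thesis by (simp add: power2_diff)
  qed
  have "(\<rho> * cos x - \<rho>\<^sup>2) * (1 - 2 * \<rho> * cos y + \<rho>\<^sup>2) - (\<rho> * cos y - \<rho>\<^sup>2) * (1 - 2 * \<rho> * cos x + \<rho>\<^sup>2)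
     = \<rho> * (1 - \<rho>\<^sup>2) * (cos x - cos y)" by (simp add: power2_eq_square algebra_simps)
  also have "\<dots> \<ge> 0" using \<rho> empty by (intro mult_nonneg_nonneg) (auto simp: power_le_one)
  finally have "(\<rho> * cos y - \<rho>\<^sup>2) / (1 - 2 * \<rho> * cos y + \<rho>\<^sup>2) \<le> (\<rho> * cos x - \<rho>\<^sup>2) / (1 - 2 * \<rho> * cos x + \<rho>\<^sup>2)"
    using pos[of x] pos[of y] by (simp add: divide_le_eq le_divide_eq mult.commute divide_simps)
  then show ?case using Poisson_sums[OF \<rho>, of x] Poisson_sums[OF \<rho>, of y]
    by (simp add: arc_conv_def sums_iff)
next
  case (insert l S)
  have r: "0 < r l" "r l < pi" using insert.prems by auto
  have "arc_conv \<rho> r (insert l S) (arccos (cos y)) \<le> arc_conv \<rho> r (insert l S) (arccos (cos x))"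
  proof (rule DERIV_nonpos_imp_nonincreasing[where f = "arc_conv \<rho> r (insert l S)"])
    show "arccos (cos x) \<le> arccos (cos y)" using insert.prems by (intro arccos_le_arccos) auto
    fix t assume t: "arccos (cos x) \<le> t" "t \<le> arccos (cos y)"
    have t: "0 \<le> t" "t \<le> pi" using t arccos_lbound[of "cos x"] arccos_ubound[of "cos y"] by auto
    have "sin t * sin (r l) \<ge> 0" using t r by (intro mult_nonneg_nonneg sin_ge_zero) auto
    then have "cos (t + r l) \<le> cos (t - r l)" by (simp add: cos_add cos_diff)
    then have "arc_conv \<rho> r S (t + r l) \<le> arc_conv \<rho> r S (t - r l)" using insert by auto
    then have "(arc_conv \<rho> r S (t + r l) - arc_conv \<rho> r S (t - r l)) / 2 \<le> 0" by simp
    with arc_conv_insert_deriv[OF \<rho> insert.hyps(1,2), of r t]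
    show "\<exists>D. (arc_conv \<rho> r (insert l S) has_real_derivative D) (at t) \<and> D \<le> 0" by blast
  qed
  also have "arc_conv \<rho> r (insert l S) (arccos (cos y)) = arc_conv \<rho> r (insert l S) y" by (rule arc_conv_cos_cong) simp
  also have "arc_conv \<rho> r (insert l S) (arccos (cos x)) = arc_conv \<rho> r (insert l S) x" by (rule arc_conv_cos_cong) simp
  finally show ?case .
qed

section \<open>Witten's series under an averaging step\<close>

definition witten_term :: "real^'n::finite \<Rightarrow> nat \<Rightarrow> real" where
  "witten_term r k = (\<Prod>i\<in>UNIV. sin (real (Suc k) * r $ i)) / real (Suc k) ^ (CARD('n) - 2)"

text \<open>There are exactly \<open>n - 2\<close> sides other than \<open>i\<close>,
  \<open>j\<close>. The power of \<open>k\<close> is shared out among them, one factor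
  \<open>1 / k\<close> each, which turns their sines into Fourier coefficients of arcs.\<close>

lemma witten_term_split:
  fixes r :: "real^'n::finite"
  assumes "i \<noteq> j"
  shows "witten_term r k = sin (real (Suc k) * r $ i) * sin (real (Suc k) * r $ j) *
     (\<Prod>l\<in>UNIV - {i, j}. sin (real (Suc k) * r $ l) / real (Suc k))"
proof -
  have "(\<Prod>l\<in>UNIV. sin (real (Suc k) * r $ l)) = (\<Prod>l\<in>{i, j}. sin (real (Suc k) * r $ l)) * (\<Prod>l\<in>UNIV - {i, j}. sin (real (Suc k) * r $ l))"
    by (subst prod.union_disjoint[symmetric]) (auto simp: Un_absorb1)
  moreover have "card (UNIV - {i, j}) = CARD('n) - 2" using assms by (subst card_Diff_subset) auto
  ultimately show ?thesis using assms
    by (simp add: witten_term_def prod_dividef)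
qed

text \<open>For \<open>n \<ge> 4\<close> the terms are dominated by \<open>1 / k\<^sup>2\<close>.
  For \<open>n = 3\<close> only one power of \<open>k\<close> is left, and the product of three
  sines is resolved into four series of the form \<open>\<Sum> sin (k t) / k\<close>.\<close>

lemma summable_witten_term:
  assumes n: "CARD('n::finite) \<ge> 3"
  shows "summable (witten_term (r :: real^'n))"
proof (cases "CARD('n) = 3")
  case True
  then obtain a b c :: 'n where abc: "a \<noteq> b" "a \<noteq> c" "b \<noteq> c" "UNIV = {a, b, c}"
    by (auto simp: card_3_iff)
  let ?s = "\<lambda>t k. sin (real (Suc k) * t) / real (Suc k)"
  have "witten_term r = (\<lambda>k. (?s (r $ a + r $ b - r $ c) k + ?s (r $ a - r $ b + r $ c) k + ?s (r $ b + r $ c - r $ a) k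
      - ?s (r $ a + r $ b + r $ c) k) / 4)"
  proof
    fix k
    have id: "4 * (sin x * sin y * sin z) = sin (x + y - z) + sin (x - y + z) + sin (y + z - x) - sin (x + y + z)" for x y z :: real
      by (simp add: sin_add sin_diff cos_add cos_diff algebra_simps)
    define K where "K = real (Suc k)"
    have K: "K > 0" by (simp add: K_def)
    have e: "K * (r $ a + r $ b - r $ c) = K * r $ a + K * r $ b - K * r $ c"
      "K * (r $ a - r $ b + r $ c) = K * r $ a - K * r $ b + K * r $ c"
      "K * (r $ b + r $ c - r $ a) = K * r $ b + K * r $ c - K * r $ a"
      "K * (r $ a + r $ b + r $ c) = K * r $ a + K * r $ b + K * r $ c" by (simp_all add: algebra_simps)
    have "(\<Prod>i\<in>UNIV. sin (K * r $ i)) = sin (K * r $ a) * sin (K * r $ b) * sin (K * r $ c)"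
      unfolding abc(4) using abc(1-3) by simp
    then have "witten_term r k = 4 * (sin (K * r $ a) * sin (K * r $ b) * sin (K * r $ c)) / K / 4"
      using True by (simp add: witten_term_def K_def[symmetric] del: of_nat_Suc)
    then show "witten_term r k = (?s (r $ a + r $ b - r $ c) k + ?s (r $ a - r $ b + r $ c) k + ?s (r $ b + r $ c - r $ a) k
      - ?s (r $ a + r $ b + r $ c) k) / 4"
      unfolding id K_def[symmetric] e by (simp add: add_divide_distrib diff_divide_distrib)
  qed
  then show ?thesis by (simp only:) (intro summable_add summable_diff summable_divide summable_sin_over)
next
  case False
  then have n4: "CARD('n) \<ge> 4" using n by simp
  have sm: "summable (\<lambda>k. 1 / real (Suc k) ^ 2)"
    using inverse_power_summable[of 2, where 'a = real]
    by (subst summable_Suc_iff[of "\<lambda>k. 1 / real k ^ 2"]) (simp add: inverse_eq_divide)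
  show ?thesis
  proof (rule summable_comparison_test'[OF sm])
    fix k
    have "\<bar>\<Prod>i\<in>UNIV. sin (real (Suc k) * r $ i)\<bar> \<le> 1" unfolding abs_prod by (intro prod_le_1) auto
    moreover have "real (Suc k) ^ 2 \<le> real (Suc k) ^ (CARD('n) - 2)" using n4 by (intro power_increasing) auto
    ultimately show "norm (witten_term r k) \<le> 1 / real (Suc k) ^ 2"
      unfolding witten_term_def real_norm_def abs_divide by (intro frac_le) auto
  qed
qed

lemma suminf_witten_term_mono:
  fixes r s :: "real^'n::finite"
  assumes n: "CARD('n) \<ge> 3" and ij: "i \<noteq> j"
    and r: "\<forall>k. r $ k \<in> {0<..<pi}" and s: "\<forall>k. s $ k \<in> {0<..<pi}"
    and so: "\<forall>k. k \<noteq> i \<longrightarrow> k \<noteq> j \<longrightarrow> s $ k = r $ k"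
    and eq: "s $ i + s $ j = r $ i + r $ j" and le: "\<bar>s $ i - s $ j\<bar> \<le> \<bar>r $ i - r $ j\<bar>"
  shows "suminf (witten_term r) \<le> suminf (witten_term s)"
proof -
  define S where "S = UNIV - {i, j}"
  \<comment> \<open>The extra factor \<open>\<rho>\<close> turns \<open>\<rho> ^ k\<close> into the
    \<open>\<rho> ^ Suc k\<close> of \<open>arc_conv\<close>; in the limit it is 1.\<close>
  have lim: "((\<lambda>\<rho>. \<rho> * (\<Sum>k. witten_term t k * \<rho> ^ k)) \<longlongrightarrow> suminf (witten_term t)) (at_left 1)" for t :: "real^'n"
  proof -
    have "((\<lambda>\<rho>. \<rho> * (\<Sum>k. witten_term t k * \<rho> ^ k)) \<longlongrightarrow> 1 * suminf (witten_term t)) (at_left 1)"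
      by (intro tendsto_mult Abel_limit summable_witten_term n tendsto_ident_at)
    then show ?thesis by simp
  qed
  have val: "\<rho> * (\<Sum>k. witten_term t k * \<rho> ^ k) =
      (arc_conv \<rho> (($) t) S (t $ i - t $ j) - arc_conv \<rho> (($) t) S (t $ i + t $ j)) / 2"
    if \<rho>: "0 \<le> \<rho>" "\<rho> < 1" for \<rho> and t :: "real^'n"
  proof -
    let ?c = "\<lambda>k. (\<Prod>l\<in>S. sin (real (Suc k) * t $ l) / real (Suc k))"
    have "summable (\<lambda>k. witten_term t k * \<rho> ^ k)"
      using powser_insidea[of "witten_term t" 1 \<rho>] summable_witten_term[OF n] \<rho> by (auto intro: summable_norm_cancel)
    then have "\<rho> * (\<Sum>k. witten_term t k * \<rho> ^ k) = (\<Sum>k. \<rho> * (witten_term t k * \<rho> ^ k))"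
      by (rule suminf_mult[symmetric])
    also have "\<dots> = (\<Sum>k. (\<rho> ^ Suc k * cos (real (Suc k) * (t $ i - t $ j)) * ?c k - \<rho> ^ Suc k * cos (real (Suc k) * (t $ i + t $ j)) * ?c k) / 2)"
    proof (intro suminf_cong)
      fix k
      have c: "cos (real (Suc k) * (t $ i + t $ j)) = cos (real (Suc k) * t $ i) * cos (real (Suc k) * t $ j) - sin (real (Suc k) * t $ i) * sin (real (Suc k) * t $ j)"
        "cos (real (Suc k) * (t $ i - t $ j)) = cos (real (Suc k) * t $ i) * cos (real (Suc k) * t $ j) + sin (real (Suc k) * t $ i) * sin (real (Suc k) * t $ j)"
        unfolding distrib_left right_diff_distrib cos_add cos_diff by auto
      show "\<rho> * (witten_term t k * \<rho> ^ k) = (\<rho> ^ Suc k * cos (real (Suc k) * (t $ i - t $ j)) * ?c k - \<rho> ^ Suc k * cos (real (Suc k) * (t $ i + t $ j)) * ?c k) / 2"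
        unfolding witten_term_split[OF ij] S_def[symmetric] c power_Suc by (simp add: field_simps del: of_nat_Suc)
    qed
    also have "\<dots> = (\<Sum>k. \<rho> ^ Suc k * cos (real (Suc k) * (t $ i - t $ j)) * ?c k - \<rho> ^ Suc k * cos (real (Suc k) * (t $ i + t $ j)) * ?c k) / 2"
      by (intro suminf_divide summable_diff summable_arc_conv_cos \<rho>)
    also have "(\<Sum>k. \<rho> ^ Suc k * cos (real (Suc k) * (t $ i - t $ j)) * ?c k - \<rho> ^ Suc k * cos (real (Suc k) * (t $ i + t $ j)) * ?c k) =
       arc_conv \<rho> (($) t) S (t $ i - t $ j) - arc_conv \<rho> (($) t) S (t $ i + t $ j)"
      unfolding arc_conv_def by (intro suminf_diff[symmetric] summable_arc_conv_cos \<rho>)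
    finally show ?thesis .
  qed
  \<comment> \<open>Only sides other than \<open>i\<close>, \<open>j\<close> enter, and these agree.
    As \<open>r $ i + r $ j\<close> is also unchanged, the step affects only the value at the
    difference of the two sides.\<close>
  have cong: "arc_conv \<rho> (($) s) S = arc_conv \<rho> (($) r) S" for \<rho>
    using so by (auto simp: arc_conv_def S_def fun_eq_iff intro!: suminf_cong prod.cong)
  have "cos \<bar>r $ i - r $ j\<bar> \<le> cos \<bar>s $ i - s $ j\<bar>"
    proof (rule cos_monotone_0_pi_le)
    show "\<bar>r $ i - r $ j\<bar> \<le> pi" using r[rule_format, of i] r[rule_format, of j] by auto
  qed (use le in auto)
  then have cosle: "cos (r $ i - r $ j) \<le> cos (s $ i - s $ j)" by simp
  show ?thesis
  proof (rule tendsto_le[OF _ lim[of s] lim[of r]])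
    have "eventually (\<lambda>\<rho>::real. \<rho> \<in> {0<..<1}) (at_left 1)" by (intro eventually_at_leftI[of 0]) auto
    then show "eventually (\<lambda>\<rho>. \<rho> * (\<Sum>k. witten_term r k * \<rho> ^ k) \<le> \<rho> * (\<Sum>k. witten_term s k * \<rho> ^ k)) (at_left 1)"
    proof eventually_elim
      case (elim \<rho>)
      have "arc_conv \<rho> (($) r) S (r $ i - r $ j) \<le> arc_conv \<rho> (($) r) S (s $ i - s $ j)"
        using elim r by (intro arc_conv_mono cosle) auto
      then have "(arc_conv \<rho> (($) r) S (r $ i - r $ j) - arc_conv \<rho> (($) r) S (r $ i + r $ j)) / 2
        \<le> (arc_conv \<rho> (($) s) S (s $ i - s $ j) - arc_conv \<rho> (($) s) S (s $ i + s $ j)) / 2"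
        unfolding cong eq by simp
      then show ?case using elim by (subst (1 2) val) auto
    qed
  qed simp
qed

text \<open>With sides \<open>a + d\<close> and \<open>a - d\<close>, the identity \<open>(sin
  x)\<^sup>2 - sin (x + y) * sin (x - y) = (sin y)\<^sup>2\<close> makes the difference of the
  \<open>k\<close>-th terms equal to \<open>(sin (k d))\<^sup>2\<close> times an even power. The
  first one is positive because \<open>0 < \<bar>d\<bar> < pi\<close> and
  \<open>0 < a < pi\<close>.\<close>

lemma suminf_witten_term_strict:
  fixes s :: "real^'n::finite"
  assumes n: "CARD('n) \<ge> 3" and ev: "even CARD('n)" and ij: "i \<noteq> j"
    and s: "\<forall>k. s $ k \<in> {0<..<pi}" and a: "a \<in> {0<..<pi}"
    and so: "\<forall>k. k \<noteq> i \<longrightarrow> k \<noteq> j \<longrightarrow> s $ k = a"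
    and eq: "s $ i + s $ j = 2 * a" and ne: "s $ i \<noteq> a"
  shows "suminf (witten_term s) < suminf (witten_term (\<chi> k::'n. a))"
proof -
  define d where "d = s $ i - a"
  have si: "s $ i = a + d" "s $ j = a - d" using eq by (auto simp: d_def)
  let ?t = "\<lambda>k. witten_term (\<chi> k::'n. a) k - witten_term s k"
  have t: "?t k = (sin (real (Suc k) * d))\<^sup>2 * (sin (real (Suc k) * a) / real (Suc k)) ^ (CARD('n) - 2)" for k
  proof -
    have card: "card (UNIV - {i, j}) = CARD('n) - 2" using ij by (subst card_Diff_subset) auto
    have p: "(\<Prod>l\<in>UNIV - {i, j}. sin (real (Suc k) * s $ l) / real (Suc k)) = (sin (real (Suc k) * a) / real (Suc k)) ^ (CARD('n) - 2)"
      using so card by simp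
    have id: "(sin x)\<^sup>2 - sin (x + y) * sin (x - y) = (sin y)\<^sup>2" for x y :: real
    proof -
      have "sin (x + y) * sin (x - y) = (sin x)\<^sup>2 * (cos y)\<^sup>2 - (cos x)\<^sup>2 * (sin y)\<^sup>2"
        by (simp add: sin_add sin_diff power2_eq_square algebra_simps)
      then show ?thesis by (simp add: cos_squared_eq algebra_simps)
    qed
    have "?t k = ((sin (real (Suc k) * a))\<^sup>2 - sin (real (Suc k) * s $ i) * sin (real (Suc k) * s $ j)) *
        (sin (real (Suc k) * a) / real (Suc k)) ^ (CARD('n) - 2)"
      unfolding witten_term_split[OF ij] p using card by (simp add: power2_eq_square left_diff_distrib)
    then show ?thesis using id[of "real (Suc k) * a" "real (Suc k) * d"] by (simp add: si distrib_left right_diff_distrib)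
  qed
  have ev2: "even (CARD('n) - 2)" using ev n by simp
  have "0 < suminf ?t"
  proof (rule suminf_pos2)
    show "summable ?t" by (intro summable_diff summable_witten_term n)
    show "0 \<le> ?t k" for k unfolding t by (intro mult_nonneg_nonneg zero_le_even_power ev2) auto
    have "\<bar>d\<bar> < pi" "d \<noteq> 0" using s[rule_format, of i] a ne by (auto simp: d_def)
    then have "sin d \<noteq> 0" using sin_eq_0_pi[of d] by (auto simp: abs_less_iff)
    moreover have "sin a > 0" using a by (intro sin_gt_zero) auto
    ultimately show "0 < ?t 0" unfolding t by simp
  qed
  also have "suminf ?t = suminf (witten_term (\<chi> k::'n. a)) - suminf (witten_term s)"
    by (intro suminf_diff[symmetric] summable_witten_term n)
  finally show ?thesis by simp
qed

lemma V_S3_witten_term: "V_S3 (r :: real^'n::finite) = 2 ^ (CARD('n) - 1) / pi * suminf (witten_term r)"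
  by (simp add: V_S3_def witten_term_def[abs_def])

section \<open>Continuously differentiable maps\<close>

text \<open>Continuity of the derivative is required for each fixed direction, as in
  \<open>local_section\<close>.\<close>

definition C1_on :: "'a::real_normed_vector set \<Rightarrow> ('a \<Rightarrow> 'b::real_normed_vector) \<Rightarrow> bool" where
  "C1_on S f \<longleftrightarrow> (\<exists>f'. (\<forall>x\<in>S. (f has_derivative f' x) (at x)) \<and> (\<forall>h. continuous_on S (\<lambda>x. f' x h)))"

lemma C1_onI:
  assumes "\<And>x. x \<in> S \<Longrightarrow> (f has_derivative f' x) (at x)" "\<And>h. continuous_on S (\<lambda>x. f' x h)"
  shows "C1_on S f"
  using assms unfolding C1_on_def by blast

lemma C1_onE:
  assumes "C1_on S f"
  obtains f' where "\<And>x. x \<in> S \<Longrightarrow> (f has_derivative f' x) (at x)" "\<And>h. continuous_on S (\<lambda>x. f' x h)"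
  using assms unfolding C1_on_def by blast

lemma C1_on_frechet_derivative:
  assumes "C1_on S f"
  shows "\<And>x. x \<in> S \<Longrightarrow> (f has_derivative frechet_derivative f (at x)) (at x)"
    and "\<And>h. continuous_on S (\<lambda>x. frechet_derivative f (at x) h)"
proof -
  obtain f' where f': "\<And>x. x \<in> S \<Longrightarrow> (f has_derivative f' x) (at x)" "\<And>h. continuous_on S (\<lambda>x. f' x h)"
    using assms by (rule C1_onE) blast
  have eq: "f' x = frechet_derivative f (at x)" if "x \<in> S" for x
    by (rule frechet_derivative_at[OF f'(1)[OF that]])
  show "(f has_derivative frechet_derivative f (at x)) (at x)" if "x \<in> S" for x
    using f'(1)[OF that] eq[OF that] by simp
  show "continuous_on S (\<lambda>x. frechet_derivative f (at x) h)" for h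
    using f'(2)[of h] eq by (subst continuous_on_cong[OF refl, where g = "\<lambda>x. f' x h"]) simp_all
qed

lemma C1_on_imp_continuous_on: "C1_on S f \<Longrightarrow> continuous_on S f"
  by (metis C1_on_frechet_derivative(1) continuous_at_imp_continuous_on has_derivative_continuous)

lemma C1_on_const [intro!]: "C1_on S (\<lambda>x. c)"
  by (rule C1_onI[where f' = "\<lambda>x h. 0"]) auto

lemma C1_on_linear:
  assumes "bounded_linear L" "C1_on S f" shows "C1_on S (\<lambda>x. L (f x))"
proof -
  interpret bounded_linear L by fact
  obtain f' where f': "\<And>x. x \<in> S \<Longrightarrow> (f has_derivative f' x) (at x)" "\<And>h. continuous_on S (\<lambda>x. f' x h)"
    using assms(2) by (rule C1_onE) blast
  show ?thesis
    by (rule C1_onI[where f' = "\<lambda>x h. L (f' x h)"]) (intro has_derivative continuous_on f'; assumption)+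
qed

lemma C1_on_id [intro!]: "C1_on S (\<lambda>x. x)"
  by (rule C1_onI[where f' = "\<lambda>x h. h"]) auto

lemma C1_on_add [intro]: assumes "C1_on S f" "C1_on S g" shows "C1_on S (\<lambda>x. f x + g x)"
proof -
  obtain f' where f': "\<And>x. x \<in> S \<Longrightarrow> (f has_derivative f' x) (at x)" "\<And>h. continuous_on S (\<lambda>x. f' x h)"
    using assms(1) by (rule C1_onE) blast
  obtain g' where g': "\<And>x. x \<in> S \<Longrightarrow> (g has_derivative g' x) (at x)" "\<And>h. continuous_on S (\<lambda>x. g' x h)"
    using assms(2) by (rule C1_onE) blast
  show ?thesis
    by (rule C1_onI[where f' = "\<lambda>x h. f' x h + g' x h"]) (intro has_derivative_add continuous_on_add f' g'; assumption)+
qed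

text \<open>One product rule for multiplication, scaling, inner product and cross product.\<close>

lemma C1_on_bilinear:
  assumes "bounded_bilinear B" and f: "C1_on S f" and g: "C1_on S g"
  shows "C1_on S (\<lambda>x. B (f x) (g x))"
proof -
  interpret bounded_bilinear B by fact
  obtain f' where f': "\<And>x. x \<in> S \<Longrightarrow> (f has_derivative f' x) (at x)" "\<And>h. continuous_on S (\<lambda>x. f' x h)"
    using f by (rule C1_onE) blast
  obtain g' where g': "\<And>x. x \<in> S \<Longrightarrow> (g has_derivative g' x) (at x)" "\<And>h. continuous_on S (\<lambda>x. g' x h)"
    using g by (rule C1_onE) blast
  show ?thesis
    by (rule C1_onI[where f' = "\<lambda>x h. B (f x) (g' x h) + B (f' x h) (g x)"])
       (intro FDERIV f' g' continuous_on_add continuous_on f[THEN C1_on_imp_continuous_on] g[THEN C1_on_imp_continuous_on]; assumption?)+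
qed

lemmas C1_on_mult [intro] = C1_on_bilinear[OF bounded_bilinear_mult]
lemmas C1_on_scaleR [intro] = C1_on_bilinear[OF bounded_bilinear_scaleR]
lemmas C1_on_inner [intro] = C1_on_bilinear[OF bounded_bilinear_inner]
lemmas C1_on_minus [intro] = C1_on_linear[OF bounded_linear_minus[OF bounded_linear_ident]]
lemmas C1_on_vec_nth [intro] = C1_on_linear[OF bounded_linear_vec_nth]

lemma C1_on_diff [intro]: "C1_on S f \<Longrightarrow> C1_on S g \<Longrightarrow> C1_on S (\<lambda>x. f x - g x)"
  using C1_on_add[OF _ C1_on_minus, of S f g] by simp

lemma bounded_bilinear_cross3: "bounded_bilinear cross3"
  using bilinear_cross bilinear_conv_bounded_bilinear by blast

lemmas C1_on_cross3 [intro] = C1_on_bilinear[OF bounded_bilinear_cross3]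

lemma C1_on_sum [intro]:
  assumes "\<And>i. i \<in> I \<Longrightarrow> C1_on S (f i)" shows "C1_on S (\<lambda>x. \<Sum>i\<in>I. f i x)"
  using assms by (induction I rule: infinite_finite_induct) auto

lemma norm_axis: "norm (axis i x :: 'b::real_normed_vector^'n) = norm x"
proof -
  have "(\<Sum>j\<in>UNIV. (norm ((axis i x :: 'b^'n) $ j))\<^sup>2) = (\<Sum>j\<in>UNIV. if j = i then (norm x)\<^sup>2 else 0)"
    by (rule sum.cong) (auto simp: axis_def)
  then show ?thesis by (simp add: norm_vec_def L2_set_def)
qed

lemma C1_on_vec_lambda [intro]:
  fixes f :: "'a::real_normed_vector \<Rightarrow> 'n::finite \<Rightarrow> 'b::real_normed_vector"
  assumes "\<And>i. C1_on S (\<lambda>x. f x i)" shows "C1_on S (\<lambda>x. \<chi> i. f x i)"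
proof -
  have "bounded_linear (axis i :: 'b \<Rightarrow> 'b^'n)" for i
  proof (rule bounded_linear_intro[where K = 1])
    show "axis i (x + y) = axis i x + axis i y" for x y :: 'b by (simp add: axis_def vec_eq_iff)
    show "axis i (c *\<^sub>R x) = c *\<^sub>R axis i x" for c and x :: 'b by (simp add: axis_def vec_eq_iff)
    show "norm (axis i x) \<le> norm x * 1" for x :: 'b by (simp add: norm_axis)
  qed
  then have "C1_on S (\<lambda>x. \<Sum>i\<in>UNIV. axis i (f x i))"
    by (intro C1_on_sum C1_on_linear[of "axis _"] assms)
  moreover have "(\<Sum>i\<in>UNIV. axis i (y i)) = (\<chi> i. y i)" for y :: "'n \<Rightarrow> 'b"
    by (simp add: vec_eq_iff axis_def)
  ultimately show ?thesis by simp
qed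

lemma C1_on_real_compose:
  fixes f :: "'a::real_normed_vector \<Rightarrow> real"
  assumes f: "C1_on S f" and g: "\<And>t. t \<in> T \<Longrightarrow> (g has_real_derivative g' t) (at t)" "continuous_on T g'" and T: "f ` S \<subseteq> T"
  shows "C1_on S (\<lambda>x. g (f x))"
proof -
  obtain f' where f': "\<And>x. x \<in> S \<Longrightarrow> (f has_derivative f' x) (at x)" "\<And>h. continuous_on S (\<lambda>x. f' x h)"
    using f by (rule C1_onE) blast
  show ?thesis
  proof (rule C1_onI[where f' = "\<lambda>x h. g' (f x) * f' x h"])
    fix x assume "x \<in> S"
    then have "(g has_derivative (\<lambda>h. g' (f x) * h)) (at (f x))"
      using g(1)[of "f x"] T by (auto simp: has_field_derivative_def)
    from has_derivative_compose[OF f'(1)[OF \<open>x \<in> S\<close>] this]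
    show "((\<lambda>x. g (f x)) has_derivative (\<lambda>h. g' (f x) * f' x h)) (at x)" .
  next
    show "continuous_on S (\<lambda>x. g' (f x) * f' x h)" for h
      using continuous_on_compose2[OF g(2) C1_on_imp_continuous_on[OF f] T] f'(2) by (intro continuous_intros)
  qed
qed

lemma C1_on_inverse:
  fixes f :: "'a::real_normed_vector \<Rightarrow> real"
  assumes "C1_on S f" "\<And>x. x \<in> S \<Longrightarrow> f x \<noteq> 0"
  shows "C1_on S (\<lambda>x. inverse (f x))"
  by (rule C1_on_real_compose[OF assms(1), where T = "-{0}" and g' = "\<lambda>t. - (inverse t * 1 * inverse t)"])
     (use assms(2) in \<open>auto intro!: derivative_eq_intros continuous_intros\<close>)

lemma C1_on_divide:
  fixes f :: "'a::real_normed_vector \<Rightarrow> real"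
  assumes "C1_on S f" "C1_on S g" "\<And>x. x \<in> S \<Longrightarrow> g x \<noteq> 0"
  shows "C1_on S (\<lambda>x. f x / g x)"
  using C1_on_mult[OF assms(1) C1_on_inverse[OF assms(2,3)]] by (simp add: divide_inverse)

lemma C1_on_sqrt:
  fixes f :: "'a::real_normed_vector \<Rightarrow> real"
  assumes "C1_on S f" "\<And>x. x \<in> S \<Longrightarrow> f x > 0"
  shows "C1_on S (\<lambda>x. sqrt (f x))"
  by (rule C1_on_real_compose[OF assms(1), where T = "{0<..}" and g' = "\<lambda>t. inverse (sqrt t) / 2"])
     (use assms(2) in \<open>auto intro!: DERIV_real_sqrt continuous_intros\<close>)

text \<open>The derivative is determined by the map. New sections can therefore be given by the map
  alone, with \<open>frechet_derivative\<close> as the second datum.\<close>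

lemma local_section_iff_C1_on:
  "local_section r U \<phi> \<phi>' \<longleftrightarrow>
     open U \<and> \<phi> ` U \<subseteq> regular_level r \<and> C1_on U \<phi> \<and> (\<forall>x\<in>U. \<phi>' x = frechet_derivative \<phi> (at x)) \<and>
     (\<forall>x\<in>U. \<forall>y\<in>U. (\<phi> x, \<phi> y) \<in> so3_rel \<longrightarrow> x = y)"
proof -
  have "(\<forall>x\<in>U. (\<phi> has_derivative \<phi>' x) (at x)) \<and> (\<forall>h. continuous_on U (\<lambda>x. \<phi>' x h)) \<longleftrightarrow>
    C1_on U \<phi> \<and> (\<forall>x\<in>U. \<phi>' x = frechet_derivative \<phi> (at x))" (is "?L \<longleftrightarrow> ?R")
  proof
    assume ?L then show ?R by (auto intro: C1_onI frechet_derivative_at)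
  next
    assume R: ?R
    from R have "continuous_on U (\<lambda>x. \<phi>' x h)" for h
      by (subst continuous_on_cong[OF refl, where g = "\<lambda>x. frechet_derivative \<phi> (at x) h"])
         (auto intro: C1_on_frechet_derivative(2))
    moreover have "(\<phi> has_derivative \<phi>' x) (at x)" if "x \<in> U" for x
      using C1_on_frechet_derivative(1)[of U \<phi> x] R that by simp
    ultimately show ?L by simp
  qed
  then show ?thesis by (simp only: local_section_def conj_assoc[symmetric])
qed

text \<open>Near a zero \<open>x\<close>, take a direction \<open>h\<close> along which
  \<open>g\<close> increases and look at the level set from \<open>a = x - h\<close>. Every ray from
  \<open>a\<close> crosses it with positive derivative, hence at most once inside a small ball, and
  a closed set that each ray from a point meets at most once is null.\<close>

lemma negligible_regular_level_set:
  fixes g :: "'a::euclidean_space \<Rightarrow> real"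
  assumes U: "open U" and g: "\<And>x. x \<in> U \<Longrightarrow> (g has_derivative g' x) (at x)" "\<And>h. continuous_on U (\<lambda>x. g' x h)"
  shows "negligible {x \<in> U. g x = 0 \<and> (\<exists>h. g' x h \<noteq> 0)}" (is "negligible ?S")
proof (rule locally_negligible_alt[THEN iffD2, rule_format])
  fix x assume x: "x \<in> ?S"
  have lin: "linear (g' y)" if "y \<in> U" for y using g(1)[OF that] has_derivative_linear by blast
  obtain h where h: "g' x h > 0"
  proof -
    obtain h where "g' x h \<noteq> 0" using x by auto
    moreover have "g' x (- h) = - g' x h" using lin[of x] x by (intro linear_neg) auto
    ultimately show ?thesis using that[of h] that[of "- h"] by linarith
  qed
  define a where "a = x - h"
  \<comment> \<open>The derivative in the direction away from \<open>a\<close>, written in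
    coordinates: its continuity in \<open>y\<close> then follows from continuity for each fixed
    basis vector.\<close>
  define q where "q y = (\<Sum>b\<in>Basis. ((y - a) \<bullet> b) * g' y b)" for y
  have q: "q y = g' y (y - a)" if "y \<in> U" for y
  proof -
    have "g' y (y - a) = g' y (\<Sum>b\<in>Basis. ((y - a) \<bullet> b) *\<^sub>R b)" by (simp add: euclidean_representation)
    also have "\<dots> = q y" using lin[OF that] by (simp add: q_def linear_sum linear_cmul)
    finally show ?thesis by simp
  qed
  have "continuous_on U q" unfolding q_def using g(2) by (intro continuous_intros)
  moreover have "q x > 0" using q[of x] x h by (simp add: a_def)
  ultimately obtain e where e: "e > 0" "\<And>y. y \<in> U \<Longrightarrow> dist y x < e \<Longrightarrow> \<bar>q y - q x\<bar> < q x"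
    using x unfolding continuous_on_iff dist_real_def by blast
  obtain e2 where e2: "e2 > 0" "cball x e2 \<subseteq> U" using U x open_contains_cball by blast
  define d where "d = min (e / 2) e2"
  have d: "d > 0" "cball x d \<subseteq> U" "\<And>y. y \<in> cball x d \<Longrightarrow> g' y (y - a) > 0"
  proof -
    show "d > 0" "cball x d \<subseteq> U" using e e2 by (auto simp: d_def)
    fix y assume y: "y \<in> cball x d"
    then have "y \<in> U" "dist y x < e" using e e2 by (auto simp: d_def dist_commute)
    then show "g' y (y - a) > 0" using e(2)[of y] q[of y] by simp
  qed
  define T where "T = {y \<in> cball x d. g y = 0}"
  have "closed T"
  proof -
    have "continuous_on (cball x d) g"
      using d(2) g(1) by (meson continuous_at_imp_continuous_on has_derivative_continuous subsetD)
    then show ?thesis unfolding T_def by (intro continuous_closed_preimage_constant) auto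
  qed
  \<comment> \<open>Between two zeros on one ray, the mean value theorem gives a point with
    vanishing radial derivative; by convexity it still lies in the ball.\<close>
  have star: False if ab: "s < t" "0 \<le> s" "a + s *\<^sub>R v \<in> T" "a + t *\<^sub>R v \<in> T" for s t v
  proof -
    have cb: "a + l *\<^sub>R v \<in> cball x d" if l: "s \<le> l" "l \<le> t" for l
    proof -
      define \<mu> where "\<mu> = (l - s) / (t - s)"
      have \<mu>: "0 \<le> \<mu>" "\<mu> \<le> 1" "l = s + \<mu> * (t - s)" using l ab by (auto simp: \<mu>_def)
      have "a + l *\<^sub>R v = (1 - \<mu>) *\<^sub>R (a + s *\<^sub>R v) + \<mu> *\<^sub>R (a + t *\<^sub>R v)"
        unfolding \<mu>(3) by (simp add: algebra_simps)
      moreover have "(1 - \<mu>) *\<^sub>R (a + s *\<^sub>R v) + \<mu> *\<^sub>R (a + t *\<^sub>R v) \<in> cball x d"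
        using \<mu> ab by (intro convexD[OF convex_cball]) (auto simp: T_def)
      ultimately show ?thesis by simp
    qed
    define p where "p l = g (a + l *\<^sub>R v)" for l
    have der: "(p has_real_derivative g' (a + l *\<^sub>R v) v) (at l)" if l: "s \<le> l" "l \<le> t" for l
    proof -
      have U: "a + l *\<^sub>R v \<in> U" using cb[OF l] d by blast
      have "((\<lambda>l. a + l *\<^sub>R v) has_derivative (\<lambda>h. h *\<^sub>R v)) (at l)" by (auto intro!: derivative_eq_intros)
      from has_derivative_compose[OF this g(1)[OF U]]
      have "(p has_derivative (\<lambda>h. g' (a + l *\<^sub>R v) (h *\<^sub>R v))) (at l)" unfolding p_def .
      then show ?thesis unfolding has_field_derivative_def using lin[OF U] by (simp add: linear_cmul mult.commute[of _ "g' (a + l *\<^sub>R v) v"])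
    qed
    obtain l where l: "s < l" "l < t" "p t - p s = (t - s) * g' (a + l *\<^sub>R v) v"
      using MVT2[OF ab(1), of p "\<lambda>l. g' (a + l *\<^sub>R v) v"] der by metis
    have "g' (a + l *\<^sub>R v) v = 0" using l ab by (simp add: p_def T_def)
    moreover have "a + l *\<^sub>R v \<in> U" using cb[of l] l d by auto
    ultimately have "g' (a + l *\<^sub>R v) (a + l *\<^sub>R v - a) = 0" using lin by (simp add: linear_cmul)
    then show False using d(3)[OF cb, of l] l by auto
  qed
  have "negligible T"
  proof (rule starlike_negligible[OF \<open>closed T\<close>, of a])
    fix c y assume "a + c *\<^sub>R y \<in> T" "0 \<le> c" "a + y \<in> T"
    then show "c = 1" using star[of c 1 y] star[of 1 c y] by (cases c "1::real" rule: linorder_cases) auto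
  qed
  moreover have "?S \<inter> ball x d \<subseteq> T" by (auto simp: T_def)
  ultimately have "negligible (?S \<inter> ball x d)" by (rule negligible_subset)
  moreover have "openin (top_of_set ?S) (?S \<inter> ball x d)" by (rule openin_open_Int) simp
  moreover have "x \<in> ?S \<inter> ball x d" using x d(1) by (intro IntI) simp_all
  ultimately show "\<exists>V. openin (top_of_set ?S) V \<and> x \<in> V \<and> negligible V" by (intro exI conjI)
qed

lemmas C1_intros = C1_on_const C1_on_id C1_on_add C1_on_diff C1_on_mult C1_on_scaleR C1_on_inner C1_on_minus
  C1_on_vec_nth C1_on_cross3 C1_on_sum C1_on_vec_lambda C1_on_divide C1_on_sqrt

section \<open>Polygons with two parallel edges\<close>

lemma has_derivative_const_on_open:
  assumes "open U" "x \<in> U" "(g has_derivative g') (at x)" "\<And>y. y \<in> U \<Longrightarrow> g y = c"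
  shows "g' = (\<lambda>h. 0)"
proof -
  have "((\<lambda>_. c) has_derivative g') (at x)"
    by (rule has_derivative_transform_within_open[OF assms(3,1,2)]) (rule assms(4))
  then show ?thesis by (rule has_derivative_unique) (rule has_derivative_const)
qed

text \<open>The transposed Gram matrix maps the coordinates of \<open>h\<close> to the values of
  \<open>B h\<close> on the standard basis, so its kernel is the radical of \<open>B\<close>. Zeros
  of the Liouville density thus become a question about the form itself.\<close>

lemma det_bilinear_form_nz_iff:
  fixes B :: "real^'k::finite \<Rightarrow> real^'k \<Rightarrow> real"
  assumes B: "bilinear B"
  shows "det (\<chi> i j. B (axis i 1) (axis j 1)) \<noteq> 0 \<longleftrightarrow> (\<forall>h. (\<forall>h'. B h h' = 0) \<longrightarrow> h = 0)"
proof -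
  define M where "M = (\<chi> i j. B (axis i 1) (axis j 1))"
  have lin: "linear (B x)" "linear (\<lambda>x. B x y)" for x y using B unfolding bilinear_def by auto
  have rep: "h = (\<Sum>i\<in>UNIV. h $ i *\<^sub>R axis i 1)" for h :: "real^'k"
    using basis_expansion[of h] by (simp add: scalar_mult_eq_scaleR)
  have col: "(transpose M *v h) $ j = B h (axis j 1)" for h j
  proof -
    have "B h (axis j 1) = B (\<Sum>i\<in>UNIV. h $ i *\<^sub>R axis i 1) (axis j 1)" using rep[of h] by simp
    also have "\<dots> = (\<Sum>i\<in>UNIV. h $ i * B (axis i 1) (axis j 1))"
      using lin(2)[of "axis j 1"] by (simp add: linear_sum[OF lin(2)] linear_cmul[OF lin(2)])
    finally show ?thesis by (simp add: matrix_vector_mult_def transpose_def M_def mult.commute)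
  qed
  have "(\<forall>h'. B h h' = 0) \<longleftrightarrow> (\<forall>j. B h (axis j 1) = 0)" for h
  proof
    assume *: "\<forall>j. B h (axis j 1) = 0"
    have "B h h' = 0" for h'
    proof -
      have "B h h' = B h (\<Sum>i\<in>UNIV. h' $ i *\<^sub>R axis i 1)" using rep[of h'] by simp
      also have "\<dots> = 0" by (simp add: linear_sum[OF lin(1)] linear_cmul[OF lin(1)] *)
      finally show ?thesis .
    qed
    then show "\<forall>h'. B h h' = 0" by simp
  qed simp
  then have "(\<forall>h'. B h h' = 0) \<longleftrightarrow> transpose M *v h = 0" for h
    using col by (auto simp: vec_eq_iff)
  then have "(\<forall>h. (\<forall>h'. B h h' = 0) \<longrightarrow> h = 0) \<longleftrightarrow> (\<forall>h. transpose M *v h = 0 \<longrightarrow> h = 0)" by simp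
  also have "\<dots> \<longleftrightarrow> invertible (transpose M)"
    unfolding invertible_left_inverse matrix_left_invertible_ker ..
  also have "\<dots> \<longleftrightarrow> det M \<noteq> 0" by (simp add: invertible_det_nz)
  finally show ?thesis by (simp add: M_def)
qed

lemma bilinear_symp_form_linear:
  assumes "linear D" shows "bilinear (\<lambda>h h'. symp_form r u (D h) (D h'))"
  unfolding bilinear_def symp_form_def
  by (auto intro!: linearI simp: linear_add[OF assms] linear_cmul[OF assms] cross_add_left cross_add_right
      cross_mult_left cross_mult_right inner_add_right inner_scaleR_right distrib_left sum.distrib sum_distrib_left mult_ac)

text \<open>For a nonzero \<open>\<eta>\<close>, all edges would be multiples of it. In other words,
  rotations act infinitesimally freely on nondegenerate polygons.\<close>

lemma not_degenerate_cross3_eq_0: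
  assumes "\<not> degenerate u" "\<And>k. cross3 \<eta> (u $ k) = 0" shows "\<eta> = 0"
proof (rule ccontr)
  assume \<eta>: "\<eta> \<noteq> 0"
  have "\<exists>c. u $ k = c *\<^sub>R \<eta>" for k
    using assms(2)[of k] \<eta> unfolding cross_eq_0 collinear_lemma by (metis scale_zero_left)
  then obtain c where c: "\<And>k. u $ k = c k *\<^sub>R \<eta>" by metis
  have "\<exists>d. x = d *\<^sub>R \<eta>" if "x \<in> insert 0 (range (($) u))" for x
    using that c by (auto intro: exI[of _ 0])
  then have "collinear (insert 0 (range (($) u)))"
    unfolding collinear_def by (intro exI[of _ \<eta>] ballI) (metis scaleR_left_diff_distrib)
  then show False using assms(1) by (simp add: degenerate_def)
qed

lemma not_degenerateI: "cross3 (u $ i) (u $ j) \<noteq> 0 \<Longrightarrow> \<not> degenerate u"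
  unfolding degenerate_def cross_eq_0 by (auto dest: collinear_subset[of _ "{0, u $ i, u $ j}"])

text \<open>The constraints, unit edges and closure, hold on the whole open domain and can be
  differentiated.\<close>

lemma local_section_tangent:
  assumes L: "local_section r U \<phi> \<phi>'" and x: "x \<in> U"
  shows "linear (\<phi>' x)" "(\<phi> has_derivative \<phi>' x) (at x)" "norm (\<phi> x $ k) = 1" "\<phi>' x h $ k \<bullet> \<phi> x $ k = 0"
    "(\<Sum>k\<in>UNIV. r $ k *\<^sub>R \<phi> x $ k) = 0" "(\<Sum>k\<in>UNIV. r $ k *\<^sub>R \<phi>' x h $ k) = 0" "\<not> degenerate (\<phi> x)"
proof -
  have U: "open U" and reg: "\<And>y. y \<in> U \<Longrightarrow> \<phi> y \<in> regular_level r"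
    and der: "(\<phi> has_derivative \<phi>' x) (at x)" using L x by (auto simp: local_section_def)
  show "(\<phi> has_derivative \<phi>' x) (at x)" "linear (\<phi>' x)" using der has_derivative_linear by auto
  show "norm (\<phi> x $ k) = 1" "(\<Sum>k\<in>UNIV. r $ k *\<^sub>R \<phi> x $ k) = 0" "\<not> degenerate (\<phi> x)"
    using reg[OF x] by (auto simp: regular_level_def zero_level_def moment_map_def)
  have dk: "((\<lambda>y. \<phi> y $ k) has_derivative (\<lambda>h. \<phi>' x h $ k)) (at x)" for k
    using bounded_linear.has_derivative[OF bounded_linear_vec_nth der] .
  have "((\<lambda>y. \<phi> y $ k \<bullet> \<phi> y $ k) has_derivative (\<lambda>h. \<phi> x $ k \<bullet> \<phi>' x h $ k + \<phi>' x h $ k \<bullet> \<phi> x $ k)) (at x)"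
    by (intro has_derivative_inner dk)
  from has_derivative_const_on_open[OF U x this, of 1]
  have "\<phi> x $ k \<bullet> \<phi>' x h $ k + \<phi>' x h $ k \<bullet> \<phi> x $ k = 0"
    using reg by (auto simp: regular_level_def zero_level_def norm_eq_1 fun_eq_iff)
  then show "\<phi>' x h $ k \<bullet> \<phi> x $ k = 0" by (simp add: inner_commute)
  have "((\<lambda>y. \<Sum>k\<in>UNIV. r $ k *\<^sub>R \<phi> y $ k) has_derivative (\<lambda>h. \<Sum>k\<in>UNIV. r $ k *\<^sub>R \<phi>' x h $ k)) (at x)"
    by (intro has_derivative_sum has_derivative_scaleR_right dk)
  from has_derivative_const_on_open[OF U x this, of 0]
  show "(\<Sum>k\<in>UNIV. r $ k *\<^sub>R \<phi>' x h $ k) = 0"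
    using reg by (auto simp: regular_level_def zero_level_def moment_map_def fun_eq_iff)
qed

lemma CARD_chart_dim_ge_4: "CARD('n::finite) \<ge> 4 \<Longrightarrow> CARD('n chart_dim) = 2 * CARD('n) - 6"
  by (simp add: CARD_chart_dim)

text \<open>The space is orthogonal to \<open>n + 4\<close> pairwise orthogonal nonzero vectors in
  dimension \<open>3 n\<close>: three in each of the slots \<open>a\<close>, \<open>b\<close> and
  one normal \<open>u $ k\<close> in every other slot.\<close>

lemma dim_tangent_slots_le:
  fixes u :: "(real^3)^'n::finite"
  assumes u: "\<And>k. norm (u $ k) = 1" and ab: "a \<noteq> b"
  shows "dim {v :: (real^3)^'n. v $ a = 0 \<and> v $ b = 0 \<and> (\<forall>k. v $ k \<bullet> u $ k = 0)} \<le> 2 * CARD('n) - 4"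
proof -
  define P where "P = (SIGMA k:UNIV. if k \<in> {a, b} then Basis else {u $ k})"
  define A where "A = (\<lambda>(k, x). axis k x :: (real^3)^'n) ` P"
  have u0: "u $ k \<noteq> 0" for k using u[of k] by auto
  have x0: "x \<noteq> 0" if "(k, x) \<in> P" for k x
    using that u0 nonzero_Basis by (auto simp: P_def split: if_splits)
  have orth: "x \<bullet> y = 0" if "(k, x) \<in> P" "(k, y) \<in> P" "x \<noteq> y" for k x y
    using that inner_not_same_Basis by (auto simp: P_def split: if_splits)
  have "pairwise orthogonal A"
    unfolding A_def pairwise_def orthogonal_def
    by (auto simp: inner_axis_axis dest: orth)
  moreover have "0 \<notin> A" unfolding A_def using x0 by (auto simp: axis_eq_0_iff)
  ultimately have ind: "independent A" by (rule pairwise_orthogonal_independent)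
  have inj: "inj_on (\<lambda>(k, x). axis k x :: (real^3)^'n) P"
    by (auto simp: inj_on_def axis_eq_axis dest: x0)
  have "card P = (\<Sum>k\<in>UNIV. card (if k \<in> {a, b} then Basis else {u $ k}))"
    unfolding P_def by (rule card_SigmaI) auto
  also have "\<dots> = (\<Sum>k\<in>UNIV. if k \<in> {a, b} then 3 else 1)" by (rule sum.cong) auto
  also have "\<dots> = (\<Sum>k\<in>{a, b}. 3) + (\<Sum>k\<in>UNIV - {a, b}. 1)"
    by (subst sum.If_cases) (simp_all only: finite Collect_mem_eq Int_UNIV_left Compl_eq_Diff_UNIV)
  also have "\<dots> = CARD('n) - 2 + 6" using ab by (simp add: card_Diff_subset)
  finally have cA: "card A = CARD('n) - 2 + 6" unfolding A_def using card_image[OF inj] by simp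
  have "dim (span A) = CARD('n) + 4"
    using ind cA card_mono[of UNIV "{a, b}"] ab by (simp add: dim_eq_card_independent)
  moreover have "dim {y \<in> UNIV. \<forall>x\<in>span A. orthogonal x y} + dim (span A) = 3 * CARD('n)"
    using dim_subspace_orthogonal_to_vectors[of "span A" UNIV] by simp
  moreover have "dim {v :: (real^3)^'n. v $ a = 0 \<and> v $ b = 0 \<and> (\<forall>k. v $ k \<bullet> u $ k = 0)} \<le> dim {y \<in> UNIV. \<forall>x\<in>span A. orthogonal x y}"
  proof (rule dim_subset)
    show "{v :: (real^3)^'n. v $ a = 0 \<and> v $ b = 0 \<and> (\<forall>k. v $ k \<bullet> u $ k = 0)} \<subseteq> {y \<in> UNIV. \<forall>x\<in>span A. orthogonal x y}"
  proof clarsimp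
    fix v x :: "(real^3)^'n" assume v: "v $ a = 0" "v $ b = 0" "\<forall>k. v $ k \<bullet> u $ k = 0" and x: "x \<in> span A"
    have "orthogonal v x"
    proof (rule orthogonal_to_span[OF x])
      fix y assume "y \<in> A"
      then obtain k x where y: "y = axis k x" "(k, x) \<in> P" unfolding A_def by auto
      have "v $ k \<bullet> x = 0" using y(2) v by (cases "k \<in> {a, b}") (auto simp: P_def)
      then show "orthogonal v y" unfolding orthogonal_def y(1) inner_axis .
    qed
    then show "orthogonal x v" by (simp add: orthogonal_commute)
  qed
  qed
  ultimately show ?thesis by linarith
qed

text \<open>
  If the form were nondegenerate on the velocities \<open>D h\<close>, these would be independent of the infinitesimal
  rotations, on which it vanishes, and together they would span a space of dimension \<open>2n - 3\<close>. But
  with edges \<open>i, j\<close> moving parallel, there are only \<open>2n - 4\<close> degrees of freedom: omit \<open>j\<close> and any further edge \<open>k0\<close>.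
\<close>

lemma parallel_pair_det_eq_0:
  fixes r :: "real^'n::finite" and u :: "(real^3)^'n" and D :: "real^('n chart_dim) \<Rightarrow> (real^3)^'n"
  assumes n: "CARD('n) \<ge> 4" and ij: "i \<noteq> j" and r: "\<And>k. r $ k \<noteq> 0"
    and u: "\<And>k. norm (u $ k) = 1" "(\<Sum>k\<in>UNIV. r $ k *\<^sub>R u $ k) = 0" "\<not> degenerate u"
    and D: "linear D" "\<And>h k. D h $ k \<bullet> u $ k = 0" "\<And>h. (\<Sum>k\<in>UNIV. r $ k *\<^sub>R D h $ k) = 0"
    and par: "u $ j = \<sigma> *\<^sub>R u $ i" "\<And>h. D h $ j = \<sigma> *\<^sub>R D h $ i"
  shows "det (\<chi> a b. symp_form r u (D (axis a 1)) (D (axis b 1))) = 0"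
proof (rule ccontr)
  assume "\<not> ?thesis"
  then have nd: "h = 0" if "\<And>h'. symp_form r u (D h) (D h') = 0" for h
    using det_bilinear_form_nz_iff[OF bilinear_symp_form_linear[OF D(1)], of r u] that by blast
  have "\<not> UNIV \<subseteq> {i, j}"
  proof
    assume "UNIV \<subseteq> {i, j}"
    then have "CARD('n) \<le> card {i, j}" by (intro card_mono) auto
    then show False using n ij by simp
  qed
  then obtain k0 where k0: "k0 \<noteq> i" "k0 \<noteq> j" by blast
  \<comment> \<open>Velocity of the section plus the infinitesimal rotation about
    \<open>snd p\<close>; \<open>Pr\<close> then forgets the slots \<open>j\<close> and
    \<open>k0\<close>.\<close>
  define \<Theta> where "\<Theta> p = (\<chi> k. D (fst p) $ k + cross3 (snd p) (u $ k))" for p :: "(real^('n chart_dim)) \<times> (real^3)"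
  define Pr where "Pr p = (\<chi> k. if k = j \<or> k = k0 then 0 else \<Theta> p $ k)" for p
  have lin\<Theta>: "linear \<Theta>"
    unfolding \<Theta>_def by (rule linearI) (auto simp: vec_eq_iff linear_add[OF D(1)] linear_cmul[OF D(1)] cross_add_left cross_mult_left algebra_simps)
  have lin: "linear Pr"
    unfolding Pr_def by (rule linearI) (auto simp: vec_eq_iff linear_add[OF lin\<Theta>] linear_cmul[OF lin\<Theta>])
  have K: "\<Theta> p $ k \<bullet> u $ k = 0" "\<Theta> p $ j = \<sigma> *\<^sub>R \<Theta> p $ i" "(\<Sum>k\<in>UNIV. r $ k *\<^sub>R \<Theta> p $ k) = 0" for p k
  proof -
    show "\<Theta> p $ k \<bullet> u $ k = 0" by (simp add: \<Theta>_def inner_add_left D(2) dot_cross_self)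
    show "\<Theta> p $ j = \<sigma> *\<^sub>R \<Theta> p $ i" by (simp add: \<Theta>_def par cross_mult_right scaleR_right_distrib)
    have "(\<Sum>k\<in>UNIV. r $ k *\<^sub>R \<Theta> p $ k) = (\<Sum>k\<in>UNIV. r $ k *\<^sub>R D (fst p) $ k) + (\<Sum>k\<in>UNIV. cross3 (snd p) (r $ k *\<^sub>R u $ k))"
      by (simp add: \<Theta>_def scaleR_right_distrib sum.distrib cross_mult_right)
    also have "(\<Sum>k\<in>UNIV. cross3 (snd p) (r $ k *\<^sub>R u $ k)) = cross3 (snd p) (\<Sum>k\<in>UNIV. r $ k *\<^sub>R u $ k)"
      by (simp add: bounded_bilinear.sum_right[OF bounded_bilinear_cross3])
    finally show "(\<Sum>k\<in>UNIV. r $ k *\<^sub>R \<Theta> p $ k) = 0" by (simp add: D(3) u(2))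
  qed
  \<comment> \<open>Nothing is lost by forgetting: slot \<open>j\<close> is \<open>\<sigma>\<close>
    times slot \<open>i\<close>, and then slot \<open>k0\<close> follows from the closing condition
    because \<open>r $ k0 \<noteq> 0\<close>.\<close>
  have ker: "p = 0" if p: "Pr p = 0" for p
  proof -
    have nk: "\<Theta> p $ k = 0" if "k \<noteq> j" "k \<noteq> k0" for k using arg_cong[OF p, of "\<lambda>v. v $ k"] that by (simp add: Pr_def)
    then have nj: "\<Theta> p $ j = 0" using K(2)[of p] ij k0 by auto
    have "(\<Sum>k\<in>UNIV. r $ k *\<^sub>R \<Theta> p $ k) = (\<Sum>k\<in>{k0}. r $ k *\<^sub>R \<Theta> p $ k)"
    proof (rule sum.mono_neutral_right; simp; intro ballI)
      fix k assume "k \<in> UNIV - {k0}"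
      then show "r $ k = 0 \<or> \<Theta> p $ k = 0" using nk nj by (cases "k = j") auto
    qed
    then have "\<Theta> p $ k0 = 0" using K(3)[of p] r by simp
    then have z: "D (fst p) $ k = - cross3 (snd p) (u $ k)" for k
      using nk[of k] nj by (cases "k = j"; cases "k = k0") (auto simp: \<Theta>_def add_eq_0_iff2)
    \<comment> \<open>Here \<open>D (fst p)\<close> is an infinitesimal rotation. Pairing it with a
      velocity gives, up to sign, a component of the derivative of the moment map along that
      velocity, which is zero.\<close>
    have "symp_form r u (D (fst p)) (D h') = 0" for h'
    proof -
      have "u $ k \<bullet> cross3 (D (fst p) $ k) (D h' $ k) = - (snd p \<bullet> D h' $ k)" for k
      proof -
        have "cross3 (cross3 e w) v = (e \<bullet> v) *\<^sub>R w - (w \<bullet> v) *\<^sub>R e" for e w v :: "real^3"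
          by (metis Lagrange cross_skew inner_commute minus_diff_eq)
        then have "u $ k \<bullet> cross3 (cross3 (snd p) (u $ k)) (D h' $ k) = (snd p \<bullet> D h' $ k) * (u $ k \<bullet> u $ k)"
          using D(2)[of h' k] by (simp add: inner_diff_right inner_commute)
        moreover have "u $ k \<bullet> u $ k = 1" using u(1)[of k] by (simp add: norm_eq_1)
        ultimately show ?thesis unfolding z by simp
      qed
      then have "symp_form r u (D (fst p)) (D h') = - (snd p \<bullet> (\<Sum>k\<in>UNIV. r $ k *\<^sub>R D h' $ k))"
        by (simp add: symp_form_def inner_sum_right sum_negf)
      then show ?thesis by (simp add: D(3))
    qed
    then have "fst p = 0" by (rule nd)
    moreover have "snd p = 0"
      by (rule not_degenerate_cross3_eq_0[OF u(3)]) (use z \<open>fst p = 0\<close> linear_0[OF D(1)] in auto)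
    ultimately show ?thesis by (simp add: prod_eq_iff)
  qed
  then have "inj Pr" using lin linear_injective_0 by blast
  then have "dim (range Pr) = DIM((real^('n chart_dim)) \<times> (real^3))"
    using dim_image_eq[OF lin, of UNIV] by (simp add: inj_on_subset)
  also have "\<dots> = 2 * CARD('n) - 3" using n by (simp add: CARD_chart_dim_ge_4)
  finally have dim1: "dim (range Pr) = 2 * CARD('n) - 3" .
  have "range Pr \<subseteq> {v. v $ j = 0 \<and> v $ k0 = 0 \<and> (\<forall>k. v $ k \<bullet> u $ k = 0)}"
    using K(1) by (auto simp: Pr_def)
  then have "dim (range Pr) \<le> dim {v. v $ j = 0 \<and> v $ k0 = 0 \<and> (\<forall>k. v $ k \<bullet> u $ k = 0)}"
    by (rule dim_subset)
  also have "\<dots> \<le> 2 * CARD('n) - 4" by (rule dim_tangent_slots_le[OF u(1)]) (use k0 in auto)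
  finally show False using n dim1 by linarith
qed

definition nonparallel :: "'n::finite \<Rightarrow> 'n \<Rightarrow> ('a \<Rightarrow> (real^3)^'n) \<Rightarrow> 'a set \<Rightarrow> 'a set" where
  "nonparallel i j \<phi> U = {x \<in> U. cross3 (\<phi> x $ i) (\<phi> x $ j) \<noteq> 0}"

lemma unit_parallel:
  assumes "norm (u::real^3) = 1" "norm v = 1" "cross3 u v = 0"
  shows "v = u \<or> v = - u"
proof -
  have "(u \<bullet> v)\<^sup>2 = 1" using norm_cross[of u v] assms by simp
  then have "u \<bullet> v = 1 \<or> u \<bullet> v = -1" by (simp add: power2_eq_1_iff)
  then show ?thesis
  proof
    assume "u \<bullet> v = 1"
    then have "(v - u) \<bullet> (v - u) = 0" using assms by (simp add: inner_diff_left inner_diff_right inner_commute norm_eq_1)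
    then show ?thesis by simp
  next
    assume "u \<bullet> v = -1"
    then have "(v + u) \<bullet> (v + u) = 0" using assms by (simp add: inner_add_left inner_add_right inner_commute norm_eq_1)
    then show ?thesis by (simp add: add_eq_0_iff2)
  qed
qed

text \<open>Where \<open>u\<^sub>j = \<sigma> u\<^sub>i\<close>, there are two cases. If some
  component of \<open>u\<^sub>j - \<sigma> u\<^sub>i\<close> has nonzero derivative, the point lies
  on a regular level set of that component, which is null. Otherwise the two edges move parallel and
  the density vanishes.\<close>

lemma liouville_volume_nonparallel:
  fixes r :: "real^'n::finite"
  assumes n: "CARD('n) \<ge> 4" and ij: "i \<noteq> j" and r: "\<And>k. r $ k \<noteq> 0" and L: "local_section r U \<phi> \<phi>'"
  shows "liouville_volume r U \<phi> \<phi>' = liouville_volume r (nonparallel i j \<phi> U) \<phi> \<phi>'"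
proof -
  define Z where "Z c \<sigma> = {x \<in> U. (\<phi> x $ j - \<sigma> *\<^sub>R \<phi> x $ i) $ c = 0 \<and> (\<exists>h. (\<phi>' x h $ j - \<sigma> *\<^sub>R \<phi>' x h $ i) $ c \<noteq> 0)}"
    for c :: 3 and \<sigma> :: real
  have U: "open U" and der: "\<And>x. x \<in> U \<Longrightarrow> (\<phi> has_derivative \<phi>' x) (at x)" and cont: "\<And>h. continuous_on U (\<lambda>x. \<phi>' x h)"
    using L by (auto simp: local_section_def)
  have "negligible (Z c \<sigma>)" for c \<sigma>
    unfolding Z_def
  proof (rule negligible_regular_level_set[OF U])
    show "((\<lambda>x. (\<phi> x $ j - \<sigma> *\<^sub>R \<phi> x $ i) $ c) has_derivative (\<lambda>h. (\<phi>' x h $ j - \<sigma> *\<^sub>R \<phi>' x h $ i) $ c)) (at x)" if "x \<in> U" for x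
      by (intro bounded_linear.has_derivative[OF bounded_linear_vec_nth] has_derivative_diff has_derivative_scaleR_right der that)
    show "continuous_on U (\<lambda>x. (\<phi>' x h $ j - \<sigma> *\<^sub>R \<phi>' x h $ i) $ c)" for h
      by (intro continuous_intros cont)
  qed
  then have "negligible (\<Union>\<sigma>\<in>{1,-1}. \<Union>c. Z c \<sigma>)" by (intro negligible_Union) auto
  then have "AE x in lebesgue. x \<notin> (\<Union>\<sigma>\<in>{1,-1}. \<Union>c. Z c \<sigma>)"
    unfolding negligible_iff_null_sets by (rule AE_not_in)
  then have ae: "AE x in lborel. x \<notin> (\<Union>\<sigma>\<in>{1,-1}. \<Union>c. Z c \<sigma>)"
    by (simp add: AE_completion_iff)
  show ?thesis
    unfolding liouville_volume_def
  proof (rule nn_integral_cong_AE)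
    show "AE x in lborel.
       ennreal (sqrt \<bar>det (\<chi> a b. symp_form r (\<phi> x) (\<phi>' x (axis a 1)) (\<phi>' x (axis b 1)))\<bar>) * indicator U x =
       ennreal (sqrt \<bar>det (\<chi> a b. symp_form r (\<phi> x) (\<phi>' x (axis a 1)) (\<phi>' x (axis b 1)))\<bar>) * indicator (nonparallel i j \<phi> U) x"
      using ae
    proof eventually_elim
      case (elim x)
      show ?case
      proof (cases "x \<in> U \<and> x \<notin> nonparallel i j \<phi> U")
        case True
        note T = local_section_tangent[OF L conjunct1[OF True]]
        have "cross3 (\<phi> x $ i) (\<phi> x $ j) = 0" using True by (simp add: nonparallel_def)
        then obtain \<sigma> where \<sigma>: "\<sigma> \<in> {1, -1 :: real}" "\<phi> x $ j = \<sigma> *\<^sub>R \<phi> x $ i"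
          using unit_parallel[OF T(3) T(3)] by (metis insertCI scaleR_minus1_left scaleR_one)
        have "(\<phi>' x h $ j - \<sigma> *\<^sub>R \<phi>' x h $ i) $ c = 0" for h c
        proof (rule ccontr)
          assume "(\<phi>' x h $ j - \<sigma> *\<^sub>R \<phi>' x h $ i) $ c \<noteq> 0"
          then have "x \<in> Z c \<sigma>" using True \<sigma>(2) unfolding Z_def by auto
          then show False using elim \<sigma>(1) by blast
        qed
        then have "\<phi>' x h $ j = \<sigma> *\<^sub>R \<phi>' x h $ i" for h
          by (simp add: vec_eq_iff)
        from parallel_pair_det_eq_0[OF n ij r T(3,5,7,1,4,6) \<sigma>(2) this]
        show ?thesis by simp
      next
        case False
        then have "x \<in> U \<longleftrightarrow> x \<in> nonparallel i j \<phi> U" by (auto simp: nonparallel_def)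
        then show ?thesis by (simp only: indicator_def)
      qed
    qed
  qed
qed

section \<open>Replacing two edges\<close>

text \<open>
  Let \<open>f = r\<^sub>1 u\<^sub>1 + r\<^sub>2 u\<^sub>2\<close>, where \<open>c = u\<^sub>1 \<bullet> u\<^sub>2\<close>. The new first edge has direction \<open>a u\<^sub>1 + b u\<^sub>2 = \<alpha> f + h q\<close>
  with \<open>q = (r\<^sub>1 c + r\<^sub>2) u\<^sub>1 - (r\<^sub>1 + r\<^sub>2 c) u\<^sub>2\<close> orthogonal to \<open>f\<close>, on the side of \<open>u\<^sub>1\<close>. The law of cosines
  gives \<open>\<alpha>\<close>, and \<open>h\<close> makes it a unit vector.
\<close>

definition tri_d2 :: "real \<Rightarrow> real \<Rightarrow> real \<Rightarrow> real" where
  "tri_d2 r1 r2 c = r1\<^sup>2 + r2\<^sup>2 + 2 * r1 * r2 * c"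

definition tri_al :: "real \<Rightarrow> real \<Rightarrow> real \<Rightarrow> real \<Rightarrow> real \<Rightarrow> real" where
  "tri_al r1 r2 s1 s2 c = (tri_d2 r1 r2 c + s1\<^sup>2 - s2\<^sup>2) / (2 * s1 * tri_d2 r1 r2 c)"

definition tri_h :: "real \<Rightarrow> real \<Rightarrow> real \<Rightarrow> real \<Rightarrow> real \<Rightarrow> real" where
  "tri_h r1 r2 s1 s2 c = sqrt (1 - tri_al r1 r2 s1 s2 c * tri_al r1 r2 s1 s2 c * tri_d2 r1 r2 c) / sqrt ((1 - c * c) * tri_d2 r1 r2 c)"

definition tri_a :: "real \<Rightarrow> real \<Rightarrow> real \<Rightarrow> real \<Rightarrow> real \<Rightarrow> real" where
  "tri_a r1 r2 s1 s2 c = tri_al r1 r2 s1 s2 c * r1 + tri_h r1 r2 s1 s2 c * (r1 * c + r2)"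

definition tri_b :: "real \<Rightarrow> real \<Rightarrow> real \<Rightarrow> real \<Rightarrow> real \<Rightarrow> real" where
  "tri_b r1 r2 s1 s2 c = tri_al r1 r2 s1 s2 c * r2 - tri_h r1 r2 s1 s2 c * (r1 + r2 * c)"

context
  fixes r1 r2 s1 s2 :: real
  assumes pos: "r1 > 0" "r2 > 0" "s1 > 0" "s2 > 0" and sum: "s1 + s2 = r1 + r2" and diff: "\<bar>s1 - s2\<bar> \<le> \<bar>r1 - r2\<bar>"
begin

text \<open>\<open>tri_d2\<close> is the squared length of the diagonal. The old triangle satisfies
  the strict triangle inequalities, and the new one has the same sum of sides and no larger
  difference.\<close>

lemma tri_d2_bounds:
  assumes "\<bar>c\<bar> < 1"
  shows "(r1 - r2)\<^sup>2 < tri_d2 r1 r2 c" "tri_d2 r1 r2 c < (s1 + s2)\<^sup>2" "(s1 - s2)\<^sup>2 < tri_d2 r1 r2 c" "tri_d2 r1 r2 c > 0"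
proof -
  have p: "r1 * r2 > 0" using pos by simp
  have "r1 * r2 * (1 + c) > 0" "r1 * r2 * (1 - c) > 0" using p assms by (simp_all add: abs_less_iff)
  then show 1: "(r1 - r2)\<^sup>2 < tri_d2 r1 r2 c" and "tri_d2 r1 r2 c < (s1 + s2)\<^sup>2"
    unfolding sum tri_d2_def by (simp_all add: power2_eq_square algebra_simps)
  have "(s1 - s2)\<^sup>2 \<le> (r1 - r2)\<^sup>2" using diff by (simp add: abs_le_square_iff)
  then show "(s1 - s2)\<^sup>2 < tri_d2 r1 r2 c" using 1 by simp
  show "tri_d2 r1 r2 c > 0" using 1 zero_le_power2[of "r1 - r2"] by linarith
qed

text \<open>The squared sine of the angle between the new first edge and the diagonal. As in Heron's
  formula, it is a product of the two gaps in the triangle inequalities, divided by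
  \<open>4 * s1\<^sup>2 * d\<close>.\<close>

lemma tri_heron:
  assumes "\<bar>c\<bar> < 1"
  shows "1 - tri_al r1 r2 s1 s2 c * tri_al r1 r2 s1 s2 c * tri_d2 r1 r2 c > 0"
proof -
  let ?d = "tri_d2 r1 r2 c"
  have "0 < ((s1 + s2)\<^sup>2 - ?d) * (?d - (s1 - s2)\<^sup>2)" using tri_d2_bounds[OF assms] by simp
  also have "\<dots> = 4 * s1\<^sup>2 * ?d - (?d + s1\<^sup>2 - s2\<^sup>2)\<^sup>2" by (simp add: power2_eq_square algebra_simps)
  finally have "0 < (4 * s1\<^sup>2 * ?d - (?d + s1\<^sup>2 - s2\<^sup>2)\<^sup>2) / (4 * s1\<^sup>2 * ?d)" using pos tri_d2_bounds[OF assms] by simp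
  also have "\<dots> = 1 - tri_al r1 r2 s1 s2 c * tri_al r1 r2 s1 s2 c * ?d"
    using pos tri_d2_bounds(4)[OF assms] unfolding tri_al_def by (simp add: field_simps power2_eq_square)
  finally show ?thesis .
qed

lemma tri_h_pos: "\<bar>c\<bar> < 1 \<Longrightarrow> tri_h r1 r2 s1 s2 c > 0"
  using tri_heron[of c] tri_d2_bounds(4)[of c] abs_square_less_1[of c] unfolding tri_h_def
  by (simp add: power2_eq_square)

text \<open>The first identity is Pythagoras for the components along the diagonal \<open>f\<close>
  and along \<open>q\<close>; the second is the law of cosines for the remaining edge, which is
  \<open>f\<close> minus \<open>s1\<close> times the new first edge, divided by \<open>s2\<close>.
  The determinant equals \<open>h * d / s2\<close>: its sign says that the new triangle is
  nondegenerate and has the old orientation.\<close>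

lemma tri_coeffs:
  fixes u v :: "real^3"
  assumes u: "norm u = 1" "norm v = 1" and c: "u \<bullet> v = c" "\<bar>c\<bar> < 1"
  defines "a \<equiv> tri_a r1 r2 s1 s2 c" and "b \<equiv> tri_b r1 r2 s1 s2 c"
  shows "norm (a *\<^sub>R u + b *\<^sub>R v) = 1" "norm (((r1 - s1 * a) / s2) *\<^sub>R u + ((r2 - s1 * b) / s2) *\<^sub>R v) = 1"
    "a * ((r2 - s1 * b) / s2) - ((r1 - s1 * a) / s2) * b > 0"
proof -
  define al h d where "al = tri_al r1 r2 s1 s2 c" and "h = tri_h r1 r2 s1 s2 c" and "d = tri_d2 r1 r2 c"
  have d: "d > 0" using tri_d2_bounds(4)[OF c(2)] by (simp add: d_def)
  have ab: "a = al * r1 + h * (r1 * c + r2)" "b = al * r2 - h * (r1 + r2 * c)"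
    by (simp_all add: a_def b_def tri_a_def tri_b_def al_def h_def)
  have c1: "1 - c * c > 0" using abs_square_less_1[of c] c(2) by (simp add: power2_eq_square)
  have hh: "h * h * ((1 - c * c) * d) = 1 - al * al * d"
  proof -
    have "h * h = (1 - al * al * d) / ((1 - c * c) * d)"
      using tri_heron[OF c(2)] c1 d unfolding h_def tri_h_def al_def d_def by simp
    then show ?thesis using c1 d by simp
  qed
  have ald: "2 * s1 * (al * d) = d + s1 * s1 - s2 * s2"
    using d pos unfolding al_def tri_al_def d_def by (simp add: field_simps power2_eq_square)
  have dd: "d = r1 * r1 + r2 * r2 + 2 * r1 * r2 * c" by (simp add: d_def tri_d2_def power2_eq_square)
  have nrm: "(norm (p *\<^sub>R u + q *\<^sub>R v))\<^sup>2 = p * p + q * q + 2 * p * q * c" for p q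
    unfolding power2_norm_eq_inner using u c
    by (simp add: inner_add_left inner_add_right inner_commute norm_eq_1 algebra_simps)
  have one: "a * a + b * b + 2 * a * b * c = 1"
  proof -
    have "a * a + b * b + 2 * a * b * c = al * al * d + h * h * ((1 - c * c) * d)"
      unfolding ab dd by (simp add: algebra_simps)
    then show ?thesis using hh by simp
  qed
  have "(norm (a *\<^sub>R u + b *\<^sub>R v))\<^sup>2 = 1" using nrm one by simp
  then show "norm (a *\<^sub>R u + b *\<^sub>R v) = 1"
    by (metis norm_ge_zero power2_eq_1_iff neg_0_le_iff_le not_one_le_zero)
  have fa: "a * r1 + b * r2 + (a * r2 + b * r1) * c = al * d"
    unfolding ab dd by (simp add: algebra_simps)
  have "(r1 - s1 * a) * (r1 - s1 * a) + (r2 - s1 * b) * (r2 - s1 * b) + 2 * (r1 - s1 * a) * (r2 - s1 * b) * c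
     = d - 2 * s1 * (a * r1 + b * r2 + (a * r2 + b * r1) * c) + s1 * s1 * (a * a + b * b + 2 * a * b * c)"
    unfolding dd by (simp add: algebra_simps)
  also have "\<dots> = s2 * s2" unfolding fa one using ald by (simp add: mult.assoc)
  finally have two: "(r1 - s1 * a) * (r1 - s1 * a) + (r2 - s1 * b) * (r2 - s1 * b) + 2 * (r1 - s1 * a) * (r2 - s1 * b) * c = s2 * s2" .
  have "(norm (((r1 - s1 * a) / s2) *\<^sub>R u + ((r2 - s1 * b) / s2) *\<^sub>R v))\<^sup>2
    = ((r1 - s1 * a) * (r1 - s1 * a) + (r2 - s1 * b) * (r2 - s1 * b) + 2 * (r1 - s1 * a) * (r2 - s1 * b) * c) / (s2 * s2)"
    unfolding nrm by (simp add: add_divide_distrib)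
  also have "\<dots> = 1" unfolding two using pos by simp
  finally show "norm (((r1 - s1 * a) / s2) *\<^sub>R u + ((r2 - s1 * b) / s2) *\<^sub>R v) = 1"
    by (metis norm_ge_zero power2_eq_1_iff neg_0_le_iff_le not_one_le_zero)
  have "a * ((r2 - s1 * b) / s2) - ((r1 - s1 * a) / s2) * b = (a * r2 - b * r1) / s2"
    using pos by (simp add: field_simps)
  also have "a * r2 - b * r1 = h * d" unfolding ab dd by (simp add: algebra_simps)
  finally show "a * ((r2 - s1 * b) / s2) - ((r1 - s1 * a) / s2) * b > 0"
    using tri_h_pos[OF c(2)] d pos by (simp add: h_def)
qed

lemma C1_on_tri:
  assumes c: "C1_on S c" "\<And>x. x \<in> S \<Longrightarrow> \<bar>c x\<bar> < 1"
  shows "C1_on S (\<lambda>x. tri_a r1 r2 s1 s2 (c x))" "C1_on S (\<lambda>x. tri_b r1 r2 s1 s2 (c x))"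
proof -
  have c1: "(1 - c x * c x) * tri_d2 r1 r2 (c x) > 0" if "x \<in> S" for x
    using abs_square_less_1[of "c x"] c(2)[OF that] tri_d2_bounds(4)[of "c x"] by (simp add: power2_eq_square)
  have c1': "sqrt ((1 - c x * c x) * tri_d2 r1 r2 (c x)) \<noteq> 0" if "x \<in> S" for x
    using c1[OF that] by (metis less_irrefl real_sqrt_eq_0_iff)
  have d0: "tri_d2 r1 r2 (c x) \<noteq> 0" if "x \<in> S" for x
    using tri_d2_bounds(4)[of "c x"] c(2)[OF that] by simp
  have d: "C1_on S (\<lambda>x. tri_d2 r1 r2 (c x))" unfolding tri_d2_def by (intro C1_intros c)
  have al: "C1_on S (\<lambda>x. tri_al r1 r2 s1 s2 (c x))" unfolding tri_al_def
    by (intro C1_intros d) (use d0 pos in simp)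
  have h: "C1_on S (\<lambda>x. tri_h r1 r2 s1 s2 (c x))" unfolding tri_h_def
    using c1 c1' tri_heron[OF c(2)] by (intro C1_intros d al c) simp_all
  show "C1_on S (\<lambda>x. tri_a r1 r2 s1 s2 (c x))" "C1_on S (\<lambda>x. tri_b r1 r2 s1 s2 (c x))"
    unfolding tri_a_def tri_b_def by (intro C1_intros al h c)+
qed

end

section \<open>Invariance of the form when two edges are replaced\<close>

lemma cross3_tangent:
  fixes u v w :: "real^3"
  assumes "norm u = 1" "v \<bullet> u = 0" "w \<bullet> u = 0"
  shows "cross3 v w = (u \<bullet> cross3 v w) *\<^sub>R u"
proof (rule cross_dot_cancel[of u])
  have uu: "u \<bullet> u = 1" using assms by (simp add: norm_eq_1)
  then show "u \<bullet> cross3 v w = u \<bullet> (u \<bullet> cross3 v w) *\<^sub>R u" by simp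
  show "u \<noteq> 0" using uu by auto
  show "cross3 u (cross3 v w) = cross3 u ((u \<bullet> cross3 v w) *\<^sub>R u)"
    using assms by (simp add: Lagrange inner_commute cross_mult_right)
qed

text \<open>The area form in the orthogonal basis of the tangent plane that consists of the
  projection of \<open>z\<close> and of \<open>cross3 u z\<close>, two vectors of equal
  norm.\<close>

lemma triple_tangent:
  fixes u v w z :: "real^3"
  assumes "norm u = 1" "v \<bullet> u = 0" "w \<bullet> u = 0"
  shows "(norm (cross3 u z))\<^sup>2 * (u \<bullet> cross3 v w) = (v \<bullet> z) * (w \<bullet> cross3 u z) - (v \<bullet> cross3 u z) * (w \<bullet> z)"
proof -
  have uu: "u \<bullet> u = 1" using assms by (simp add: norm_eq_1)
  note vw = cross3_tangent[OF assms]
  have "(v \<bullet> z) * (w \<bullet> cross3 u z) - (v \<bullet> cross3 u z) * (w \<bullet> z) = cross3 v w \<bullet> cross3 z (cross3 u z)"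
    by (simp add: dot_cross)
  also have "\<dots> = (u \<bullet> cross3 v w) * (u \<bullet> cross3 z (cross3 u z))" by (subst vw) simp
  also have "u \<bullet> cross3 z (cross3 u z) = (norm (cross3 u z))\<^sup>2"
  proof -
    have "u \<bullet> cross3 z (cross3 u z) = (norm z)\<^sup>2 - (u \<bullet> z)\<^sup>2"
      using uu by (simp add: Lagrange inner_diff_right inner_commute power2_norm_eq_inner power2_eq_square[of "u \<bullet> z"])
    then show ?thesis using assms(1) norm_cross[of u z] by simp
  qed
  finally show ?thesis by simp
qed

text \<open>Two edges contribute to the form only through the motion of the frame of the triangle that they span
  and the length of its third side.\<close>

lemma symp_form_pair_invariant:
  fixes u1 u2 v1 v2 w1 w2 V1 V2 W1 W2 U1 U2 :: "real^3"
  assumes u: "norm u1 = 1" "norm u2 = 1" "cross3 u1 u2 \<noteq> 0"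
    and t: "v1 \<bullet> u1 = 0" "v2 \<bullet> u2 = 0" "w1 \<bullet> u1 = 0" "w2 \<bullet> u2 = 0"
    and U: "U1 = a *\<^sub>R u1 + b *\<^sub>R u2" "U2 = a' *\<^sub>R u1 + b' *\<^sub>R u2" "norm U1 = 1" "norm U2 = 1" "a * b' - a' * b \<noteq> 0"
    and V: "V1 = a *\<^sub>R v1 + b *\<^sub>R v2 + p1 *\<^sub>R u1 + p2 *\<^sub>R u2" "V1 \<bullet> U1 = 0" "V2 \<bullet> U2 = 0" "s1 *\<^sub>R V1 + s2 *\<^sub>R V2 = r1 *\<^sub>R v1 + r2 *\<^sub>R v2"
      "V2 = a' *\<^sub>R v1 + b' *\<^sub>R v2 + p3 *\<^sub>R u1 + p4 *\<^sub>R u2"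
    and W: "W1 = a *\<^sub>R w1 + b *\<^sub>R w2 + q1 *\<^sub>R u1 + q2 *\<^sub>R u2" "W1 \<bullet> U1 = 0" "W2 \<bullet> U2 = 0" "s1 *\<^sub>R W1 + s2 *\<^sub>R W2 = r1 *\<^sub>R w1 + r2 *\<^sub>R w2"
      "W2 = a' *\<^sub>R w1 + b' *\<^sub>R w2 + q3 *\<^sub>R u1 + q4 *\<^sub>R u2"
  shows "s1 * (U1 \<bullet> cross3 V1 W1) + s2 * (U2 \<bullet> cross3 V2 W2) = r1 * (u1 \<bullet> cross3 v1 w1) + r2 * (u2 \<bullet> cross3 v2 w2)"
proof -
  define n k Q where "n = cross3 u1 u2" and "k = a * b' - a' * b" and "Q = (norm n)\<^sup>2"
  have Q: "Q \<noteq> 0" using u(3) by (simp add: Q_def n_def)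
  have N: "cross3 U1 U2 = k *\<^sub>R n"
  proof -
    have "cross3 u2 u1 = - n" unfolding n_def by (rule cross_skew)
    then show ?thesis unfolding U(1,2) k_def
      by (simp add: cross_add_left cross_add_right cross_mult_left cross_mult_right n_def[symmetric] algebra_simps)
  qed
  have QN: "(norm (cross3 U1 U2))\<^sup>2 = k\<^sup>2 * Q" unfolding N Q_def by (simp add: power_mult_distrib)
  have sw: "cross3 u2 u1 = - n" "cross3 U2 U1 = - (k *\<^sub>R n)" unfolding n_def N[symmetric, unfolded n_def] by (rule cross_skew)+
  have nu: "u1 \<bullet> n = 0" "u2 \<bullet> n = 0" unfolding n_def by (simp_all add: dot_cross_self)
  have id1: "Q * (u1 \<bullet> cross3 v1 w1) = (v1 \<bullet> u2) * (w1 \<bullet> n) - (v1 \<bullet> n) * (w1 \<bullet> u2)"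
    using triple_tangent[OF u(1) t(1,3), of u2] by (simp add: Q_def n_def)
  have id2: "Q * (u2 \<bullet> cross3 v2 w2) = (v2 \<bullet> n) * (w2 \<bullet> u1) - (v2 \<bullet> u1) * (w2 \<bullet> n)"
    using triple_tangent[OF u(2) t(2,4), of u1] unfolding sw Q_def by simp
  have id3: "k\<^sup>2 * Q * (U1 \<bullet> cross3 V1 W1) = k * ((V1 \<bullet> U2) * (W1 \<bullet> n) - (V1 \<bullet> n) * (W1 \<bullet> U2))"
    using triple_tangent[OF U(3) V(2) W(2), of U2] unfolding QN unfolding N by (simp add: algebra_simps)
  have id4: "k\<^sup>2 * Q * (U2 \<bullet> cross3 V2 W2) = k * ((V2 \<bullet> n) * (W2 \<bullet> U1) - (V2 \<bullet> U1) * (W2 \<bullet> n))"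
    using triple_tangent[OF U(4) V(3) W(3), of U1] unfolding sw(2) by (simp add: Q_def power_mult_distrib algebra_simps)
  \<comment> \<open>The derivatives of the coefficients, \<open>p1\<close> to \<open>q4\<close>,
    contribute only vectors in the plane of the triangle and drop out after pairing with the normal
    \<open>n\<close>.\<close>
  have Vn: "V1 \<bullet> n = a * (v1 \<bullet> n) + b * (v2 \<bullet> n)" "V2 \<bullet> n = a' * (v1 \<bullet> n) + b' * (v2 \<bullet> n)"
    "W1 \<bullet> n = a * (w1 \<bullet> n) + b * (w2 \<bullet> n)" "W2 \<bullet> n = a' * (w1 \<bullet> n) + b' * (w2 \<bullet> n)"
    unfolding V(1,5) W(1,5) by (simp_all add: inner_add_left nu)
  \<comment> \<open>As \<open>V2\<close> is orthogonal to \<open>U2\<close>, pairing with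
    \<open>U2\<close> sees only the motion of the third side, which is the same for both
    triangles.\<close>
  have VU: "s1 * (V1 \<bullet> U2) = r1 * b' * (v1 \<bullet> u2) + r2 * a' * (v2 \<bullet> u1)"
    "s2 * (V2 \<bullet> U1) = r1 * b * (v1 \<bullet> u2) + r2 * a * (v2 \<bullet> u1)"
    if "V1 \<bullet> U1 = 0" "V2 \<bullet> U2 = 0" "s1 *\<^sub>R V1 + s2 *\<^sub>R V2 = r1 *\<^sub>R v1 + r2 *\<^sub>R v2" "v1 \<bullet> u1 = 0" "v2 \<bullet> u2 = 0" for V1 V2 v1 v2 :: "real^3"
  proof -
    have "s1 * (V1 \<bullet> U2) = (s1 *\<^sub>R V1 + s2 *\<^sub>R V2) \<bullet> U2" using that(2) by (simp add: inner_add_left)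
    also have "\<dots> = (r1 *\<^sub>R v1 + r2 *\<^sub>R v2) \<bullet> (a' *\<^sub>R u1 + b' *\<^sub>R u2)" unfolding that(3) U(2) ..
    finally show "s1 * (V1 \<bullet> U2) = r1 * b' * (v1 \<bullet> u2) + r2 * a' * (v2 \<bullet> u1)"
      by (simp add: that(4,5) inner_add_left inner_add_right)
    have "s2 * (V2 \<bullet> U1) = (s1 *\<^sub>R V1 + s2 *\<^sub>R V2) \<bullet> U1" using that(1) by (simp add: inner_add_left)
    also have "\<dots> = (r1 *\<^sub>R v1 + r2 *\<^sub>R v2) \<bullet> (a *\<^sub>R u1 + b *\<^sub>R u2)" unfolding that(3) U(1) ..
    finally show "s2 * (V2 \<bullet> U1) = r1 * b * (v1 \<bullet> u2) + r2 * a * (v2 \<bullet> u1)"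
      by (simp add: that(4,5) inner_add_left inner_add_right)
  qed
  note VU1 = VU[OF V(2,3,4) t(1,2)] and WU1 = VU[OF W(2,3,4) t(3,4)]
  have "k\<^sup>2 * Q * (s1 * (U1 \<bullet> cross3 V1 W1) + s2 * (U2 \<bullet> cross3 V2 W2)) =
     k * ((s1 * (V1 \<bullet> U2)) * (W1 \<bullet> n) - (V1 \<bullet> n) * (s1 * (W1 \<bullet> U2)) + ((V2 \<bullet> n) * (s2 * (W2 \<bullet> U1)) - (s2 * (V2 \<bullet> U1)) * (W2 \<bullet> n)))"
    using arg_cong[OF id3, of "\<lambda>x. s1 * x"] arg_cong[OF id4, of "\<lambda>x. s2 * x"] by (simp add: algebra_simps)
  also have "\<dots> = k * k * (r1 * ((v1 \<bullet> u2) * (w1 \<bullet> n) - (v1 \<bullet> n) * (w1 \<bullet> u2)) + r2 * ((v2 \<bullet> n) * (w2 \<bullet> u1) - (v2 \<bullet> u1) * (w2 \<bullet> n)))"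
    unfolding VU1 WU1 Vn unfolding k_def by algebra
  also have "\<dots> = k\<^sup>2 * Q * (r1 * (u1 \<bullet> cross3 v1 w1) + r2 * (u2 \<bullet> cross3 v2 w2))"
    unfolding id1[symmetric] id2[symmetric] by (simp add: power2_eq_square algebra_simps)
  finally show ?thesis using Q U(5) by (simp add: k_def)
qed

lemma abs_inner_less_1:
  fixes u v :: "real^3"
  assumes "norm u = 1" "norm v = 1" "cross3 u v \<noteq> 0" shows "\<bar>u \<bullet> v\<bar> < 1"
proof -
  have "(norm (cross3 u v))\<^sup>2 > 0" using assms by simp
  then have "(u \<bullet> v)\<^sup>2 < 1" unfolding norm_cross using assms by simp
  then show ?thesis by (simp add: abs_square_less_1)
qed

lemma rotation_matrix_inner:
  fixes A :: "real^'n^'n"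
  assumes "rotation_matrix A" shows "(A *v x) \<bullet> (A *v y) = x \<bullet> y"
proof -
  have "orthogonal_transformation ((*v) A)"
    unfolding orthogonal_transformation_matrix using assms
    by (simp add: rotation_matrix_def matrix_vector_mul_linear)
  then show ?thesis by (simp add: orthogonal_transformation_def)
qed

lemma rotation_matrix_lin: "A *v (a *\<^sub>R x + b *\<^sub>R y) = a *\<^sub>R (A *v x) + b *\<^sub>R (A *v y)" for A :: "real^3^3"
  by (simp add: matrix_vector_right_distrib matrix_vector_mult_scaleR)

text \<open>The coefficients of the new edges depend only on \<open>c\<close>, the cosine between
  the old ones, so the construction commutes with rotations. It can be undone because the length of
  the diagonal determines \<open>c\<close> and the coefficient matrix is invertible. The last
  conclusion, that the diagonal is kept, later separates the image from other polygons.\<close>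

lemma section_transfer:
  fixes r s :: "real^'n::finite"
  assumes ij: "i \<noteq> j" and r: "\<And>k. r $ k > 0" and s: "\<And>k. s $ k > 0"
    and so: "\<And>k. k \<noteq> i \<Longrightarrow> k \<noteq> j \<Longrightarrow> s $ k = r $ k"
    and sum: "s $ i + s $ j = r $ i + r $ j" and diff: "\<bar>s $ i - s $ j\<bar> \<le> \<bar>r $ i - r $ j\<bar>"
    and L: "local_section r U \<phi> \<phi>'" and np: "nonparallel i j \<phi> U = U"
  obtains \<psi> \<psi>' where "local_section s U \<psi> \<psi>'" "liouville_volume s U \<psi> \<psi>' = liouville_volume r U \<phi> \<phi>'"
    "\<forall>x\<in>U. s $ i *\<^sub>R \<psi> x $ i + s $ j *\<^sub>R \<psi> x $ j = r $ i *\<^sub>R \<phi> x $ i + r $ j *\<^sub>R \<phi> x $ j"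
proof -
  define c where "c x = \<phi> x $ i \<bullet> \<phi> x $ j" for x
  define a where "a x = tri_a (r $ i) (r $ j) (s $ i) (s $ j) (c x)" for x
  define b where "b x = tri_b (r $ i) (r $ j) (s $ i) (s $ j) (c x)" for x
  define a' where "a' x = (r $ i - s $ i * a x) / s $ j" for x
  define b' where "b' x = (r $ j - s $ i * b x) / s $ j" for x
  define \<psi> where "\<psi> x = (\<chi> k. if k = i then a x *\<^sub>R \<phi> x $ i + b x *\<^sub>R \<phi> x $ j
      else if k = j then a' x *\<^sub>R \<phi> x $ i + b' x *\<^sub>R \<phi> x $ j else \<phi> x $ k)" for x
  define \<psi>' where "\<psi>' x = frechet_derivative \<psi> (at x)" for x
  have \<psi>i: "\<psi> x $ i = a x *\<^sub>R \<phi> x $ i + b x *\<^sub>R \<phi> x $ j"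
    and \<psi>j: "\<psi> x $ j = a' x *\<^sub>R \<phi> x $ i + b' x *\<^sub>R \<phi> x $ j"
    and \<psi>k: "k \<noteq> i \<Longrightarrow> k \<noteq> j \<Longrightarrow> \<psi> x $ k = \<phi> x $ k" for x k
    using ij by (auto simp: \<psi>_def)
  have U: "open U" and C1: "C1_on U \<phi>" and inj: "\<And>x y. x \<in> U \<Longrightarrow> y \<in> U \<Longrightarrow> (\<phi> x, \<phi> y) \<in> so3_rel \<Longrightarrow> x = y"
    using L unfolding local_section_iff_C1_on by blast+
  note T = local_section_tangent[OF L]
  have cross: "cross3 (\<phi> x $ i) (\<phi> x $ j) \<noteq> 0" if "x \<in> U" for x
    using np that unfolding nonparallel_def by blast
  have c1: "\<bar>c x\<bar> < 1" if "x \<in> U" for x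
    unfolding c_def by (intro abs_inner_less_1 T(3) cross that)
  have lin: "s $ i * a x + s $ j * a' x = r $ i" "s $ i * b x + s $ j * b' x = r $ j" for x
    using s[of j] by (auto simp: a'_def b'_def)
  have U1: "norm (\<psi> x $ i) = 1" and U2: "norm (\<psi> x $ j) = 1" and det: "a x * b' x - a' x * b x > 0" if "x \<in> U" for x
    using tri_coeffs[OF r r s s sum diff T(3)[OF that] T(3)[OF that] c_def[symmetric] c1[OF that]]
    unfolding \<psi>i \<psi>j a_def[symmetric] b_def[symmetric] a'_def[symmetric] b'_def[symmetric] by blast+
  have sumf: "s $ i *\<^sub>R \<psi> x $ i + s $ j *\<^sub>R \<psi> x $ j = r $ i *\<^sub>R \<phi> x $ i + r $ j *\<^sub>R \<phi> x $ j" for x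
  proof -
    have "s $ i *\<^sub>R \<psi> x $ i + s $ j *\<^sub>R \<psi> x $ j = (s $ i * a x + s $ j * a' x) *\<^sub>R \<phi> x $ i + (s $ i * b x + s $ j * b' x) *\<^sub>R \<phi> x $ j"
      unfolding \<psi>i \<psi>j by (simp add: algebra_simps)
    then show ?thesis unfolding lin .
  qed
  have split: "(\<Sum>k\<in>UNIV. g k) = g i + g j + (\<Sum>k\<in>UNIV - {i, j}. g k)" for g :: "'n \<Rightarrow> 'c::comm_monoid_add"
    using ij by (subst sum.subset_diff[of "{i, j}"]) (auto simp: add.commute)
  have ncross: "cross3 (\<psi> x $ i) (\<psi> x $ j) = (a x * b' x - a' x * b x) *\<^sub>R cross3 (\<phi> x $ i) (\<phi> x $ j)" for x
    unfolding \<psi>i \<psi>j using cross_skew[of "\<phi> x $ j" "\<phi> x $ i"]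
    by (simp add: cross_add_left cross_add_right cross_mult_left cross_mult_right algebra_simps)
  have C1c: "C1_on U c" unfolding c_def by (intro C1_intros C1)
  have C1ab: "C1_on U a" "C1_on U b" unfolding a_def b_def
    by (intro C1_on_tri[OF r r s s sum diff C1c c1]; assumption)+
  have C1ab': "C1_on U a'" "C1_on U b'" unfolding a'_def b'_def
    by (intro C1_intros C1ab; use s[of j] in simp)+
  have C1\<psi>: "C1_on U \<psi>"
  proof -
    have "C1_on U (\<lambda>x. if k = i then a x *\<^sub>R \<phi> x $ i + b x *\<^sub>R \<phi> x $ j
      else if k = j then a' x *\<^sub>R \<phi> x $ i + b' x *\<^sub>R \<phi> x $ j else \<phi> x $ k)" for k
      by (cases "k = i"; cases "k = j"; simp; intro C1_intros C1 C1ab C1ab')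
    then show ?thesis unfolding \<psi>_def by (rule C1_on_vec_lambda)
  qed
  have reg: "\<psi> x \<in> regular_level s" if "x \<in> U" for x
  proof -
    have "(\<Sum>k\<in>UNIV. s $ k *\<^sub>R \<psi> x $ k) = (\<Sum>k\<in>UNIV. r $ k *\<^sub>R \<phi> x $ k)"
      unfolding split sumf by (intro arg_cong2[of _ _ _ _ "(+)"] refl sum.cong) (auto simp: so \<psi>k)
    moreover have "norm (\<psi> x $ k) = 1" for k
      using U1[OF that] U2[OF that] T(3)[OF that] \<psi>k[of k x] by (cases "k = i"; cases "k = j") auto
    moreover have "\<not> degenerate (\<psi> x)"
      by (rule not_degenerateI[of _ i j]) (use ncross[of x] cross[OF that] det[OF that] in simp)
    ultimately show ?thesis using T(5)[OF that] by (simp add: regular_level_def zero_level_def moment_map_def)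
  qed
  have inj': "x = y" if xy: "x \<in> U" "y \<in> U" "(\<psi> x, \<psi> y) \<in> so3_rel" for x y
  proof -
    obtain A where A: "rotation_matrix A" "\<psi> y = (\<chi> k. A *v \<psi> x $ k)" using xy(3) by (auto simp: so3_rel_def)
    have Ak: "\<psi> y $ k = A *v \<psi> x $ k" for k unfolding A(2) by simp
    define f where "f x = r $ i *\<^sub>R \<phi> x $ i + r $ j *\<^sub>R \<phi> x $ j" for x
    have fA: "f y = A *v f x" unfolding f_def sumf[symmetric] Ak rotation_matrix_lin ..
    have ff: "f x \<bullet> f x = (r $ i)\<^sup>2 + (r $ j)\<^sup>2 + 2 * r $ i * r $ j * c x" if "x \<in> U" for x
      using T(3)[OF that] unfolding f_def c_def
      by (simp add: inner_add_left inner_add_right inner_commute norm_eq_1 power2_eq_square algebra_simps)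
    have "f y \<bullet> f y = f x \<bullet> f x" unfolding fA by (rule rotation_matrix_inner[OF A(1)])
    then have "r $ i * r $ j * c y = r $ i * r $ j * c x" using ff xy by simp
    then have cc: "c y = c x" using r[of i] r[of j] by simp
    then have coef: "a y = a x" "b y = b x" "a' y = a' x" "b' y = b' x" by (simp_all add: a_def b_def a'_def b'_def)
    define k where "k = a x * b' x - a' x * b x"
    have k0: "k \<noteq> 0" using det[OF xy(1)] by (simp add: k_def)
    have ri: "k *\<^sub>R \<phi> z $ i = b' x *\<^sub>R \<psi> z $ i + (- b x) *\<^sub>R \<psi> z $ j" and rj: "k *\<^sub>R \<phi> z $ j = (- a' x) *\<^sub>R \<psi> z $ i + a x *\<^sub>R \<psi> z $ j"
      if "z = x \<or> z = y" for z
    proof -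
      have "a z = a x" "b z = b x" "a' z = a' x" "b' z = b' x" using that coef by auto
      then show "k *\<^sub>R \<phi> z $ i = b' x *\<^sub>R \<psi> z $ i + (- b x) *\<^sub>R \<psi> z $ j" "k *\<^sub>R \<phi> z $ j = (- a' x) *\<^sub>R \<psi> z $ i + a x *\<^sub>R \<psi> z $ j"
        unfolding \<psi>i \<psi>j k_def by (simp_all add: algebra_simps)
    qed
    have "k *\<^sub>R \<phi> y $ i = k *\<^sub>R (A *v \<phi> x $ i)" "k *\<^sub>R \<phi> y $ j = k *\<^sub>R (A *v \<phi> x $ j)"
      unfolding matrix_vector_mult_scaleR[symmetric] ri[of x, simplified] rj[of x, simplified] ri[of y, simplified] rj[of y, simplified]
      by (simp_all add: Ak matrix_vector_right_distrib matrix_vector_mult_scaleR matrix_vector_mult_diff_distrib)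
    then have ph: "\<phi> y $ i = A *v \<phi> x $ i" "\<phi> y $ j = A *v \<phi> x $ j" using k0 by simp_all
    have "\<phi> y $ k = A *v \<phi> x $ k" for k
      using ph Ak[of k] \<psi>k by (cases "k = i"; cases "k = j") auto
    then have "\<phi> y = (\<chi> k. A *v \<phi> x $ k)" by (simp add: vec_eq_iff)
    then show ?thesis using inj[OF xy(1,2)] A(1) by (auto simp: so3_rel_def)
  qed
  have L': "local_section s U \<psi> \<psi>'"
    unfolding local_section_iff_C1_on using U C1\<psi> reg inj' by (auto simp: \<psi>'_def)
  note T' = local_section_tangent[OF L']
  have form: "symp_form s (\<psi> x) (\<psi>' x h) (\<psi>' x h') = symp_form r (\<phi> x) (\<phi>' x h) (\<phi>' x h')" if x: "x \<in> U" for x h h'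
  proof -
    have dk: "((\<lambda>x. \<phi> x $ k) has_derivative (\<lambda>h. \<phi>' x h $ k)) (at x)" for k
      using bounded_linear.has_derivative[OF bounded_linear_vec_nth T(2)[OF x]] .
    have dk': "((\<lambda>x. \<psi> x $ k) has_derivative (\<lambda>h. \<psi>' x h $ k)) (at x)" for k
      using bounded_linear.has_derivative[OF bounded_linear_vec_nth T'(2)[OF x]] .
    have oth: "\<psi>' x h $ k = \<phi>' x h $ k" if "k \<noteq> i" "k \<noteq> j" for k h
    proof -
      have "((\<lambda>x. \<phi> x $ k) has_derivative (\<lambda>h. \<psi>' x h $ k)) (at x)"
        using dk'[of k] unfolding \<psi>k[OF that] .
      then have "(\<lambda>h. \<psi>' x h $ k) = (\<lambda>h. \<phi>' x h $ k)" by (rule has_derivative_unique) (rule dk)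
      then show ?thesis by meson
    qed
    \<comment> \<open>Product rule. The derivatives of the coefficients enter as multiples
      \<open>p h\<close>, \<open>q h\<close> of the old edges and are left implicit.\<close>
    have comb: "\<exists>p q. \<forall>h. D h = f x *\<^sub>R \<phi>' x h $ i + g x *\<^sub>R \<phi>' x h $ j + p h *\<^sub>R \<phi> x $ i + q h *\<^sub>R \<phi> x $ j"
      if fg: "C1_on U f" "C1_on U g" and D: "((\<lambda>x. f x *\<^sub>R \<phi> x $ i + g x *\<^sub>R \<phi> x $ j) has_derivative D) (at x)" for f g D
    proof -
      obtain f' g' where f': "(f has_derivative f') (at x)" and g': "(g has_derivative g') (at x)"
        using C1_on_frechet_derivative(1)[OF fg(1) x] C1_on_frechet_derivative(1)[OF fg(2) x] by blast
      have "((\<lambda>x. f x *\<^sub>R \<phi> x $ i + g x *\<^sub>R \<phi> x $ j) has_derivative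
         (\<lambda>h. (f x *\<^sub>R \<phi>' x h $ i + f' h *\<^sub>R \<phi> x $ i) + (g x *\<^sub>R \<phi>' x h $ j + g' h *\<^sub>R \<phi> x $ j))) (at x)"
        by (intro has_derivative_add has_derivative_scaleR f' g' dk)
      from has_derivative_unique[OF D this]
      show ?thesis by (intro exI[of _ f'] exI[of _ g']) (simp add: algebra_simps)
    qed
    obtain p1 p2 where p12: "\<And>h. \<psi>' x h $ i = a x *\<^sub>R \<phi>' x h $ i + b x *\<^sub>R \<phi>' x h $ j + p1 h *\<^sub>R \<phi> x $ i + p2 h *\<^sub>R \<phi> x $ j"
      using comb[OF C1ab dk'[of i, unfolded \<psi>i]] by blast
    obtain p3 p4 where p34: "\<And>h. \<psi>' x h $ j = a' x *\<^sub>R \<phi>' x h $ i + b' x *\<^sub>R \<phi>' x h $ j + p3 h *\<^sub>R \<phi> x $ i + p4 h *\<^sub>R \<phi> x $ j"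
      using comb[OF C1ab' dk'[of j, unfolded \<psi>j]] by blast
    have sumV: "s $ i *\<^sub>R \<psi>' x h $ i + s $ j *\<^sub>R \<psi>' x h $ j = r $ i *\<^sub>R \<phi>' x h $ i + r $ j *\<^sub>R \<phi>' x h $ j" for h
    proof -
      have "(\<Sum>k\<in>UNIV - {i, j}. s $ k *\<^sub>R \<psi>' x h $ k) = (\<Sum>k\<in>UNIV - {i, j}. r $ k *\<^sub>R \<phi>' x h $ k)"
        by (rule sum.cong) (auto simp: so oth)
      moreover have "(\<Sum>k\<in>UNIV. s $ k *\<^sub>R \<psi>' x h $ k) = (\<Sum>k\<in>UNIV. r $ k *\<^sub>R \<phi>' x h $ k)"
        using T(6)[OF x, of h] T'(6)[OF x, of h] by simp
      ultimately show ?thesis unfolding split by simp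
    qed
    have pair: "s $ i * (\<psi> x $ i \<bullet> cross3 (\<psi>' x h $ i) (\<psi>' x h' $ i)) + s $ j * (\<psi> x $ j \<bullet> cross3 (\<psi>' x h $ j) (\<psi>' x h' $ j))
      = r $ i * (\<phi> x $ i \<bullet> cross3 (\<phi>' x h $ i) (\<phi>' x h' $ i)) + r $ j * (\<phi> x $ j \<bullet> cross3 (\<phi>' x h $ j) (\<phi>' x h' $ j))"
      by (rule symp_form_pair_invariant[OF T(3)[OF x] T(3)[OF x] cross[OF x] T(4)[OF x] T(4)[OF x] T(4)[OF x] T(4)[OF x] \<psi>i \<psi>j U1[OF x] U2[OF x] _
          p12 T'(4)[OF x] T'(4)[OF x] sumV p34 p12 T'(4)[OF x] T'(4)[OF x] sumV p34]) (use det[OF x] in simp)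
    have "(\<Sum>k\<in>UNIV - {i, j}. s $ k * (\<psi> x $ k \<bullet> cross3 (\<psi>' x h $ k) (\<psi>' x h' $ k)))
      = (\<Sum>k\<in>UNIV - {i, j}. r $ k * (\<phi> x $ k \<bullet> cross3 (\<phi>' x h $ k) (\<phi>' x h' $ k)))"
      by (rule sum.cong) (auto simp: so oth \<psi>k)
    then show ?thesis unfolding symp_form_def split pair by simp
  qed
  have vol: "liouville_volume s U \<psi> \<psi>' = liouville_volume r U \<phi> \<phi>'"
    unfolding liouville_volume_def
    by (rule nn_integral_cong) (simp add: form indicator_def)
  show thesis by (rule that[OF L' vol]) (simp add: sumf)
qed

section \<open>Finiteness of the volume\<close>

lemma frame_rotation:
  fixes b D :: "3 \<Rightarrow> real^3"
  assumes b: "cross3 (b 1) (b 2) = b 3" "cross3 (b 2) (b 3) = b 1" "cross3 (b 3) (b 1) = b 2"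
    and on: "\<And>v. v = (v \<bullet> b 1) *\<^sub>R b 1 + (v \<bullet> b 2) *\<^sub>R b 2 + (v \<bullet> b 3) *\<^sub>R b 3"
    and D: "\<And>p q. D p \<bullet> b q + b p \<bullet> D q = 0"
  shows "\<exists>\<eta>. \<forall>p. D p = cross3 (b p) \<eta>"
proof -
  \<comment> \<open>The matrix of products \<open>D p \<bullet> b q\<close> is skew; these three
    entries determine it and are the coordinates of the rotation vector.\<close>
  define e1 e2 e3 where "e1 = D 3 \<bullet> b 2" and "e2 = D 1 \<bullet> b 3" and "e3 = D 2 \<bullet> b 1"
  have z: "D p \<bullet> b p = 0" for p using D[of p p] by (simp add: inner_commute)
  have e: "D 2 \<bullet> b 3 = - e1" "D 3 \<bullet> b 1 = - e2" "D 1 \<bullet> b 2 = - e3"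
    using D[of 3 2] D[of 1 3] D[of 2 1] by (simp_all add: e1_def e2_def e3_def inner_commute)
  have b': "cross3 (b 2) (b 1) = - b 3" "cross3 (b 3) (b 2) = - b 1" "cross3 (b 1) (b 3) = - b 2"
    using b by (metis cross_skew)+
  define \<eta> where "\<eta> = e1 *\<^sub>R b 1 + e2 *\<^sub>R b 2 + e3 *\<^sub>R b 3"
  have "D 1 = cross3 (b 1) \<eta>"
    by (subst on[of "D 1"]) (simp add: \<eta>_def cross_add_right cross_mult_right b b' z e flip: e2_def)
  moreover have "D 2 = cross3 (b 2) \<eta>"
    by (subst on[of "D 2"]) (simp add: \<eta>_def cross_add_right cross_mult_right b b' z e flip: e3_def)
  moreover have "D 3 = cross3 (b 3) \<eta>"
    by (subst on[of "D 3"]) (simp add: \<eta>_def cross_add_right cross_mult_right b b' z e flip: e1_def)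
  ultimately have "\<forall>p. D p = cross3 (b p) \<eta>" unfolding forall_3 by blast
  then show ?thesis ..
qed

text \<open>The three correction terms are linear in \<open>v\<close>, \<open>v'\<close> and
  \<open>u\<close>, respectively. Summed over a closed polygon with weights \<open>r\<close> they
  vanish, which is why the form descends to the quotient.\<close>

lemma triple_add_rotation:
  fixes u v v' \<eta> \<eta>' :: "real^3"
  assumes "norm u = 1" "v \<bullet> u = 0" "v' \<bullet> u = 0"
  shows "u \<bullet> cross3 (v + cross3 \<eta> u) (v' + cross3 \<eta>' u) = u \<bullet> cross3 v v' - v \<bullet> \<eta>' + v' \<bullet> \<eta> + u \<bullet> cross3 \<eta> \<eta>'"
proof -
  have uu: "u \<bullet> u = 1" using assms by (simp add: norm_eq_1)
  have 1: "u \<bullet> cross3 v (cross3 \<eta>' u) = - (v \<bullet> \<eta>')" if "v \<bullet> u = 0" for v \<eta>'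
    using uu that by (simp add: Lagrange inner_diff_right)
  have 2: "u \<bullet> cross3 (cross3 \<eta> u) v' = v' \<bullet> \<eta>"
    using 1[OF assms(3), of \<eta>] by (metis cross_skew inner_minus_right minus_minus)
  have 3: "u \<bullet> cross3 (cross3 \<eta> u) (cross3 \<eta>' u) = u \<bullet> cross3 \<eta> \<eta>'"
  proof -
    have "cross3 (cross3 \<eta> u) (cross3 \<eta>' u) = (cross3 \<eta> u \<bullet> u) *\<^sub>R \<eta>' - (cross3 \<eta> u \<bullet> \<eta>') *\<^sub>R u"
      by (simp add: Lagrange)
    then have "u \<bullet> cross3 (cross3 \<eta> u) (cross3 \<eta>' u) = - (cross3 \<eta> u \<bullet> \<eta>')"
      using uu by (simp add: inner_diff_right dot_cross_self)
    also have "cross3 \<eta> u \<bullet> \<eta>' = - (u \<bullet> cross3 \<eta> \<eta>')"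
      by (metis cross_triple cross_skew inner_commute inner_minus_left)
    finally show ?thesis by simp
  qed
  show ?thesis
    using 1[OF assms(2), of \<eta>'] 2 3 by (simp add: cross_add_left cross_add_right inner_add_right)
qed

lemma orthonormal_frame_matrix:
  fixes b :: "3 \<Rightarrow> real^3"
  assumes b: "cross3 (b 1) (b 2) = b 3" "b 1 \<bullet> b 2 = 0" "norm (b 1) = 1" "norm (b 2) = 1"
  shows "rotation_matrix (\<chi> p. b p)" "cross3 (b 2) (b 3) = b 1" "cross3 (b 3) (b 1) = b 2"
    "v = (v \<bullet> b 1) *\<^sub>R b 1 + (v \<bullet> b 2) *\<^sub>R b 2 + (v \<bullet> b 3) *\<^sub>R b 3" "p \<noteq> q \<Longrightarrow> b p \<bullet> b q = 0" "b p \<bullet> b p = 1"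
proof -
  have n3: "b 3 \<bullet> b 3 = 1" using norm_cross[of "b 1" "b 2"] b by (simp add: power2_norm_eq_inner)
  have n12: "b 1 \<bullet> b 1 = 1" "b 2 \<bullet> b 2 = 1" using b by (simp_all add: norm_eq_1)
  have o: "b 1 \<bullet> b 3 = 0" "b 2 \<bullet> b 3 = 0" unfolding b(1)[symmetric] by (simp_all add: dot_cross_self)
  show one: "b p \<bullet> b p = 1" for p using exhaust_3[of p] n3 n12 by auto
  show orth: "b p \<bullet> b q = 0" if "p \<noteq> q" for p q
    using exhaust_3[of p] exhaust_3[of q] that o b(2) by (auto simp: inner_commute)
  show c1: "cross3 (b 2) (b 3) = b 1"
    unfolding b(1)[symmetric] Lagrange inner_commute[of "b 2" "b 1"] b(2) n12 by simp
  have "cross3 (b 3) (b 1) = - cross3 (b 1) (b 3)" by (rule cross_skew)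
  also have "\<dots> = b 2" unfolding b(1)[symmetric] Lagrange b(2) n12 by simp
  finally show c2: "cross3 (b 3) (b 1) = b 2" .
  define B where "B = (\<chi> p. b p)"
  have "(B ** transpose B) $ p $ q = b p \<bullet> b q" for p q
    by (simp add: matrix_matrix_mult_def transpose_def B_def inner_vec_def)
  then have BB: "B ** transpose B = mat 1"
    by (simp add: vec_eq_iff[of "B ** transpose B"] vec_eq_iff[of "(B ** transpose B) $ _"] mat_def one orth)
  then have orthB: "orthogonal_matrix B" unfolding orthogonal_matrix_def using matrix_left_right_inverse by blast
  have "det B = b 1 \<bullet> cross3 (b 2) (b 3)"
    by (simp add: det_3 B_def cross3_def inner_vec_def sum_3 vector_def algebra_simps)
  also have "\<dots> = 1" using c1 n12 by simp
  finally show "rotation_matrix (\<chi> p. b p)" using orthB by (simp add: rotation_matrix_def B_def)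
  have "transpose B *v (B *v v) = v" using orthB unfolding orthogonal_matrix_def by (simp add: matrix_vector_mul_assoc)
  moreover have "B *v v = (\<chi> p. v \<bullet> b p)"
    by (simp add: vec_eq_iff matrix_vector_mult_def B_def inner_vec_def mult.commute)
  moreover have "transpose B *v x = x $ 1 *\<^sub>R b 1 + x $ 2 *\<^sub>R b 2 + x $ 3 *\<^sub>R b 3" for x
    by (simp add: vec_eq_iff matrix_vector_mult_def transpose_def B_def sum_3 mult.commute)
  ultimately show "v = (v \<bullet> b 1) *\<^sub>R b 1 + (v \<bullet> b 2) *\<^sub>R b 2 + (v \<bullet> b 3) *\<^sub>R b 3" by simp
qed

lemma collinear_linear_image:
  assumes "collinear S" "linear f" shows "collinear (f ` S)"
proof -
  obtain u where u: "\<And>x y. x \<in> S \<Longrightarrow> y \<in> S \<Longrightarrow> \<exists>c. x - y = c *\<^sub>R u" using assms(1) unfolding collinear_def by blast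
  have "\<exists>c. f x - f y = c *\<^sub>R f u" if "x \<in> S" "y \<in> S" for x y
    using u[OF that] linear_diff[OF assms(2), of x y] linear_cmul[OF assms(2)] by metis
  then show ?thesis unfolding collinear_def by blast
qed

lemma frame_matrix_mult: "(\<chi> p. b p) *v v = (\<chi> p. v \<bullet> b p)" for b :: "3 \<Rightarrow> real^3"
  by (simp add: vec_eq_iff matrix_vector_mult_def inner_vec_def mult.commute)

text \<open>Each polygon is turned by a rotation that depends on the point, so its class in the
  quotient stays the same. The velocities acquire infinitesimal rotations, to which the form is
  blind on closed polygons.\<close>

lemma gauge_section:
  fixes r :: "real^'n::finite" and b :: "real^('n chart_dim) \<Rightarrow> 3 \<Rightarrow> real^3"
  assumes L: "local_section r U \<phi> \<phi>'"
    and b: "\<And>p. C1_on U (\<lambda>x. b x p)" "\<And>x. x \<in> U \<Longrightarrow> cross3 (b x 1) (b x 2) = b x 3" "\<And>x. x \<in> U \<Longrightarrow> b x 1 \<bullet> b x 2 = 0"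
      "\<And>x. x \<in> U \<Longrightarrow> norm (b x 1) = 1" "\<And>x. x \<in> U \<Longrightarrow> norm (b x 2) = 1"
  defines "w \<equiv> \<lambda>x. \<chi> k. \<chi> p. \<phi> x $ k \<bullet> b x p"
  shows "local_section r U w (\<lambda>x. frechet_derivative w (at x))"
    "liouville_volume r U w (\<lambda>x. frechet_derivative w (at x)) = liouville_volume r U \<phi> \<phi>'"
proof -
  define B where "B x = (\<chi> p. b x p)" for x
  define w' where "w' x = frechet_derivative w (at x)" for x
  have U: "open U" and C1: "C1_on U \<phi>" and inj: "\<And>x y. x \<in> U \<Longrightarrow> y \<in> U \<Longrightarrow> (\<phi> x, \<phi> y) \<in> so3_rel \<Longrightarrow> x = y"
    using L unfolding local_section_iff_C1_on by blast+
  note T = local_section_tangent[OF L]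
  note F = orthonormal_frame_matrix[OF b(2) b(3) b(4) b(5)]
  have wB: "w x $ k = B x *v \<phi> x $ k" for x k unfolding B_def frame_matrix_mult w_def by simp
  have rot: "rotation_matrix (B x)" if "x \<in> U" for x unfolding B_def by (rule F(1)[OF that that that that])
  have C1w: "C1_on U w" unfolding w_def by (intro C1_intros C1 b)
  have inv: "transpose (B x) *v (B x *v v) = v" if "x \<in> U" for x v
    using rot[OF that] unfolding rotation_matrix_def orthogonal_matrix_def by (simp add: matrix_vector_mul_assoc)
  have reg: "w x \<in> regular_level r" if x: "x \<in> U" for x
  proof -
    have "norm (w x $ k) = 1" for k
      using rotation_matrix_inner[OF rot[OF x], of "\<phi> x $ k" "\<phi> x $ k"] T(3)[OF x, of k] by (simp add: wB norm_eq_1)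
    moreover have "(\<Sum>k\<in>UNIV. r $ k *\<^sub>R w x $ k) = B x *v (\<Sum>k\<in>UNIV. r $ k *\<^sub>R \<phi> x $ k)"
      unfolding wB by (simp add: linear_sum[OF matrix_vector_mul_linear] matrix_vector_mult_scaleR)
    moreover have "\<not> degenerate (w x)"
    proof
      assume "degenerate (w x)"
      then have "collinear ((\<lambda>v. transpose (B x) *v v) ` insert 0 (range (($) (w x))))"
        unfolding degenerate_def by (intro collinear_linear_image matrix_vector_mul_linear)
      moreover have "(\<lambda>v. transpose (B x) *v v) ` insert 0 (range (($) (w x))) = insert 0 (range (($) (\<phi> x)))"
        by (simp only: image_insert image_image wB inv[OF x] matrix_vector_mult_0_right)
      ultimately show False using T(7)[OF x] by (simp add: degenerate_def)
    qed
    ultimately show ?thesis using T(5)[OF x] by (simp add: regular_level_def zero_level_def moment_map_def)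
  qed
  have inj': "x = y" if xy: "x \<in> U" "y \<in> U" "(w x, w y) \<in> so3_rel" for x y
  proof -
    obtain A where A: "rotation_matrix A" "w y = (\<chi> k. A *v w x $ k)" using xy(3) by (auto simp: so3_rel_def)
    have "B y *v \<phi> y $ k = A *v (B x *v \<phi> x $ k)" for k using A(2) by (simp add: vec_eq_iff[of "w y"] flip: wB)
    then have "\<phi> y $ k = transpose (B y) *v (A *v (B x *v \<phi> x $ k))" for k using inv[OF xy(2)] by metis
    then have "\<phi> y = (\<chi> k. (transpose (B y) ** A ** B x) *v \<phi> x $ k)"
      by (simp add: vec_eq_iff[of "\<phi> y"] matrix_vector_mul_assoc matrix_mul_assoc)
    moreover have "rotation_matrix (transpose (B y) ** A ** B x)"
      using rot[OF xy(1)] rot[OF xy(2)] A(1) unfolding rotation_matrix_def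
      by (simp add: orthogonal_matrix_mul orthogonal_matrix_transpose det_mul det_transpose)
    ultimately show ?thesis using inj[OF xy(1,2)] by (auto simp: so3_rel_def)
  qed
  have L': "local_section r U w w'"
  proof (rule local_section_iff_C1_on[THEN iffD2], intro conjI)
    show "open U" by fact
    show "w ` U \<subseteq> regular_level r" using reg by blast
    show "C1_on U w" by fact
    show "\<forall>x\<in>U. w' x = frechet_derivative w (at x)" unfolding w'_def by simp
    show "\<forall>x\<in>U. \<forall>y\<in>U. (w x, w y) \<in> so3_rel \<longrightarrow> x = y" using inj' by blast
  qed
  note T' = local_section_tangent[OF L']
  have form: "symp_form r (w x) (w' x h) (w' x h') = symp_form r (\<phi> x) (\<phi>' x h) (\<phi>' x h')" if x: "x \<in> U" for x h h'
  proof -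
    define b' where "b' p = frechet_derivative (\<lambda>x. b x p) (at x)" for p
    have b': "((\<lambda>x. b x p) has_derivative b' p) (at x)" for p
      unfolding b'_def by (rule C1_on_frechet_derivative(1)[OF b(1) x])
    have dk: "((\<lambda>x. \<phi> x $ k) has_derivative (\<lambda>h. \<phi>' x h $ k)) (at x)" for k
      using bounded_linear.has_derivative[OF bounded_linear_vec_nth T(2)[OF x]] .
    have dw: "w' x h $ k $ p = \<phi> x $ k \<bullet> b' p h + \<phi>' x h $ k \<bullet> b x p" for h k p
    proof -
      have "((\<lambda>x. w x $ k $ p) has_derivative (\<lambda>h. w' x h $ k $ p)) (at x)"
        by (rule bounded_linear.has_derivative[OF bounded_linear_vec_nth bounded_linear.has_derivative[OF bounded_linear_vec_nth T'(2)[OF x]]])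
      then have 1: "((\<lambda>x. \<phi> x $ k \<bullet> b x p) has_derivative (\<lambda>h. w' x h $ k $ p)) (at x)" by (simp add: w_def)
      have 2: "((\<lambda>x. \<phi> x $ k \<bullet> b x p) has_derivative (\<lambda>h. \<phi> x $ k \<bullet> b' p h + \<phi>' x h $ k \<bullet> b x p)) (at x)"
        by (intro has_derivative_inner dk b')
      show ?thesis using has_derivative_unique[OF 1 2] by meson
    qed
    have "\<exists>\<eta>. \<forall>p. b' p h = cross3 (b x p) \<eta>" for h
    proof (rule frame_rotation)
      show "cross3 (b x 1) (b x 2) = b x 3" "cross3 (b x 2) (b x 3) = b x 1" "cross3 (b x 3) (b x 1) = b x 2"
        using b(2)[OF x] F(2,3)[OF x x x x] by auto
      show "v = (v \<bullet> b x 1) *\<^sub>R b x 1 + (v \<bullet> b x 2) *\<^sub>R b x 2 + (v \<bullet> b x 3) *\<^sub>R b x 3" for v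
        by (rule F(4)[OF x x x x])
      show "b' p h \<bullet> b x q + b x p \<bullet> b' q h = 0" for p q
      proof -
        have "((\<lambda>x. b x p \<bullet> b x q) has_derivative (\<lambda>h. b x p \<bullet> b' q h + b' p h \<bullet> b x q)) (at x)"
          by (intro has_derivative_inner b')
        moreover have "b y p \<bullet> b y q = (if p = q then 1 else 0)" if "y \<in> U" for y
          using F(5,6)[OF that that that that] by simp
        ultimately have "(\<lambda>h. b x p \<bullet> b' q h + b' p h \<bullet> b x q) = (\<lambda>h. 0)"
          by (rule has_derivative_const_on_open[OF U x])
        then show ?thesis by (metis add.commute)
      qed
    qed
    then obtain \<eta> where \<eta>: "\<And>h p. b' p h = cross3 (b x p) (\<eta> h)" by metis
    have dw': "w' x h $ k = B x *v (\<phi>' x h $ k + cross3 (\<eta> h) (\<phi> x $ k))" for h k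
    proof -
      have "\<phi> x $ k \<bullet> cross3 (b x p) (\<eta> h) = cross3 (\<eta> h) (\<phi> x $ k) \<bullet> b x p" for p
        by (metis cross_triple inner_commute)
      then show ?thesis unfolding B_def frame_matrix_mult by (simp add: vec_eq_iff dw \<eta> inner_add_left)
    qed
    have "symp_form r (w x) (w' x h) (w' x h') =
      (\<Sum>k\<in>UNIV. r $ k * (\<phi> x $ k \<bullet> cross3 (\<phi>' x h $ k + cross3 (\<eta> h) (\<phi> x $ k)) (\<phi>' x h' $ k + cross3 (\<eta> h') (\<phi> x $ k))))"
      unfolding symp_form_def dw' wB cross_rotation_matrix[OF rot[OF x]] rotation_matrix_inner[OF rot[OF x]] ..
    also have "\<dots> = (\<Sum>k\<in>UNIV. r $ k * (\<phi> x $ k \<bullet> cross3 (\<phi>' x h $ k) (\<phi>' x h' $ k)) - (r $ k *\<^sub>R \<phi>' x h $ k) \<bullet> \<eta> h'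
       + (r $ k *\<^sub>R \<phi>' x h' $ k) \<bullet> \<eta> h + (r $ k *\<^sub>R \<phi> x $ k) \<bullet> cross3 (\<eta> h) (\<eta> h'))"
      unfolding triple_add_rotation[OF T(3)[OF x] T(4)[OF x] T(4)[OF x]] by (simp add: algebra_simps)
    also have "\<dots> = symp_form r (\<phi> x) (\<phi>' x h) (\<phi>' x h')"
      unfolding sum.distrib sum_subtractf inner_sum_left[symmetric] T(5)[OF x] T(6)[OF x] symp_form_def by simp
    finally show ?thesis .
  qed
  show "local_section r U w (\<lambda>x. frechet_derivative w (at x))" using L' by (simp add: w'_def[abs_def])
  have "liouville_volume r U w w' = liouville_volume r U \<phi> \<phi>'"
    unfolding liouville_volume_def
    by (rule nn_integral_cong) (simp add: form indicator_def)
  then show "liouville_volume r U w (\<lambda>x. frechet_derivative w (at x)) = liouville_volume r U \<phi> \<phi>'"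
    by (simp add: w'_def[abs_def])
qed

lemma C1_on_normalize:
  fixes f :: "'a::real_normed_vector \<Rightarrow> real^3"
  assumes "C1_on S f" "\<And>x. x \<in> S \<Longrightarrow> f x \<noteq> 0"
  shows "C1_on S (\<lambda>x. (1 / sqrt (f x \<bullet> f x)) *\<^sub>R f x)"
  by (intro C1_intros assms(1)) (use assms(2) in auto)

text \<open>The third axis is taken along the diagonal \<open>f\<close> and the second along the
  normal of the triangle over it, which uses up the three rotational degrees of freedom.\<close>

lemma body_frame_section:
  fixes r :: "real^'n::finite"
  assumes L: "local_section r U \<phi> \<phi>'" and np: "\<And>x. x \<in> U \<Longrightarrow> cross3 (\<phi> x $ i) (\<phi> x $ j) \<noteq> 0" and r: "r $ i > 0" "r $ j > 0"
  obtains w w' where "local_section r U w w'" "liouville_volume r U w w' = liouville_volume r U \<phi> \<phi>'"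
    "\<And>x. x \<in> U \<Longrightarrow> w x $ i $ 2 = 0" "\<And>x. x \<in> U \<Longrightarrow> w x $ j $ 2 = 0"
    "\<And>x. x \<in> U \<Longrightarrow> (r $ i *\<^sub>R w x $ i + r $ j *\<^sub>R w x $ j) $ 1 = 0"
    "\<And>x. x \<in> U \<Longrightarrow> (r $ i *\<^sub>R w x $ i + r $ j *\<^sub>R w x $ j) $ 3 > 0"
    "\<And>x. x \<in> U \<Longrightarrow> (cross3 (w x $ i) (w x $ j)) $ 2 > 0"
proof -
  define f where "f x = r $ i *\<^sub>R \<phi> x $ i + r $ j *\<^sub>R \<phi> x $ j" for x
  define n where "n x = cross3 (\<phi> x $ i) (\<phi> x $ j)" for x
  define z where "z x = (1 / sqrt (f x \<bullet> f x)) *\<^sub>R f x" for x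
  define y where "y x = (1 / sqrt (n x \<bullet> n x)) *\<^sub>R n x" for x
  define b where "b x p = (if p = 1 then cross3 (y x) (z x) else if p = 2 then y x else z x)" for x and p :: 3
  have C1: "C1_on U \<phi>" using L unfolding local_section_iff_C1_on by blast
  have n0: "n x \<noteq> 0" if "x \<in> U" for x using np[OF that] by (simp add: n_def)
  \<comment> \<open>The cross product of \<open>f x\<close> with \<open>\<phi> x $ j\<close> is
    \<open>r $ i\<close> times the nonzero normal \<open>n x\<close>.\<close>
  have f0: "f x \<noteq> 0" if "x \<in> U" for x
  proof
    assume "f x = 0"
    then have "cross3 (f x) (\<phi> x $ j) = 0" by simp
    then have "r $ i *\<^sub>R n x = 0" by (simp add: f_def n_def cross_add_left cross_mult_left)
    then show False using r n0[OF that] by simp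
  qed
  have C1y: "C1_on U y" unfolding y_def by (rule C1_on_normalize) (use n0 in \<open>auto simp: n_def intro!: C1_intros C1\<close>)
  have C1z: "C1_on U z" unfolding z_def by (rule C1_on_normalize) (use f0 in \<open>auto simp: f_def intro!: C1_intros C1\<close>)
  have C1b: "C1_on U (\<lambda>x. b x p)" for p
    unfolding b_def by (cases "p = 1"; cases "p = 2"; simp; intro C1_intros C1y C1z)
  have nf: "n x \<bullet> f x = 0" for x by (simp add: n_def f_def inner_add_right dot_cross_self)
  have yz: "y x \<bullet> z x = 0" for x by (simp add: y_def z_def nf)
  have ny: "norm (y x) = 1" "norm (z x) = 1" if "x \<in> U" for x
    using n0[OF that] f0[OF that] by (simp_all add: y_def z_def norm_eq_sqrt_inner)
  have nyz: "norm (cross3 (y x) (z x)) = 1" if "x \<in> U" for x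
  proof -
    have "(norm (cross3 (y x) (z x)))\<^sup>2 = 1" using norm_cross[of "y x" "z x"] ny[OF that] yz by simp
    then show ?thesis by (metis norm_ge_zero power2_eq_1_iff neg_0_le_iff_le not_one_le_zero)
  qed
  have bc: "cross3 (b x 1) (b x 2) = b x 3" if "x \<in> U" for x
  proof -
    have "cross3 (cross3 (y x) (z x)) (y x) = - cross3 (y x) (cross3 (y x) (z x))" by (rule cross_skew)
    also have "\<dots> = z x" using ny[OF that] yz by (simp add: Lagrange norm_eq_1)
    finally show ?thesis by (simp add: b_def)
  qed
  have bo: "b x 1 \<bullet> b x 2 = 0" for x by (simp add: b_def dot_cross_self)
  have bn: "norm (b x 1) = 1" "norm (b x 2) = 1" if "x \<in> U" for x using ny[OF that] nyz[OF that] by (simp_all add: b_def)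
  define w where "w = (\<lambda>x. \<chi> k. \<chi> p. \<phi> x $ k \<bullet> b x p)"
  note G = gauge_section[OF L C1b bc bo bn, folded w_def]
  have wf: "(r $ i *\<^sub>R w x $ i + r $ j *\<^sub>R w x $ j) $ p = f x \<bullet> b x p" for x p
    by (simp add: w_def f_def inner_add_left)
  show thesis
  proof (rule that[OF G])
    fix x assume x: "x \<in> U"
    have yn: "y x \<bullet> \<phi> x $ i = 0" "y x \<bullet> \<phi> x $ j = 0" by (simp_all add: y_def n_def dot_cross_self)
    then show "w x $ i $ 2 = 0" "w x $ j $ 2 = 0" by (simp_all add: w_def b_def inner_commute)
    show "(r $ i *\<^sub>R w x $ i + r $ j *\<^sub>R w x $ j) $ 1 = 0"
      unfolding wf b_def z_def by (simp add: cross_mult_right dot_cross_self)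
    show "(r $ i *\<^sub>R w x $ i + r $ j *\<^sub>R w x $ j) $ 3 > 0"
      unfolding wf b_def z_def using f0[OF x] by simp
    note F = orthonormal_frame_matrix[OF bc[OF x] bo bn[OF x]]
    have "cross3 (w x $ i) (w x $ j) = (\<chi> p. b x p) *v n x"
      using cross_rotation_matrix[OF F(1), of "\<phi> x $ i" "\<phi> x $ j"] unfolding frame_matrix_mult by (simp add: w_def n_def)
    then have "cross3 (w x $ i) (w x $ j) $ 2 = n x \<bullet> y x" unfolding frame_matrix_mult by (simp add: b_def)
    also have "\<dots> > 0" using n0[OF x] by (simp add: y_def)
    finally show "cross3 (w x $ i) (w x $ j) $ 2 > 0" .
  qed
qed

text \<open>The change of variables theorem requires a wellordered index type.\<close>

instantiation chart_dim :: (finite) wellorder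
begin

definition less_eq_chart_dim :: "'a chart_dim \<Rightarrow> 'a chart_dim \<Rightarrow> bool" where
  "x \<le> y \<longleftrightarrow> Rep_chart_dim x \<le> Rep_chart_dim y"

definition less_chart_dim :: "'a chart_dim \<Rightarrow> 'a chart_dim \<Rightarrow> bool" where
  "x < y \<longleftrightarrow> Rep_chart_dim x < Rep_chart_dim y"

instance
proof
  fix P :: "'a chart_dim \<Rightarrow> bool" and a
  assume step: "\<And>x. (\<And>y. y < x \<Longrightarrow> P y) \<Longrightarrow> P x"
  show "P a"
  proof (induction "Rep_chart_dim a" arbitrary: a rule: less_induct)
    case less
    show ?case by (rule step) (simp add: less less_chart_dim_def)
  qed
qed (auto simp: less_eq_chart_dim_def less_chart_dim_def Rep_chart_dim_inject)

end

section \<open>Determinants and integrals of densities\<close>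

lemma continuous_on_det:
  fixes A :: "'a::topological_space \<Rightarrow> real^'k^'k"
  assumes "\<And>i j. continuous_on S (\<lambda>x. A x $ i $ j)"
  shows "continuous_on S (\<lambda>x. det (A x))"
  unfolding det_def by (intro continuous_intros assms)

lemma abs_det_le:
  fixes A :: "real^'k::finite^'k"
  assumes "\<And>i j. \<bar>A $ i $ j\<bar> \<le> m"
  shows "\<bar>det A\<bar> \<le> real (card {p. p permutes (UNIV :: 'k set)}) * m ^ CARD('k)"
proof -
  have "\<bar>det A\<bar> \<le> (\<Sum>p\<in>{p. p permutes (UNIV :: 'k set)}. \<bar>of_int (sign p) * (\<Prod>i\<in>UNIV. A $ i $ p i)\<bar>)"
    unfolding det_def by (rule sum_abs)
  also have "\<dots> \<le> (\<Sum>p\<in>{p. p permutes (UNIV :: 'k set)}. m ^ CARD('k))"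
  proof (rule sum_mono)
    fix p assume "p \<in> {p. p permutes (UNIV :: 'k set)}"
    have "\<bar>\<Prod>i\<in>UNIV. A $ i $ p i\<bar> \<le> (\<Prod>i\<in>(UNIV :: 'k set). m)"
      unfolding abs_prod by (rule prod_mono) (simp add: assms)
    then show "\<bar>of_int (sign p) * (\<Prod>i\<in>UNIV. A $ i $ p i)\<bar> \<le> m ^ CARD('k)"
      by (simp add: abs_mult sign_def)
  qed
  finally show ?thesis by simp
qed

text \<open>By the change of variables formula for an injective map, the integral of the Jacobian is
  the measure of the image.\<close>

lemma nn_integral_abs_det_le:
  fixes T :: "real^'m::{finite,wellorder} \<Rightarrow> real^'m::_"
  assumes P: "open P" and der: "\<And>x. x \<in> P \<Longrightarrow> (T has_derivative J x) (at x)" and inj: "inj_on T P" and im: "T ` P \<subseteq> cbox a b" and K: "K \<ge> 0"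
  shows "(\<integral>\<^sup>+x\<in>P. ennreal (K * \<bar>det (matrix (J x))\<bar>) \<partial>lborel) \<le> ennreal (K * measure lebesgue (cbox a b))"
proof -
  have der': "(T has_derivative J x) (at x within P)" if "x \<in> P" for x
    using der[OF that] by (rule has_derivative_at_withinI)
  have Pl: "P \<in> sets lebesgue" using P by (simp add: borel_open)
  have "T differentiable_on P" using der' unfolding differentiable_on_def differentiable_def by blast
  then have "T ` P \<in> sets lebesgue"
    by (intro differentiable_image_in_sets_lebesgue[OF Pl]) simp_all
  then have lm: "T ` P \<in> lmeasurable" using im bounded_subset[OF bounded_cbox im] by (simp add: bounded_set_imp_lmeasurable)
  have "((\<lambda>x. \<bar>det (matrix (J x))\<bar>) has_integral measure lebesgue (T ` P)) P"
    using has_measure_differentiable_image[OF Pl der' inj] lm by blast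
  then have "((\<lambda>x. K * \<bar>det (matrix (J x))\<bar>) has_integral K * measure lebesgue (T ` P)) P"
    by (rule has_integral_mult_right)
  then have "(\<integral>\<^sup>+x\<in>P. ennreal (K * \<bar>det (matrix (J x))\<bar>) \<partial>lborel) = ennreal (K * measure lebesgue (T ` P))"
    using K by (intro nn_integral_has_integral_lebesgue') auto
  also have "measure lebesgue (T ` P) \<le> measure lebesgue (cbox a b)"
    by (intro measure_mono_fmeasurable im) (use lm in \<open>auto simp: fmeasurableD\<close>)
  finally show ?thesis using K by (simp add: ennreal_leI mult_left_mono)
qed

lemma local_section_density:
  fixes r :: "real^'n::finite"
  assumes L: "local_section r U \<phi> \<phi>'"
  defines "f \<equiv> \<lambda>x. ennreal (sqrt \<bar>det (\<chi> a b. symp_form r (\<phi> x) (\<phi>' x (axis a 1)) (\<phi>' x (axis b 1)))\<bar>)"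
  shows "(\<lambda>x. f x * indicator U x) \<in> borel_measurable lborel"
proof -
  have U: "open U" and c': "\<And>h. continuous_on U (\<lambda>x. \<phi>' x h)" using L unfolding local_section_def by blast+
  have cp: "continuous_on U \<phi>" using L C1_on_imp_continuous_on unfolding local_section_iff_C1_on by blast
  have "continuous_on U (\<lambda>x. sqrt \<bar>det (\<chi> a b. symp_form r (\<phi> x) (\<phi>' x (axis a 1)) (\<phi>' x (axis b 1)))\<bar>)"
    by (intro continuous_intros continuous_on_det) (auto simp: symp_form_def intro!: continuous_intros continuous_on_cross cp c')
  then have "(\<lambda>x. indicator U x *\<^sub>R sqrt \<bar>det (\<chi> a b. symp_form r (\<phi> x) (\<phi>' x (axis a 1)) (\<phi>' x (axis b 1)))\<bar>) \<in> borel_measurable borel"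
    by (intro borel_measurable_continuous_on_indicator) (use U in auto)
  then have "(\<lambda>x. ennreal (indicator U x *\<^sub>R sqrt \<bar>det (\<chi> a b. symp_form r (\<phi> x) (\<phi>' x (axis a 1)) (\<phi>' x (axis b 1)))\<bar>)) \<in> borel_measurable borel"
    by measurable
  moreover have "ennreal (indicator U x *\<^sub>R g) = ennreal g * indicator U x" for x and g :: real
    by (simp add: indicator_def)
  ultimately show ?thesis unfolding f_def measurable_lborel2 by (simp only:)
qed

lemma local_section_subset:
  assumes "local_section r U \<phi> \<phi>'" "open V" "V \<subseteq> U" shows "local_section r V \<phi> \<phi>'"
  using assms unfolding local_section_def by (blast intro: continuous_on_subset)

lemma open_nonparallel:
  assumes "local_section r U \<phi> \<phi>'" shows "open (nonparallel i j \<phi> U)"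
proof -
  have "open U" "continuous_on U \<phi>" using assms C1_on_imp_continuous_on unfolding local_section_iff_C1_on by auto
  moreover have "nonparallel i j \<phi> U = U \<inter> (\<lambda>x. cross3 (\<phi> x $ i) (\<phi> x $ j)) -` (- {0})" by (auto simp: nonparallel_def)
  ultimately show ?thesis
    by (auto intro!: continuous_open_preimage continuous_on_cross continuous_intros)
qed

section \<open>Unit vectors as graphs over two of their components\<close>

definition nxt :: "3 \<Rightarrow> 3" where "nxt c = (if c = 1 then 2 else if c = 2 then 3 else 1)"

lemma forall_nxt: "(\<forall>p. Q p) \<longleftrightarrow> Q c \<and> Q (nxt c) \<and> Q (nxt (nxt c))"
  using exhaust_3[of c] by (auto simp: forall_3 nxt_def)

lemma inner_nxt: "(u :: real^3) \<bullet> v = u $ c * v $ c + u $ nxt c * v $ nxt c + u $ nxt (nxt c) * v $ nxt (nxt c)"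
  using exhaust_3[of c] by (auto simp: inner_vec_def sum_3 nxt_def)

text \<open>On the hemisphere where component \<open>c\<close> has the sign of
  \<open>\<sigma>\<close>, the norm determines this component from the other two.\<close>

lemma unit_vector_eqI:
  fixes u v :: "real^3"
  assumes "norm u = 1" "norm v = 1" "u $ nxt c = v $ nxt c" "u $ nxt (nxt c) = v $ nxt (nxt c)" "\<sigma> * u $ c > 0" "\<sigma> * v $ c > 0"
  shows "u = v"
proof -
  have "u \<bullet> u = v \<bullet> v" using assms by (simp add: norm_eq_1)
  then have "u $ c * u $ c = v $ c * v $ c" unfolding inner_nxt[of _ _ c] using assms by simp
  then have "u $ c = v $ c \<or> u $ c = - v $ c" by (simp add: square_eq_iff)
  then have "u $ c = v $ c" using assms(5,6) by auto
  then show ?thesis using assms(3,4) unfolding vec_eq_iff forall_nxt[of _ c] by simp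
qed

lemma norm_le_nxt: "norm (v :: real^3) \<le> \<bar>v $ c\<bar> + \<bar>v $ nxt c\<bar> + \<bar>v $ nxt (nxt c)\<bar>"
  using norm_le_l1_cart[of v] exhaust_3[of c] by (auto simp: sum_3 nxt_def)

text \<open>Orthogonality to \<open>u\<close> expresses \<open>v $ c * u $ c\<close> by the other
  components, so \<open>\<bar>v $ c\<bar> \<le> 2 * t / e\<close>; the other two components add
  \<open>2 * t\<close>.\<close>

lemma tangent_norm_le:
  fixes u v :: "real^3"
  assumes "norm u = 1" "v \<bullet> u = 0" "\<bar>v $ nxt c\<bar> \<le> t" "\<bar>v $ nxt (nxt c)\<bar> \<le> t" "\<bar>u $ c\<bar> \<ge> e" "e > 0"
  shows "norm v \<le> (2 + 2 / e) * t"
proof -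
  have uc: "\<bar>u $ p\<bar> \<le> 1" for p using component_le_norm_cart[of u p] assms by simp
  have "v $ c * u $ c = - (v $ nxt c * u $ nxt c + v $ nxt (nxt c) * u $ nxt (nxt c))"
    using assms(2) unfolding inner_nxt[of _ _ c] by linarith
  then have "\<bar>v $ c\<bar> * \<bar>u $ c\<bar> \<le> \<bar>v $ nxt c * u $ nxt c\<bar> + \<bar>v $ nxt (nxt c) * u $ nxt (nxt c)\<bar>"
    unfolding abs_mult[symmetric] by linarith
  also have "\<dots> \<le> t * 1 + t * 1" unfolding abs_mult by (intro add_mono mult_mono uc assms) (use assms(3) in linarith)+
  finally have "\<bar>v $ c\<bar> * \<bar>u $ c\<bar> \<le> 2 * t" by simp
  moreover have "\<bar>v $ c\<bar> * e \<le> \<bar>v $ c\<bar> * \<bar>u $ c\<bar>" using assms by (intro mult_left_mono) auto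
  ultimately have "\<bar>v $ c\<bar> \<le> 2 * t / e" using assms by (simp add: field_simps)
  then show ?thesis using norm_le_nxt[of v c] assms(3,4) by (simp add: field_simps)
qed

lemma unit_large_component:
  fixes u :: "real^3" assumes "norm u = 1" shows "\<exists>c. \<bar>u $ c\<bar> > 1 / 2"
proof (rule ccontr)
  assume "\<not> ?thesis"
  then have "\<bar>u $ c\<bar> \<le> 1 / 2" for c by (simp add: not_less)
  then have "(u $ c)\<^sup>2 \<le> 1 / 4" for c using power_mono[of "\<bar>u $ c\<bar>" "1/2" 2] by (simp add: power2_eq_square)
  from this[of 1] this[of 2] this[of 3] have "u \<bullet> u \<le> 3 / 4" by (simp add: inner_vec_def sum_3 power2_eq_square)
  then show False using assms by (simp add: norm_eq_1)
qed

lemma abs_triple_le: fixes u v w :: "real^3" assumes "norm u = 1" shows "\<bar>u \<bullet> cross3 v w\<bar> \<le> norm v * norm w"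
proof -
  have "\<bar>u \<bullet> cross3 v w\<bar> \<le> norm u * norm (cross3 v w)" by (rule Cauchy_Schwarz_ineq2)
  also have "(norm (cross3 v w))\<^sup>2 \<le> (norm v * norm w)\<^sup>2" by (simp add: norm_cross power_mult_distrib)
  then have "norm (cross3 v w) \<le> norm v * norm w" by (rule power2_le_imp_le) simp
  finally show ?thesis using assms by simp
qed

text \<open>Used with the pull-back \<open>B\<close> of the symplectic form under a section and the derivative \<open>J\<close> of coordinates in
  which the edges move with bounded speed.\<close>

lemma sqrt_det_form_le:
  fixes B :: "real^'k::finite \<Rightarrow> real^'k \<Rightarrow> real" and J :: "real^'k \<Rightarrow> real^'k"
  assumes B: "bilinear B" and J: "linear J" and m: "\<And>h h'. \<bar>B h h'\<bar> \<le> m * norm (J h) * norm (J h')" "m \<ge> 0"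
  shows "sqrt \<bar>det (\<chi> a b. B (axis a 1) (axis b 1))\<bar> \<le> sqrt (real (card {p. p permutes (UNIV :: 'k set)}) * m ^ CARD('k)) * \<bar>det (matrix J)\<bar>"
proof (cases "det (\<chi> a b. B (axis a 1) (axis b 1)) = 0")
  case False
  then have nd: "\<And>h. (\<forall>h'. B h h' = 0) \<Longrightarrow> h = 0" using det_bilinear_form_nz_iff[OF B] by blast
  \<comment> \<open>By the assumed bound, a direction not seen by \<open>J\<close> lies in the
    radical of \<open>B\<close>.\<close>
  have "h = 0" if "J h = 0" for h
    by (rule nd) (use m(1)[of h] that in auto)
  then have "inj J" using J linear_injective_0 by blast
  then obtain K where K: "linear K" "J \<circ> K = id" "K \<circ> J = id"
    using linear_injective_isomorphism[OF J] by (auto simp: fun_eq_iff)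
  \<comment> \<open>This is \<open>B\<close> in the coordinates given by \<open>J\<close>. Its
    matrix has entries at most \<open>m\<close>; passing back multiplies the determinant by
    \<open>(det (matrix J))\<^sup>2\<close>, of which the square root leaves one factor.\<close>
  define C where "C h h' = B (K h) (K h')" for h h'
  have linB: "linear (B x)" "linear (\<lambda>x. B x y)" for x y using B unfolding bilinear_def by auto
  have C: "linear (C x)" "linear (\<lambda>x. C x y)" for x y
    unfolding C_def using linear_compose[OF K(1) linB(1)] linear_compose[OF K(1) linB(2)] by (simp_all add: o_def)
  have BC: "B h h' = C (J h) (J h')" for h h' using K(3) by (simp add: C_def fun_eq_iff)
  define M where "M = (\<chi> a b. C (axis a 1) (axis b 1))"
  define A where "A = matrix J"
  have rep: "h = (\<Sum>i\<in>UNIV. h $ i *\<^sub>R axis i 1)" for h :: "real^'k"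
    using basis_expansion[of h] by (simp add: scalar_mult_eq_scaleR)
  have Cexp: "C g h = (\<Sum>a\<in>UNIV. \<Sum>b\<in>UNIV. g $ a * (M $ a $ b * h $ b))" for g h
  proof -
    have "C g h = C (\<Sum>i\<in>UNIV. g $ i *\<^sub>R axis i 1) (\<Sum>i\<in>UNIV. h $ i *\<^sub>R axis i 1)" using rep[of g] rep[of h] by simp
    then show ?thesis
      by (simp add: linear_sum[OF C(1)] linear_cmul[OF C(1)] linear_sum[OF C(2)] linear_cmul[OF C(2)] M_def sum_distrib_left mult_ac)
         (rule sum.swap)
  qed
  have "(\<chi> a b. B (axis a 1) (axis b 1)) = transpose A ** (M ** A)"
    by (simp add: vec_eq_iff BC Cexp matrix_matrix_mult_def transpose_def A_def matrix_def sum_distrib_left)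
  then have "det (\<chi> a b. B (axis a 1) (axis b 1)) = det A * (det M * det A)" by (simp add: det_mul det_transpose)
  then have "\<bar>det (\<chi> a b. B (axis a 1) (axis b 1))\<bar> = \<bar>det M\<bar> * (det A)\<^sup>2" by (simp add: abs_mult power2_eq_square)
  also have "\<dots> \<le> (real (card {p. p permutes (UNIV :: 'k set)}) * m ^ CARD('k)) * (det A)\<^sup>2"
  proof (intro mult_right_mono abs_det_le)
    fix a b
    have "\<bar>M $ a $ b\<bar> \<le> m * norm (J (K (axis a 1))) * norm (J (K (axis b 1)))" unfolding M_def by (simp add: C_def m(1))
    then show "\<bar>M $ a $ b\<bar> \<le> m" using K(2) by (simp add: fun_eq_iff norm_axis)
  qed simp
  finally have "sqrt \<bar>det (\<chi> a b. B (axis a 1) (axis b 1))\<bar> \<le> sqrt ((real (card {p. p permutes (UNIV :: 'k set)}) * m ^ CARD('k)) * (det A)\<^sup>2)"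
    by (rule real_sqrt_le_mono)
  then show ?thesis by (simp add: real_sqrt_mult A_def)
qed (use m in simp)

text \<open>Both triangles lie in the plane of the first and third axes over the same base
  \<open>f\<close>. The law of cosines determines \<open>p $ 3\<close>, and the orientation forces
  \<open>p $ 1 < 0\<close>.\<close>

lemma canonical_triangle_unique:
  fixes p q p' q' :: "real^3"
  assumes a: "a > 0" "b > 0" and n: "norm p = 1" "norm q = 1" "norm p' = 1" "norm q' = 1"
    and z: "p $ 2 = 0" "q $ 2 = 0" "p' $ 2 = 0" "q' $ 2 = 0"
    and f: "a *\<^sub>R p + b *\<^sub>R q = f" "a *\<^sub>R p' + b *\<^sub>R q' = f" "f $ 1 = 0" "f $ 3 > 0"
    and c: "cross3 p q $ 2 > 0" "cross3 p' q' $ 2 > 0"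
  shows "p = p' \<and> q = q'"
proof -
  have f2: "f $ 2 = 0" using f(1) z by auto
  have A: "2 * a * (f $ 3 * p $ 3) = f \<bullet> f + a\<^sup>2 - b\<^sup>2 \<and> p $ 1 < 0"
    if n: "norm p = 1" "norm q = 1" and z: "p $ 2 = 0" "q $ 2 = 0" and f1: "a *\<^sub>R p + b *\<^sub>R q = f" and c: "cross3 p q $ 2 > 0" for p q
  proof
    have "b *\<^sub>R q = f - a *\<^sub>R p" using f1 by auto
    then have "(b *\<^sub>R q) \<bullet> (b *\<^sub>R q) = (f - a *\<^sub>R p) \<bullet> (f - a *\<^sub>R p)" by simp
    then have "b\<^sup>2 = f \<bullet> f - 2 * a * (f \<bullet> p) + a\<^sup>2"
      using n by (simp add: inner_diff_left inner_diff_right inner_commute norm_eq_1 power2_eq_square algebra_simps)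
    moreover have "f \<bullet> p = f $ 3 * p $ 3" using f(3) f2 by (simp add: inner_vec_def sum_3)
    ultimately show "2 * a * (f $ 3 * p $ 3) = f \<bullet> f + a\<^sup>2 - b\<^sup>2" by simp
    have b1: "b * q $ 1 = - a * p $ 1" using arg_cong[OF f1, of "\<lambda>v. v $ 1"] f(3) by simp
    have b3: "b * q $ 3 = f $ 3 - a * p $ 3" using arg_cong[OF f1, of "\<lambda>v. v $ 3"] by simp
    have "b * (cross3 p q $ 2) = p $ 3 * (b * q $ 1) - (b * q $ 3) * p $ 1"
      unfolding cross_components by (simp add: algebra_simps)
    also have "\<dots> = - (f $ 3 * p $ 1)" unfolding b1 b3 by (simp add: algebra_simps)
    finally have "b * (cross3 p q $ 2) = - (f $ 3 * p $ 1)" .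
    moreover have "b * (cross3 p q $ 2) > 0" using a c by simp
    ultimately have "f $ 3 * p $ 1 < 0" by simp
    then show "p $ 1 < 0" using f(4) by (simp add: mult_less_0_iff)
  qed
  have "p = p'"
  proof (rule unit_vector_eqI[where c = 1 and \<sigma> = "-1"])
    have "2 * a * (f $ 3 * p $ 3) = 2 * a * (f $ 3 * p' $ 3)"
      using A[OF n(1,2) z(1,2) f(1) c(1)] A[OF n(3,4) z(3,4) f(2) c(2)] by simp
    then have "p $ 3 = p' $ 3" using a f(4) by simp
    then show "p $ nxt (nxt 1) = p' $ nxt (nxt 1)" by (simp add: nxt_def)
  qed (use n z A[OF n(1,2) z(1,2) f(1) c(1)] A[OF n(3,4) z(3,4) f(2) c(2)] in \<open>auto simp: nxt_def\<close>)
  moreover from this have "b *\<^sub>R q = b *\<^sub>R q'" using f(1,2) by (metis add_left_cancel)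
  ultimately show ?thesis using a by simp
qed

lemma chart_dim_bij:
  fixes i j k0 :: "'n::finite"
  assumes n: "CARD('n) \<ge> 4" and d: "i \<noteq> j" "k0 \<noteq> i" "k0 \<noteq> j"
  obtains \<beta> :: "'n chart_dim \<Rightarrow> 'n \<times> bool" where "bij_betw \<beta> UNIV ((UNIV - {i, j, k0}) \<times> UNIV)"
proof -
  have "card (UNIV - {i, j, k0}) = CARD('n) - 3" using d by (subst card_Diff_subset) auto
  then have "card (UNIV :: 'n chart_dim set) = card ((UNIV - {i, j, k0}) \<times> (UNIV :: bool set))"
    using n by (simp add: CARD_chart_dim_ge_4 card_cartesian_product)
  then have "\<exists>\<beta>. bij_betw \<beta> (UNIV :: 'n chart_dim set) ((UNIV - {i, j, k0}) \<times> (UNIV :: bool set))"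
    by (intro finite_same_card_bij) auto
  then show thesis using that by blast
qed

text \<open>
  Coordinates on a piece of the moduli space: for each edge other than \<open>i, j, k0\<close>, the two components complementary to
  a component \<open>c k\<close> that is bounded away from \<open>0\<close>. The edge \<open>k0\<close> is recovered from the first two components of
  the closing condition.
\<close>

lemma piece_volume_le:
  fixes r :: "real^'n::finite"
  assumes n: "CARD('n) \<ge> 4" and d: "i \<noteq> j" "k0 \<noteq> i" "k0 \<noteq> j" and r: "\<And>k. r $ k > 0"
    and L: "local_section r U w w'"
    and w2: "\<And>x. x \<in> U \<Longrightarrow> w x $ i $ 2 = 0" "\<And>x. x \<in> U \<Longrightarrow> w x $ j $ 2 = 0"
    and f1: "\<And>x. x \<in> U \<Longrightarrow> (r $ i *\<^sub>R w x $ i + r $ j *\<^sub>R w x $ j) $ 1 = 0"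
    and f3: "\<And>x. x \<in> U \<Longrightarrow> (r $ i *\<^sub>R w x $ i + r $ j *\<^sub>R w x $ j) $ 3 > 0"
    and cr: "\<And>x. x \<in> U \<Longrightarrow> (cross3 (w x $ i) (w x $ j)) $ 2 > 0"
    and ck0: "c k0 = 3" and e: "e > 0" and big: "\<And>x k. x \<in> U \<Longrightarrow> k \<noteq> i \<Longrightarrow> k \<noteq> j \<Longrightarrow> \<sigma> k * w x $ k $ c k > e" and \<sigma>: "\<And>k. \<bar>\<sigma> k\<bar> = 1"
    and R: "R = (\<Sum>k\<in>UNIV. r $ k)" and C: "C = (2 + 2 / e) * (1 + R / r $ k0 * (2 + 2 / e))"
  shows "liouville_volume r U w w' \<le>
     ennreal (sqrt (real (card {p. p permutes (UNIV :: 'n chart_dim set)}) * (R * C\<^sup>2) ^ CARD('n chart_dim)) *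
       measure lebesgue (cbox (-1) 1 :: (real^('n chart_dim)) set))"
proof -
  obtain \<beta> :: "'n chart_dim \<Rightarrow> 'n \<times> bool" where \<beta>: "bij_betw \<beta> UNIV ((UNIV - {i, j, k0}) \<times> UNIV)"
    using chart_dim_bij[OF n d] .
  define ax where "ax m = (if snd (\<beta> m) then nxt (c (fst (\<beta> m))) else nxt (nxt (c (fst (\<beta> m)))))" for m
  define \<Lambda> where "\<Lambda> v = (\<chi> m. v $ fst (\<beta> m) $ ax m)" for v :: "(real^3)^'n"
  note S = local_section_tangent[OF L]
  have U: "open U" using L by (simp add: local_section_def)
  have lin\<Lambda>: "linear \<Lambda>" unfolding \<Lambda>_def by (rule linearI) (auto simp: vec_eq_iff)
  have m: "\<exists>m. \<beta> m = (k, b)" if "k \<noteq> i" "k \<noteq> j" "k \<noteq> k0" for k b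
  proof -
    have "(k, b) \<in> (UNIV - {i, j, k0}) \<times> UNIV" using that by simp
    then show ?thesis using bij_betw_imp_surj_on[OF \<beta>] by (metis imageE)
  qed
  have \<Lambda>: "v $ k $ nxt (c k) = \<Lambda> v $ (SOME m. \<beta> m = (k, True))" "v $ k $ nxt (nxt (c k)) = \<Lambda> v $ (SOME m. \<beta> m = (k, False))"
    if "k \<noteq> i" "k \<noteq> j" "k \<noteq> k0" for k v
    using someI_ex[OF m[OF that, of True]] someI_ex[OF m[OF that, of False]] by (simp_all add: \<Lambda>_def ax_def)
  define T where "T x = \<Lambda> (w x)" for x
  define J where "J x h = \<Lambda> (w' x h)" for x h
  have der: "(T has_derivative J x) (at x)" if "x \<in> U" for x
    unfolding T_def J_def using bounded_linear.has_derivative[OF linear_linear[THEN iffD2, OF lin\<Lambda>] S(2)[OF that]] .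
  have split: "(\<Sum>k\<in>UNIV. g k) = (g i + g j) + (g k0 + (\<Sum>k\<in>UNIV - {i, j, k0}. g k))" for g :: "'n \<Rightarrow> 'c::comm_monoid_add"
    using d by (subst sum.subset_diff[of "{i, j, k0}"]) (auto simp: add_ac)
  have f2: "(r $ i *\<^sub>R w x $ i + r $ j *\<^sub>R w x $ j) $ 2 = 0" if "x \<in> U" for x using w2[OF that] by simp
  have inj: "inj_on T U"
  proof (rule inj_onI)
    fix x y assume xy: "x \<in> U" "y \<in> U" "T x = T y"
    have sgn: "\<sigma> k * w z $ k $ c k > 0" if "z \<in> U" "k \<noteq> i" "k \<noteq> j" for z k using big[OF that] e by linarith
    have k: "w x $ k = w y $ k" if "k \<noteq> i" "k \<noteq> j" "k \<noteq> k0" for k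
      by (rule unit_vector_eqI[where c = "c k" and \<sigma> = "\<sigma> k"])
         (use S(3)[OF xy(1)] S(3)[OF xy(2)] \<Lambda>[OF that] xy sgn that in \<open>auto simp: T_def\<close>)
    define A where "A = (\<Sum>k\<in>UNIV - {i, j, k0}. r $ k *\<^sub>R w x $ k)"
    have Ay: "A = (\<Sum>k\<in>UNIV - {i, j, k0}. r $ k *\<^sub>R w y $ k)" unfolding A_def by (rule sum.cong) (auto simp: k)
    have sx: "(r $ i *\<^sub>R w x $ i + r $ j *\<^sub>R w x $ j) + (r $ k0 *\<^sub>R w x $ k0 + A) = 0"
      using S(5)[OF xy(1)] unfolding split A_def .
    have sy: "(r $ i *\<^sub>R w y $ i + r $ j *\<^sub>R w y $ j) + (r $ k0 *\<^sub>R w y $ k0 + A) = 0"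
      using S(5)[OF xy(2)] unfolding split Ay .
    \<comment> \<open>The diagonal has neither a first nor a second component, so the closing
      condition determines these components of edge \<open>k0\<close>. Its third one is left, whence
      \<open>c k0 = 3\<close>.\<close>
    have kp: "w x $ k0 $ p = w y $ k0 $ p" if "p = 1 \<or> p = 2" for p
    proof -
      have "r $ k0 * w x $ k0 $ p + A $ p = 0" "r $ k0 * w y $ k0 $ p + A $ p = 0"
        using arg_cong[OF sx, of "\<lambda>v. v $ p"] arg_cong[OF sy, of "\<lambda>v. v $ p"] f1[OF xy(1)] f1[OF xy(2)] f2[OF xy(1)] f2[OF xy(2)] that
        by auto
      then have "r $ k0 * w x $ k0 $ p = r $ k0 * w y $ k0 $ p" by linarith
      then show ?thesis using r[of k0] by simp
    qed
    have k0: "w x $ k0 = w y $ k0"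
      by (rule unit_vector_eqI[where c = 3 and \<sigma> = "\<sigma> k0"])
         (use S(3)[OF xy(1)] S(3)[OF xy(2)] kp sgn[OF xy(1) d(2,3)] sgn[OF xy(2) d(2,3)] ck0 in \<open>auto simp: nxt_def\<close>)
    have "w x $ i = w y $ i \<and> w x $ j = w y $ j"
    proof (rule canonical_triangle_unique[OF r r S(3)[OF xy(1)] S(3)[OF xy(1)] S(3)[OF xy(2)] S(3)[OF xy(2)]
        w2(1)[OF xy(1)] w2(2)[OF xy(1)] w2(1)[OF xy(2)] w2(2)[OF xy(2)] _ refl f1[OF xy(2)] f3[OF xy(2)] cr[OF xy(1)] cr[OF xy(2)]])
      show "r $ i *\<^sub>R w x $ i + r $ j *\<^sub>R w x $ j = r $ i *\<^sub>R w y $ i + r $ j *\<^sub>R w y $ j"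
        using sx sy k0 by (metis add_right_cancel)
    qed
    then have "w x $ k = w y $ k" for k using k k0 by metis
    then have eq: "w x = w y" by (simp add: vec_eq_iff)
    have "(w x, w y) \<in> so3_rel"
      unfolding so3_rel_def eq by (auto intro!: exI[of _ "mat 1"] simp: rotation_matrix_def orthogonal_matrix_id)
    then show "x = y" using L xy unfolding local_section_def by blast
  qed
  have im: "T ` U \<subseteq> cbox (-1) 1"
  proof
    fix t assume "t \<in> T ` U"
    then obtain x where x: "x \<in> U" "t = T x" by blast
    have "\<bar>w x $ k $ p\<bar> \<le> 1" for k p using component_le_norm_cart[of "w x $ k" p] S(3)[OF x(1), of k] by simp
    then show "t \<in> cbox (-1) 1" unfolding x(2) T_def \<Lambda>_def by (auto simp: mem_box_cart abs_le_iff minus_le_iff)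
  qed
  have R0: "R \<ge> 0" unfolding R by (rule sum_nonneg) (rule less_imp_le[OF r])
  have e2: "2 + 2 / e \<ge> 1" using e by simp
  have rR: "R / r $ k0 * (2 + 2 / e) \<ge> 0" using R0 r[of k0] e by simp
  have C0: "C \<ge> 0" unfolding C using e2 rR by simp
  \<comment> \<open>For an edge other than \<open>k0\<close>, the coordinates control the velocity
    with the factor \<open>2 + 2 / e\<close>. For \<open>k0\<close>, the differentiated closing
    condition bounds two components by the velocities of these edges, and completing the third costs
    the same factor again; \<open>C\<close> is the sum of both constants.\<close>
  have est: "norm (w' x h $ k) \<le> C * norm (J x h)" if x: "x \<in> U" and k: "k \<noteq> i" "k \<noteq> j" for x h k
  proof -
    define t where "t = norm (J x h)"
    have t0: "t \<ge> 0" by (simp add: t_def)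
    have be: "\<bar>w x $ k $ c k\<bar> \<ge> e" if "k \<noteq> i" "k \<noteq> j" for k
      using big[OF x that] \<sigma>[of k] by (metis abs_ge_self abs_mult less_imp_le mult_1 order_trans)
    have 1: "norm (w' x h $ k) \<le> (2 + 2 / e) * t" if "k \<noteq> i" "k \<noteq> j" "k \<noteq> k0" for k
    proof (rule tangent_norm_le[OF S(3)[OF x] S(4)[OF x] _ _ be[OF that(1,2)] e])
      show "\<bar>w' x h $ k $ nxt (c k)\<bar> \<le> t" "\<bar>w' x h $ k $ nxt (nxt (c k))\<bar> \<le> t"
        unfolding \<Lambda>[OF that] t_def J_def by (rule component_le_norm_cart)+
    qed
    show ?thesis
    proof (cases "k = k0")
      case False
      have "(2 + 2 / e) * t \<le> C * t" unfolding C using t0 e2 rR by (intro mult_right_mono) (auto simp: mult_le_cancel_left1)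
      then show ?thesis using 1[OF k False] by (simp add: t_def)
    next
      case True
      define B where "B = (\<Sum>k\<in>UNIV - {i, j, k0}. r $ k *\<^sub>R w' x h $ k)"
      have nB: "norm B \<le> R * ((2 + 2 / e) * t)"
      proof -
        have "norm B \<le> (\<Sum>k\<in>UNIV - {i, j, k0}. norm (r $ k *\<^sub>R w' x h $ k))" unfolding B_def by (rule norm_sum)
        also have "\<dots> \<le> (\<Sum>k\<in>UNIV - {i, j, k0}. r $ k * ((2 + 2 / e) * t))"
        proof (rule sum_mono)
          fix k assume "k \<in> UNIV - {i, j, k0}"
          then show "norm (r $ k *\<^sub>R w' x h $ k) \<le> r $ k * ((2 + 2 / e) * t)"
            using 1[of k] r[of k] by (simp add: mult_left_mono)
        qed
        also have "\<dots> \<le> (\<Sum>k\<in>UNIV. r $ k * ((2 + 2 / e) * t))"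
          by (intro sum_mono2 mult_nonneg_nonneg less_imp_le[OF r] t0) (use e2 in auto)
        finally show ?thesis by (simp add: R sum_distrib_right)
      qed
      have dp: "(r $ i *\<^sub>R w' x h $ i + r $ j *\<^sub>R w' x h $ j) $ p = 0" if p: "p = 1 \<or> p = 2" for p
      proof -
        have "((\<lambda>x. (r $ i *\<^sub>R w x $ i + r $ j *\<^sub>R w x $ j) $ p) has_derivative (\<lambda>h. (r $ i *\<^sub>R w' x h $ i + r $ j *\<^sub>R w' x h $ j) $ p)) (at x)"
          by (rule bounded_linear.has_derivative[OF bounded_linear_vec_nth], intro has_derivative_add has_derivative_scaleR_right;
              rule bounded_linear.has_derivative[OF bounded_linear_vec_nth S(2)[OF x]])
        from has_derivative_const_on_open[OF U x this, of 0] show ?thesis using f1 f2 p by meson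
      qed
      have kp: "\<bar>w' x h $ k0 $ p\<bar> \<le> R / r $ k0 * ((2 + 2 / e) * t)" if p: "p = 1 \<or> p = 2" for p
      proof -
        have "(r $ i *\<^sub>R w' x h $ i + r $ j *\<^sub>R w' x h $ j) + (r $ k0 *\<^sub>R w' x h $ k0 + B) = 0"
          using S(6)[OF x, of h] unfolding split B_def .
        from arg_cong[OF this, of "\<lambda>v. v $ p"] dp[OF p] have "r $ k0 * w' x h $ k0 $ p = - B $ p" by simp
        then have "r $ k0 * \<bar>w' x h $ k0 $ p\<bar> = \<bar>B $ p\<bar>" using r[of k0] by (metis abs_minus_cancel abs_mult abs_of_pos)
        also have "\<dots> \<le> R * ((2 + 2 / e) * t)" using component_le_norm_cart[of B p] nB by linarith
        finally show ?thesis using r[of k0] by (simp add: field_simps)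
      qed
      have "norm (w' x h $ k0) \<le> (2 + 2 / e) * (R / r $ k0 * ((2 + 2 / e) * t))"
        by (rule tangent_norm_le[where c = 3, OF S(3)[OF x] S(4)[OF x] _ _ be[OF d(2,3), unfolded ck0] e])
           (use kp in \<open>auto simp: nxt_def\<close>)
      also have "\<dots> = (2 + 2 / e) * (R / r $ k0 * (2 + 2 / e)) * t" by simp
      also have "\<dots> \<le> C * t" unfolding C using t0 e2 by (intro mult_right_mono mult_left_mono) auto
      finally show ?thesis using True by (simp add: t_def)
    qed
  qed
  have form: "\<bar>symp_form r (w x) (w' x h) (w' x h')\<bar> \<le> (R * C\<^sup>2) * norm (J x h) * norm (J x h')" if x: "x \<in> U" for x h h'
  proof -
    have z: "w' x h $ k $ 2 = 0" if "k = i \<or> k = j" for h k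
    proof -
      have "((\<lambda>x. w x $ k $ 2) has_derivative (\<lambda>h. w' x h $ k $ 2)) (at x)"
        by (rule bounded_linear.has_derivative[OF bounded_linear_vec_nth bounded_linear.has_derivative[OF bounded_linear_vec_nth S(2)[OF x]]])
      from has_derivative_const_on_open[OF U x this, of 0] show ?thesis using w2 that by meson
    qed
    \<comment> \<open>The edges \<open>i\<close>, \<open>j\<close> stay in one coordinate plane, so
      they sweep out no area and do not contribute to the form.\<close>
    have z2: "w x $ k \<bullet> cross3 (w' x h $ k) (w' x h' $ k) = 0" if "k = i \<or> k = j" for k
    proof -
      have "w x $ k $ 2 = 0" using w2[OF x] that by auto
      then show ?thesis using z[OF that, of h] z[OF that, of h'] by (simp add: inner_vec_def sum_3 cross_components)
    qed
    have "\<bar>symp_form r (w x) (w' x h) (w' x h')\<bar> \<le> (\<Sum>k\<in>UNIV. \<bar>r $ k * (w x $ k \<bullet> cross3 (w' x h $ k) (w' x h' $ k))\<bar>)"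
      unfolding symp_form_def by (rule sum_abs)
    also have "\<dots> \<le> (\<Sum>k\<in>UNIV. r $ k * ((C * norm (J x h)) * (C * norm (J x h'))))"
    proof (rule sum_mono)
      fix k
      have "\<bar>w x $ k \<bullet> cross3 (w' x h $ k) (w' x h' $ k)\<bar> \<le> (C * norm (J x h)) * (C * norm (J x h'))"
      proof (cases "k = i \<or> k = j")
        case True then show ?thesis using z2[OF True] C0 by simp
      next
        case False
        have "\<bar>w x $ k \<bullet> cross3 (w' x h $ k) (w' x h' $ k)\<bar> \<le> norm (w' x h $ k) * norm (w' x h' $ k)"
          by (rule abs_triple_le[OF S(3)[OF x]])
        also have "\<dots> \<le> (C * norm (J x h)) * (C * norm (J x h'))"
          using False C0 by (intro mult_mono est x) auto
        finally show ?thesis .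
      qed
      then show "\<bar>r $ k * (w x $ k \<bullet> cross3 (w' x h $ k) (w' x h' $ k))\<bar> \<le> r $ k * ((C * norm (J x h)) * (C * norm (J x h')))"
        using r[of k] by (simp add: abs_mult mult_left_mono)
    qed
    also have "\<dots> = (R * C\<^sup>2) * norm (J x h) * norm (J x h')"
      unfolding R sum_distrib_right[symmetric] by (simp add: power2_eq_square mult_ac)
    finally show ?thesis .
  qed
  define K where "K = sqrt (real (card {p. p permutes (UNIV :: 'n chart_dim set)}) * (R * C\<^sup>2) ^ CARD('n chart_dim))"
  have K0: "K \<ge> 0" using R0 by (simp add: K_def)
  have "liouville_volume r U w w' \<le> (\<integral>\<^sup>+x\<in>U. ennreal (K * \<bar>det (matrix (J x))\<bar>) \<partial>lborel)"
    unfolding liouville_volume_def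
  proof (rule nn_integral_mono)
    fix x
    show "ennreal (sqrt \<bar>det (\<chi> a b. symp_form r (w x) (w' x (axis a 1)) (w' x (axis b 1)))\<bar>) * indicator U x
      \<le> ennreal (K * \<bar>det (matrix (J x))\<bar>) * indicator U x"
    proof (cases "x \<in> U")
      case True
      have linJ: "linear (J x)" unfolding J_def using linear_compose[OF S(1)[OF True] lin\<Lambda>] by (simp add: o_def)
      have RC: "R * C\<^sup>2 \<ge> 0" using R0 by simp
      have "sqrt \<bar>det (\<chi> a b. symp_form r (w x) (w' x (axis a 1)) (w' x (axis b 1)))\<bar> \<le> K * \<bar>det (matrix (J x))\<bar>"
        unfolding K_def by (rule sqrt_det_form_le[OF bilinear_symp_form_linear[OF S(1)[OF True]] linJ form[OF True] RC])
      then show ?thesis using True by (simp add: ennreal_leI)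
    qed simp
  qed
  also have "\<dots> \<le> ennreal (K * measure lebesgue (cbox (-1) 1 :: (real^('n chart_dim)) set))"
    by (rule nn_integral_abs_det_le[OF U der inj im K0])
  finally show ?thesis unfolding K_def .
qed

text \<open>In the body frame, the other edges sum to a vector on the third axis of length at least \<open>\<bar>r\<^sub>i - r\<^sub>j\<bar>\<close>, so one of them
  qualifies as \<open>k0\<close>.\<close>

lemma liouville_volume_bounded:
  fixes r :: "real^'n::finite"
  assumes n: "CARD('n) \<ge> 4" and ij: "i \<noteq> j" and ne: "r $ i \<noteq> r $ j" and r: "\<And>k. r $ k > 0"
  obtains C :: real where "\<forall>U \<phi> \<phi>'. local_section r U \<phi> \<phi>' \<longrightarrow> liouville_volume r U \<phi> \<phi>' \<le> ennreal C"
proof -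
  define R where "R = (\<Sum>k\<in>UNIV. r $ k)"
  have R: "R > 0" unfolding R_def using r by (intro sum_pos) auto
  \<comment> \<open>Every unit vector has a component larger than \<open>1 / 2\<close>. The second
    bound lets the closing condition force a third component above \<open>e\<close> on some further
    edge; it is positive because \<open>r $ i \<noteq> r $ j\<close>.\<close>
  define e where "e = min (1 / 2) (\<bar>r $ i - r $ j\<bar> / (2 * R))"
  have e: "e > 0" using R ne by (simp add: e_def)
  define B where "B k0 = sqrt (real (card {p. p permutes (UNIV :: 'n chart_dim set)}) *
      (R * ((2 + 2 / e) * (1 + R / r $ k0 * (2 + 2 / e)))\<^sup>2) ^ CARD('n chart_dim)) * measure lebesgue (cbox (-1) 1 :: (real^('n chart_dim)) set)" for k0
  have B0: "B k0 \<ge> 0" for k0 unfolding B_def using R by (intro mult_nonneg_nonneg) auto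
  define sg :: "bool \<Rightarrow> real" where "sg b = (if b then 1 else -1)" for b
  define C where "C = (\<Sum>q\<in>(UNIV :: ('n \<times> ('n \<Rightarrow> 3) \<times> ('n \<Rightarrow> bool)) set). B (fst q))"
  show thesis
  proof (rule that, intro allI impI)
    fix U \<phi> \<phi>' assume L0: "local_section r U \<phi> \<phi>'"
    define V where "V = nonparallel i j \<phi> U"
    have LV: "local_section r V \<phi> \<phi>'"
      unfolding V_def by (rule local_section_subset[OF L0 open_nonparallel[OF L0]]) (auto simp: nonparallel_def)
    have np: "\<And>x. x \<in> V \<Longrightarrow> cross3 (\<phi> x $ i) (\<phi> x $ j) \<noteq> 0" by (simp add: V_def nonparallel_def)
    obtain w w' where W: "local_section r V w w'" "liouville_volume r V w w' = liouville_volume r V \<phi> \<phi>'"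
      "\<And>x. x \<in> V \<Longrightarrow> w x $ i $ 2 = 0" "\<And>x. x \<in> V \<Longrightarrow> w x $ j $ 2 = 0"
      "\<And>x. x \<in> V \<Longrightarrow> (r $ i *\<^sub>R w x $ i + r $ j *\<^sub>R w x $ j) $ 1 = 0"
      "\<And>x. x \<in> V \<Longrightarrow> (r $ i *\<^sub>R w x $ i + r $ j *\<^sub>R w x $ j) $ 3 > 0"
      "\<And>x. x \<in> V \<Longrightarrow> (cross3 (w x $ i) (w x $ j)) $ 2 > 0"
      using body_frame_section[OF LV np r r] by blast
    note S = local_section_tangent[OF W(1)]
    have V: "open V" and cw: "continuous_on V w" using W(1) C1_on_imp_continuous_on unfolding local_section_iff_C1_on by blast+
    define P where "P q = {x \<in> V. fst q \<noteq> i \<and> fst q \<noteq> j \<and> fst (snd q) (fst q) = 3 \<and>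
       (\<forall>k. k \<noteq> i \<longrightarrow> k \<noteq> j \<longrightarrow> sg (snd (snd q) k) * w x $ k $ fst (snd q) k > e)}" for q :: "'n \<times> ('n \<Rightarrow> 3) \<times> ('n \<Rightarrow> bool)"
    have oP: "open (P q)" for q
    proof (cases "fst q \<noteq> i \<and> fst q \<noteq> j \<and> fst (snd q) (fst q) = 3")
      case True
      have "open (V \<inter> (\<lambda>x. sg (snd (snd q) k) * w x $ k $ fst (snd q) k) -` {e<..})" for k
        by (intro continuous_open_preimage continuous_intros cw V open_greaterThan)
      then have "open (V \<inter> (\<Inter>k\<in>UNIV - {i, j}. V \<inter> (\<lambda>x. sg (snd (snd q) k) * w x $ k $ fst (snd q) k) -` {e<..}))"
        using V by (intro open_Int open_INT) auto
      moreover have "P q = V \<inter> (\<Inter>k\<in>UNIV - {i, j}. V \<inter> (\<lambda>x. sg (snd (snd q) k) * w x $ k $ fst (snd q) k) -` {e<..})"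
        using True by (auto simp: P_def)
      ultimately show ?thesis by simp
    next
      case False
      then have "P q = {}" by (auto simp: P_def)
      then show ?thesis by simp
    qed
    have LP: "local_section r (P q) w w'" for q
      by (rule local_section_subset[OF W(1) oP]) (auto simp: P_def)
    have vP: "liouville_volume r (P q) w w' \<le> ennreal (B (fst q))" for q
    proof (cases "fst q \<noteq> i \<and> fst q \<noteq> j \<and> fst (snd q) (fst q) = 3")
      case True
      have PV: "x \<in> V" if "x \<in> P q" for x using that by (simp add: P_def)
      show ?thesis unfolding B_def
        by (rule piece_volume_le[OF n ij _ _ r LP W(3)[OF PV] W(4)[OF PV] W(5)[OF PV] W(6)[OF PV] W(7)[OF PV], where c = "fst (snd q)" and \<sigma> = "\<lambda>k. sg (snd (snd q) k)"])
           (use True e in \<open>auto simp: P_def sg_def R_def\<close>)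
    next
      case False
      then have "P q = {}" by (auto simp: P_def)
      then show ?thesis by (simp add: liouville_volume_def)
    qed
    have cover: "\<exists>q. x \<in> P q" if x: "x \<in> V" for x
    proof -
      define f where "f = r $ i *\<^sub>R w x $ i + r $ j *\<^sub>R w x $ j"
      have f: "f $ 1 = 0" "f $ 2 = 0" "f $ 3 > 0" using W(3-6)[OF x] by (auto simp: f_def)
      have "norm f \<le> f $ 3" using norm_le_l1_cart[of f] f by (simp add: sum_3)
      moreover have "\<bar>r $ i - r $ j\<bar> \<le> norm f"
        using norm_triangle_ineq3[of "r $ i *\<^sub>R w x $ i" "- r $ j *\<^sub>R w x $ j"] S(3)[OF x] r[of i] r[of j] by (simp add: f_def)
      ultimately have fd: "\<bar>r $ i - r $ j\<bar> \<le> f $ 3" by simp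
      \<comment> \<open>Otherwise the other edges would add up to a third component of at most
        \<open>R * e\<close>, which is at most half of \<open>\<bar>r $ i - r $ j\<bar>\<close>,
        whereas they have to balance a diagonal of at least this full length.\<close>
      have "\<exists>k. k \<noteq> i \<and> k \<noteq> j \<and> \<bar>w x $ k $ 3\<bar> > e"
      proof (rule ccontr)
        assume "\<not> ?thesis"
        then have le: "\<bar>w x $ k $ 3\<bar> \<le> e" if "k \<noteq> i" "k \<noteq> j" for k using that by force
        have "(\<Sum>k\<in>UNIV. r $ k *\<^sub>R w x $ k) = f + (\<Sum>k\<in>UNIV - {i, j}. r $ k *\<^sub>R w x $ k)"
          unfolding f_def using ij by (subst sum.subset_diff[of "{i, j}"]) (auto simp: add_ac)
        then have "f = - (\<Sum>k\<in>UNIV - {i, j}. r $ k *\<^sub>R w x $ k)" using S(5)[OF x] by (simp add: add_eq_0_iff2)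
        then have "f $ 3 = (\<Sum>k\<in>UNIV - {i, j}. r $ k * (- w x $ k $ 3))" by (simp add: sum_negf)
        also have "\<dots> \<le> (\<Sum>k\<in>UNIV - {i, j}. r $ k * e)"
        proof (rule sum_mono)
          fix k assume "k \<in> UNIV - {i, j}"
          then have "- w x $ k $ 3 \<le> e" using le[of k] by (simp add: abs_le_iff)
          then show "r $ k * (- w x $ k $ 3) \<le> r $ k * e" by (rule mult_left_mono) (rule less_imp_le[OF r])
        qed
        also have "\<dots> \<le> (\<Sum>k\<in>UNIV. r $ k * e)"
          by (intro sum_mono2 mult_nonneg_nonneg less_imp_le[OF r] less_imp_le[OF e]) auto
        also have "\<dots> = R * e" by (simp add: R_def sum_distrib_right)
        also have "\<dots> \<le> R * (\<bar>r $ i - r $ j\<bar> / (2 * R))" using R by (intro mult_left_mono) (auto simp: e_def)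
        also have "\<dots> = \<bar>r $ i - r $ j\<bar> / 2" using R by simp
        finally show False using fd ne by simp
      qed
      then obtain k0 where k0: "k0 \<noteq> i" "k0 \<noteq> j" "\<bar>w x $ k0 $ 3\<bar> > e" by blast
      have "\<exists>c. \<bar>w x $ k $ c\<bar> > e" for k
      proof -
        obtain c where "\<bar>w x $ k $ c\<bar> > 1 / 2" using unit_large_component[OF S(3)[OF x, of k]] by blast
        moreover have "e \<le> 1 / 2" by (simp add: e_def)
        ultimately show ?thesis by (intro exI[of _ c]) linarith
      qed
      then obtain c0 where c0: "\<And>k. \<bar>w x $ k $ c0 k\<bar> > e" by metis
      define c where "c = c0(k0 := 3)"
      have c: "\<bar>w x $ k $ c k\<bar> > e" for k using c0 k0 by (simp add: c_def)
      define s where "s k = (w x $ k $ c k > 0)" for k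
      have "sg (s k) * w x $ k $ c k > e" for k using c[of k] e by (auto simp: sg_def s_def abs_if split: if_splits)
      then have "x \<in> P (k0, c, s)" using x k0 by (simp add: P_def c_def)
      then show ?thesis ..
    qed
    define g where "g x = ennreal (sqrt \<bar>det (\<chi> a b. symp_form r (w x) (w' x (axis a 1)) (w' x (axis b 1)))\<bar>)" for x
    have "liouville_volume r U \<phi> \<phi>' = liouville_volume r V \<phi> \<phi>'"
      unfolding V_def by (rule liouville_volume_nonparallel[OF n ij _ L0]) (metis r less_irrefl)
    also have "\<dots> = liouville_volume r V w w'" by (rule W(2)[symmetric])
    also have "\<dots> = (\<integral>\<^sup>+x. g x * indicator V x \<partial>lborel)" unfolding liouville_volume_def g_def ..
    also have "\<dots> \<le> (\<integral>\<^sup>+x. (\<Sum>q\<in>UNIV. g x * indicator (P q) x) \<partial>lborel)"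
    proof (rule nn_integral_mono)
      fix x
      show "g x * indicator V x \<le> (\<Sum>q\<in>UNIV. g x * indicator (P q) x)"
      proof (cases "x \<in> V")
        case True
        then obtain q where q: "x \<in> P q" using cover by blast
        have "g x * indicator V x = g x * indicator (P q) x" using True q by simp
        also have "\<dots> \<le> (\<Sum>q\<in>UNIV. g x * indicator (P q) x)" by (rule member_le_sum) auto
        finally show ?thesis .
      qed simp
    qed
    also have "\<dots> = (\<Sum>q\<in>UNIV. (\<integral>\<^sup>+x. g x * indicator (P q) x \<partial>lborel))"
      by (rule nn_integral_sum) (use local_section_density[OF LP] in \<open>simp add: g_def\<close>)
    also have "\<dots> \<le> (\<Sum>q\<in>(UNIV :: ('n \<times> ('n \<Rightarrow> 3) \<times> ('n \<Rightarrow> bool)) set). ennreal (B (fst q)))"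
      unfolding g_def by (rule sum_mono) (rule vP[unfolded liouville_volume_def])
    also have "\<dots> = ennreal C" unfolding C_def by (rule sum_ennreal) (rule B0)
    finally show "liouville_volume r U \<phi> \<phi>' \<le> ennreal C" .
  qed
qed

section \<open>Polygons with a short diagonal\<close>

text \<open>With the first two components as coordinates, the area form of the unit sphere is
  \<open>dx \<and> dy / z\<close>.\<close>

lemma triple_tangent_z:
  fixes u v w :: "real^3"
  assumes "norm u = 1" "v \<bullet> u = 0" "w \<bullet> u = 0"
  shows "(u \<bullet> cross3 v w) * u $ 3 = v $ 1 * w $ 2 - w $ 1 * v $ 2"
proof -
  have "(cross3 v w) $ 3 = (u \<bullet> cross3 v w) * u $ 3"
    using arg_cong[OF cross3_tangent[OF assms], of "\<lambda>x. x $ 3"] by simp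
  then show ?thesis by (simp add: cross_components)
qed

text \<open>If the integral were zero, the density would vanish almost everywhere on the domain, but
  a nonempty open set is not null.\<close>

lemma liouville_volume_pos:
  fixes r :: "real^'n::finite"
  assumes L: "local_section r U \<phi> \<phi>'" and ne: "U \<noteq> {}"
    and det: "\<And>x. x \<in> U \<Longrightarrow> det (\<chi> a b. symp_form r (\<phi> x) (\<phi>' x (axis a 1)) (\<phi>' x (axis b 1))) \<noteq> 0"
  shows "liouville_volume r U \<phi> \<phi>' > 0"
proof (rule ccontr)
  define f where "f x = ennreal (sqrt \<bar>det (\<chi> a b. symp_form r (\<phi> x) (\<phi>' x (axis a 1)) (\<phi>' x (axis b 1)))\<bar>) * indicator U x" for x
  assume "\<not> ?thesis"
  then have "(\<integral>\<^sup>+x. f x \<partial>lborel) = 0" unfolding f_def liouville_volume_def by simp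
  moreover have "f \<in> borel_measurable lborel" using local_section_density[OF L] by (simp add: f_def[abs_def])
  ultimately have "AE x in lborel. f x = 0" by (simp add: nn_integral_0_iff_AE)
  moreover have "f x \<noteq> 0" if "x \<in> U" for x using det[OF that] that by (simp add: f_def)
  ultimately have ae: "AE x in lborel. x \<notin> U" by (auto elim: eventually_mono)
  have U: "open U" using L by (simp add: local_section_def)
  have "AE x in lebesgue. x \<notin> U" using ae by (rule AE_completion)
  then have "U \<in> null_sets lebesgue" using U by (subst (asm) AE_iff_null_sets[symmetric]) (auto simp: borel_open)
  then have "negligible U" by (simp add: negligible_iff_null_sets)
  then show False using open_not_negligible[OF U ne] by simp
qed

text \<open>
  The edges other than \<open>i, j\<close> are given by their first two components \<open>X, Y\<close>, which sum to zero, and by signs \<open>\<sigma>\<close>;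
  then \<open>D\<close> is the length of the diagonal. It is small at \<open>t0\<close>, where the edges \<open>k0, k1\<close> are almost opposite
  and the others, of which there is an even number, cancel in pairs.
\<close>

lemma small_diagonal_section:
  fixes i j :: "'n::finite" and a \<delta> :: real
  assumes n: "CARD('n) \<ge> 4" "even CARD('n)" and ij: "i \<noteq> j" and \<delta>: "\<delta> > 0" and a: "a > 0"
  obtains W \<psi> \<psi>' where "local_section (\<chi> k::'n. a) W \<psi> \<psi>'" "liouville_volume (\<chi> k::'n. a) W \<psi> \<psi>' > 0"
    "bounded W" "\<forall>t\<in>W. norm (\<psi> t $ i + \<psi> t $ j) < \<delta>"
proof -
  have c2: "card (UNIV - {i, j}) = CARD('n) - 2" using ij by (subst card_Diff_subset) auto
  then have "UNIV - {i, j} \<noteq> {}" using n by (intro notI) simp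
  then obtain k0 where k0: "k0 \<noteq> i" "k0 \<noteq> j" by blast
  have c3: "card (UNIV - {i, j, k0}) = CARD('n) - 3" using ij k0 by (subst card_Diff_subset) auto
  then have "UNIV - {i, j, k0} \<noteq> {}" using n by (intro notI) simp
  then obtain k1 where k1: "k1 \<noteq> i" "k1 \<noteq> j" "k1 \<noteq> k0" by blast
  have c4: "card (UNIV - {i, j, k0, k1}) = CARD('n) - 4" using ij k0 k1 by (subst card_Diff_subset) auto
  \<comment> \<open>Half of the remaining \<open>n - 4\<close> edges, which is possible since
    \<open>n\<close> is even. Edges in \<open>H\<close> point up and the rest of these down, so
    their third components cancel at \<open>t0\<close>.\<close>
  obtain H where H: "H \<subseteq> UNIV - {i, j, k0, k1}" "card H = (CARD('n) - 4) div 2"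
    using obtain_subset_with_card_n[of "(CARD('n) - 4) div 2" "UNIV - {i, j, k0, k1}"] c4 by auto
  define \<sigma> :: "'n \<Rightarrow> real" where "\<sigma> k = (if k \<in> H \<or> k = k0 \<or> k = k1 then 1 else -1)" for k
  have \<sigma>2: "\<sigma> k * \<sigma> k = 1" "\<sigma> k \<noteq> 0" for k by (simp_all add: \<sigma>_def)
  have \<sigma>01: "\<sigma> k0 = 1" "\<sigma> k1 = 1" by (simp_all add: \<sigma>_def)
  have \<sigma>sum: "(\<Sum>k\<in>UNIV - {i, j, k0, k1}. \<sigma> k) = 0"
  proof -
    have "(\<Sum>k\<in>UNIV - {i, j, k0, k1}. \<sigma> k) = (\<Sum>k\<in>H. \<sigma> k) + (\<Sum>k\<in>(UNIV - {i, j, k0, k1}) - H. \<sigma> k)"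
      using H(1) by (subst sum.subset_diff[of H]) auto
    also have "(\<Sum>k\<in>H. \<sigma> k) = real (card H)" by (simp add: \<sigma>_def)
    also have "(\<Sum>k\<in>(UNIV - {i, j, k0, k1}) - H. \<sigma> k) = (\<Sum>k\<in>(UNIV - {i, j, k0, k1}) - H. -1)"
      by (rule sum.cong) (auto simp: \<sigma>_def)
    also have "\<dots> = - real (card ((UNIV - {i, j, k0, k1}) - H))" by simp
    also have "card ((UNIV - {i, j, k0, k1}) - H) = CARD('n) - 4 - card H"
      using H(1) c4 by (subst card_Diff_subset) (auto intro: finite_subset)
    also have "CARD('n) - 4 - card H = card H"
    proof -
      obtain b where b: "CARD('n) = 2 * b" using n(2) by (rule evenE)
      then have "2 \<le> b" using n(1) by linarith
      then obtain c where "b = 2 + c" by (rule le_Suc_ex[THEN exE])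
      then show ?thesis using H(2) b by simp
    qed
    finally show ?thesis by simp
  qed
  obtain \<beta> :: "'n chart_dim \<Rightarrow> 'n \<times> bool" where \<beta>: "bij_betw \<beta> UNIV ((UNIV - {i, j, k0}) \<times> UNIV)"
    using chart_dim_bij[OF n(1) ij k0] .
  define m where "m k b = inv_into UNIV \<beta> (k, b)" for k b
  have \<beta>m: "\<beta> (m k b) = (k, b)" if "k \<noteq> i" "k \<noteq> j" "k \<noteq> k0" for k b
    unfolding m_def using that bij_betw_imp_surj_on[OF \<beta>] by (intro f_inv_into_f) auto
  have m\<beta>: "\<exists>k b. k \<noteq> i \<and> k \<noteq> j \<and> k \<noteq> k0 \<and> p = m k b" for p
  proof -
    have "\<beta> p \<in> (UNIV - {i, j, k0}) \<times> UNIV" using bij_betw_imp_surj_on[OF \<beta>] by blast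
    moreover have "p = inv_into UNIV \<beta> (\<beta> p)" using bij_betw_imp_inj_on[OF \<beta>] by simp
    ultimately show ?thesis unfolding m_def by (metis DiffE SigmaE insertCI)
  qed
  \<comment> \<open>The value for \<open>k0\<close> is minus the sum of the others, so that the
    first two components of the edges other than \<open>i\<close>, \<open>j\<close> add up to zero
    for every \<open>t\<close>.\<close>
  define co where "co b t k = (if k = k0 then - (\<Sum>l\<in>UNIV - {i, j, k0}. t $ m l b) else t $ m k b)"
    for b and t :: "real^('n chart_dim)" and k
  define X where "X = co True"
  define Y where "Y = co False"
  have co_lin: "bounded_linear (\<lambda>t. co b t k)" for b k
    unfolding co_def by (cases "k = k0") (auto intro!: bounded_linear_intros bounded_linear_minus bounded_linear_sum bounded_linear_vec_nth)
  have co_sum: "(\<Sum>k\<in>UNIV - {i, j}. co b t k) = 0" for b t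
  proof -
    have "(\<Sum>k\<in>UNIV - {i, j}. co b t k) = co b t k0 + (\<Sum>k\<in>UNIV - {i, j} - {k0}. co b t k)"
      using k0 by (intro sum.remove) auto
    also have "UNIV - {i, j} - {k0} = UNIV - {i, j, k0}" by auto
    also have "(\<Sum>k\<in>UNIV - {i, j, k0}. co b t k) = (\<Sum>k\<in>UNIV - {i, j, k0}. t $ m k b)" by (rule sum.cong) (auto simp: co_def)
    finally show ?thesis by (simp add: co_def)
  qed
  define Q where "Q t k = 1 - X t k * X t k - Y t k * Y t k" for t k
  define Z where "Z t k = \<sigma> k * sqrt (Q t k)" for t k
  define D where "D t = (\<Sum>k\<in>UNIV - {i, j}. Z t k)" for t
  \<comment> \<open>The edges \<open>i\<close>, \<open>j\<close> are the equal sides of an isosceles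
    triangle with base \<open>D t\<close>; this is its height.\<close>
  define s where "s t = sqrt (1 - D t * D t / 4)" for t
  define w :: "real^('n chart_dim) \<Rightarrow> (real^3)^'n" where "w t = (\<chi> k. \<chi> p.
     if k = i then (if p = 1 then - s t else if p = 2 then 0 else - D t / 2)
     else if k = j then (if p = 1 then s t else if p = 2 then 0 else - D t / 2)
     else (if p = 1 then X t k else if p = 2 then Y t k else Z t k))" for t
  \<comment> \<open>The third component of the edges \<open>k0\<close>, \<open>k1\<close> at
    \<open>t0\<close>. The diagonal there is \<open>2 * z\<close>, less than 2 and less than
    \<open>\<delta>\<close>.\<close>
  define z where "z = min 1 \<delta> / 4"
  have z: "0 < z" "z < 1" "2 * z < 2" "2 * z < \<delta>" using \<delta> by (auto simp: z_def min_def)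
  define t0 :: "real^('n chart_dim)" where "t0 = axis (m k1 True) (sqrt (1 - z * z))"
  define G where "G = {t. \<forall>k\<in>UNIV - {i, j}. Q t k > 0}"
  \<comment> \<open>\<open>D t < 2\<close> lets the isosceles triangle exist, \<open>D t > 0\<close>
    keeps it nondegenerate, and the ball bounds the domain, so that it can later be joined with
    another one.\<close>
  define W where "W = {t \<in> G. D t > 0 \<and> D t < min 2 \<delta>} \<inter> ball t0 1"
  have Xc: "C1_on S (\<lambda>t. X t k)" and Yc: "C1_on S (\<lambda>t. Y t k)" for S k
    unfolding X_def Y_def by (rule C1_on_linear[OF co_lin C1_on_id])+
  have Qc: "C1_on S (\<lambda>t. Q t k)" for S k unfolding Q_def by (intro C1_intros Xc Yc)
  have Zc: "C1_on S (\<lambda>t. Z t k)" if "S \<subseteq> G" "k \<in> UNIV - {i, j}" for S k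
    unfolding Z_def by (intro C1_intros Qc) (use that in \<open>auto simp: G_def\<close>)
  have Dc: "C1_on S D" if "S \<subseteq> G" for S unfolding D_def by (intro C1_intros Zc that)
  have oG: "open G"
  proof -
    have "open ((\<lambda>t. Q t k) -` {0<..})" for k
      using C1_on_imp_continuous_on[OF Qc[of UNIV k]] by (intro open_vimage) auto
    then have "open (\<Inter>k\<in>UNIV - {i, j}. (\<lambda>t. Q t k) -` {0<..})" by (intro open_INT) auto
    moreover have "G = (\<Inter>k\<in>UNIV - {i, j}. (\<lambda>t. Q t k) -` {0<..})" by (auto simp: G_def)
    ultimately show ?thesis by simp
  qed
  have oW: "open W"
  proof -
    have "open (G \<inter> D -` {0<..<min 2 \<delta>})"
      using C1_on_imp_continuous_on[OF Dc[OF order_refl]] oG by (intro continuous_open_preimage) auto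
    moreover have "W = (G \<inter> D -` {0<..<min 2 \<delta>}) \<inter> ball t0 1" by (auto simp: W_def)
    ultimately show ?thesis by auto
  qed
  have WG: "W \<subseteq> G" by (auto simp: W_def)
  have DW: "D t > 0" "D t < 2" "D t < \<delta>" "1 - D t * D t / 4 > 0" if "t \<in> W" for t
  proof -
    show 1: "D t > 0" "D t < 2" "D t < \<delta>" using that by (auto simp: W_def)
    have "D t * D t < 2 * 2" using 1 by (intro mult_strict_mono) auto
    then show "1 - D t * D t / 4 > 0" by simp
  qed
  have s2: "s t * s t = 1 - D t * D t / 4" "s t > 0" if "t \<in> W" for t using DW(4)[OF that] by (simp_all add: s_def)
  have sc: "C1_on W s" unfolding s_def by (intro C1_intros Dc WG) (use DW(4) in auto)
  have Qp: "Q t k > 0" if "t \<in> W" "k \<noteq> i" "k \<noteq> j" for t k using that WG by (auto simp: G_def)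
  have Zn: "Z t k \<noteq> 0" "Z t k * Z t k = 1 - X t k * X t k - Y t k * Y t k" if "t \<in> W" "k \<noteq> i" "k \<noteq> j" for t k
  proof -
    show "Z t k \<noteq> 0" using Qp[OF that] \<sigma>2 by (simp add: Z_def)
    have "Z t k * Z t k = (\<sigma> k * \<sigma> k) * (sqrt (Q t k) * sqrt (Q t k))" by (simp add: Z_def)
    then show "Z t k * Z t k = 1 - X t k * X t k - Y t k * Y t k" using Qp[OF that] \<sigma>2 by (simp add: Q_def)
  qed
  have wi: "w t $ i $ 1 = - s t" "w t $ i $ 2 = 0" "w t $ i $ 3 = - D t / 2"
    and wj: "w t $ j $ 1 = s t" "w t $ j $ 2 = 0" "w t $ j $ 3 = - D t / 2" for t
    using ij by (simp_all add: w_def)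
  have wk: "w t $ k $ 1 = X t k" "w t $ k $ 2 = Y t k" "w t $ k $ 3 = Z t k" if "k \<noteq> i" "k \<noteq> j" for t k
    using that by (simp_all add: w_def)
  have C1w: "C1_on W w"
  proof -
    have "C1_on W (\<lambda>t. if k = i then (if p = 1 then - s t else if p = 2 then 0 else - D t / 2)
     else if k = j then (if p = 1 then s t else if p = 2 then 0 else - D t / 2)
     else (if p = 1 then X t k else if p = 2 then Y t k else Z t k))" for k and p :: 3
    proof -
      have D2: "C1_on W (\<lambda>t. - D t / 2)" by (intro C1_intros Dc WG) auto
      show ?thesis
        using D2 sc C1_on_const[of W "0::real"] C1_on_minus[OF sc] Xc[of W k] Yc[of W k] Zc[OF WG, of k]
        by (cases "k = i"; cases "k = j"; cases "p = 1"; cases "p = 2") simp_all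
    qed
    then show ?thesis unfolding w_def by (intro C1_on_vec_lambda)
  qed
  have unit: "norm (w t $ k) = 1" if "t \<in> W" for t k
  proof -
    have "w t $ k \<bullet> w t $ k = 1"
    proof (cases "k = i \<or> k = j")
      case True
      then show ?thesis using s2[OF that] wi[of t] wj[of t] by (auto simp: inner_vec_def sum_3)
    next
      case False
      then show ?thesis using Zn[OF that, of k] wk[of k t] by (simp add: inner_vec_def sum_3)
    qed
    then show ?thesis by (simp add: norm_eq_1)
  qed
  have sum0: "(\<Sum>k\<in>UNIV. w t $ k) = 0" for t
  proof -
    have "(\<Sum>k\<in>UNIV. w t $ k) = w t $ i + w t $ j + (\<Sum>k\<in>UNIV - {i, j}. w t $ k)"
      using ij by (subst sum.subset_diff[of "{i, j}"]) (auto simp: add_ac)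
    moreover have "(\<Sum>k\<in>UNIV - {i, j}. w t $ k) $ p = (if p = 1 then 0 else if p = 2 then 0 else D t)" for p
    proof -
      have "(\<Sum>k\<in>UNIV - {i, j}. w t $ k) $ p = (\<Sum>k\<in>UNIV - {i, j}. w t $ k $ p)" by simp
      also have "\<dots> = (\<Sum>k\<in>UNIV - {i, j}. if p = 1 then X t k else if p = 2 then Y t k else Z t k)"
        by (rule sum.cong) (auto simp: w_def)
      finally show ?thesis using co_sum[of True t] co_sum[of False t] by (auto simp: X_def Y_def D_def)
    qed
    ultimately show ?thesis
      unfolding vec_eq_iff forall_3 using wi[of t] wj[of t] by simp
  qed
  have cr: "cross3 (w t $ i) (w t $ j) $ 2 = - D t * s t" "cross3 (w t $ i) (w t $ j) $ 1 = 0" "cross3 (w t $ i) (w t $ j) $ 3 = 0" for t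
    unfolding cross_components wi wj by simp_all
  have reg: "w t \<in> regular_level (\<chi> k. a)" if "t \<in> W" for t
  proof -
    have "cross3 (w t $ i) (w t $ j) $ 2 \<noteq> 0" unfolding cr using DW(1)[OF that] s2(2)[OF that] by simp
    then have "\<not> degenerate (w t)" by (intro not_degenerateI[of _ i j]) auto
    moreover have "(\<Sum>k\<in>UNIV. a *\<^sub>R w t $ k) = 0" unfolding scaleR_sum_right[symmetric] sum0 by simp
    ultimately show ?thesis using unit[OF that] by (simp add: regular_level_def zero_level_def moment_map_def)
  qed
  \<comment> \<open>The coordinates are read off from rotation invariants: the length of the
    diagonal gives \<open>D\<close> and \<open>s\<close>; the products of an edge with
    \<open>u\<^sub>j - u\<^sub>i\<close> and with the normal of the triangle then give
    \<open>X\<close> and \<open>Y\<close>.\<close>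
  have inj: "t = t'" if tt: "t \<in> W" "t' \<in> W" "(w t, w t') \<in> so3_rel" for t t'
  proof -
    obtain A where A: "rotation_matrix A" "w t' = (\<chi> k. A *v w t $ k)" using tt(3) by (auto simp: so3_rel_def)
    have Ak: "w t' $ k = A *v w t $ k" for k unfolding A(2) by simp
    have DD: "(w t $ i + w t $ j) \<bullet> (w t $ i + w t $ j) = D t * D t" for t
      by (simp add: inner_vec_def sum_3 wi wj)
    have "D t' * D t' = D t * D t"
      unfolding DD[symmetric] Ak matrix_vector_right_distrib[symmetric] by (rule rotation_matrix_inner[OF A(1)])
    then have D: "D t' = D t" using DW(1)[OF tt(1)] DW(1)[OF tt(2)] by (simp add: square_eq_iff)
    then have s: "s t' = s t" by (simp add: s_def)
    have x: "w t $ k \<bullet> (w t $ j - w t $ i) = 2 * s t * X t k" if "k \<noteq> i" "k \<noteq> j" for t k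
      using wk[OF that, of t] by (simp add: inner_vec_def sum_3 wi wj)
    have y: "w t $ k \<bullet> cross3 (w t $ i) (w t $ j) = - D t * s t * Y t k" if "k \<noteq> i" "k \<noteq> j" for t k
      using wk[OF that, of t] cr[of t] by (simp add: inner_vec_def sum_3)
    have xy: "X t' k = X t k" "Y t' k = Y t k" if k: "k \<noteq> i" "k \<noteq> j" for k
    proof -
      have "2 * s t' * X t' k = 2 * s t * X t k"
        unfolding x[OF k, symmetric] Ak matrix_vector_mult_diff_distrib[symmetric] by (rule rotation_matrix_inner[OF A(1)])
      then show "X t' k = X t k" using s s2(2)[OF tt(1)] by simp
      have "- D t' * s t' * Y t' k = - D t * s t * Y t k"
        unfolding y[OF k, symmetric] Ak cross_rotation_matrix[OF A(1)] by (rule rotation_matrix_inner[OF A(1)])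
      then show "Y t' k = Y t k" using s D s2(2)[OF tt(1)] DW(1)[OF tt(1)] by simp
    qed
    have "t $ p = t' $ p" for p
    proof -
      obtain k b where kb: "k \<noteq> i" "k \<noteq> j" "k \<noteq> k0" "p = m k b" using m\<beta> by blast
      have "co b t k = co b t' k" using xy[OF kb(1,2)] unfolding X_def Y_def by (cases b) auto
      then show ?thesis using kb by (simp add: co_def)
    qed
    then show ?thesis by (simp add: vec_eq_iff)
  qed
  define w' where "w' t = frechet_derivative w (at t)" for t
  have L: "local_section (\<chi> k. a) W w w'"
  proof (rule local_section_iff_C1_on[THEN iffD2], intro conjI)
    show "open W" by (rule oW)
    show "w ` W \<subseteq> regular_level (\<chi> k. a)" using reg by blast
    show "C1_on W w" by (rule C1w)
    show "\<forall>x\<in>W. w' x = frechet_derivative w (at x)" unfolding w'_def by simp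
    show "\<forall>x\<in>W. \<forall>y\<in>W. (w x, w y) \<in> so3_rel \<longrightarrow> x = y" using inj by blast
  qed
  note S = local_section_tangent[OF L]
  have form: "symp_form (\<chi> k. a) (w t) (w' t h) (w' t h') = a * (\<Sum>k\<in>UNIV - {i, j}. (X h k * Y h' k - X h' k * Y h k) / Z t k)"
    if t: "t \<in> W" for t h h'
  proof -
    have dkp: "((\<lambda>t. w t $ k $ p) has_derivative (\<lambda>h. w' t h $ k $ p)) (at t)" for k p
      by (rule bounded_linear.has_derivative[OF bounded_linear_vec_nth bounded_linear.has_derivative[OF bounded_linear_vec_nth S(2)[OF t]]])
    have dX: "w' t h $ k $ 1 = X h k" and dY: "w' t h $ k $ 2 = Y h k" if k: "k \<noteq> i" "k \<noteq> j" for h k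
    proof -
      have "((\<lambda>t. X t k) has_derivative (\<lambda>h. w' t h $ k $ 1)) (at t)" using dkp[of k 1] wk[OF k] by simp
      from has_derivative_unique[OF this bounded_linear_imp_has_derivative[OF co_lin[of True k, folded X_def]]]
      show "w' t h $ k $ 1 = X h k" by meson
      have "((\<lambda>t. Y t k) has_derivative (\<lambda>h. w' t h $ k $ 2)) (at t)" using dkp[of k 2] wk[OF k] by simp
      from has_derivative_unique[OF this bounded_linear_imp_has_derivative[OF co_lin[of False k, folded Y_def]]]
      show "w' t h $ k $ 2 = Y h k" by meson
    qed
    have z0: "w' t h $ k $ 2 = 0" if "k = i \<or> k = j" for h k
    proof -
      have "((\<lambda>t. 0) has_derivative (\<lambda>h. w' t h $ k $ 2)) (at t)" using dkp[of k 2] that wi wj by auto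
      from has_derivative_unique[OF this has_derivative_const] show ?thesis by meson
    qed
    have "w t $ k \<bullet> cross3 (w' t h $ k) (w' t h' $ k) = 0" if "k = i \<or> k = j" for k
      using z0[OF that, of h] z0[OF that, of h'] that wi[of t] wj[of t] by (auto simp: inner_vec_def sum_3 cross_components)
    then have "symp_form (\<chi> k. a) (w t) (w' t h) (w' t h') = (\<Sum>k\<in>UNIV - {i, j}. a * (w t $ k \<bullet> cross3 (w' t h $ k) (w' t h' $ k)))"
      unfolding symp_form_def using ij by (subst sum.subset_diff[of "{i, j}"]) auto
    also have "\<dots> = (\<Sum>k\<in>UNIV - {i, j}. a * ((X h k * Y h' k - X h' k * Y h k) / Z t k))"
    proof (rule sum.cong)
      fix k assume "k \<in> UNIV - {i, j}"
      then have k: "k \<noteq> i" "k \<noteq> j" by auto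
      show "a * (w t $ k \<bullet> cross3 (w' t h $ k) (w' t h' $ k)) = a * ((X h k * Y h' k - X h' k * Y h k) / Z t k)"
        using triple_tangent_z[OF S(3)[OF t] S(4)[OF t] S(4)[OF t], of k h h'] Zn(1)[OF t k]
        unfolding wk[OF k] dX[OF k] dY[OF k] by (simp add: nonzero_eq_divide_eq)
    qed simp
    finally show ?thesis by (simp add: sum_distrib_left)
  qed
  \<comment> \<open>Let \<open>h\<close> be in the radical. Testing with directions that move edge
    \<open>k\<close> against \<open>k0\<close> shows that \<open>X h k / Z t k\<close> does not
    depend on \<open>k\<close>. As the \<open>X h k\<close> sum to zero and the \<open>Z t k\<close>
    to \<open>D t > 0\<close>, the common ratio is zero; likewise for \<open>Y\<close>.\<close>
  have nz: "det (\<chi> p q. symp_form (\<chi> k. a) (w t) (w' t (axis p 1)) (w' t (axis q 1))) \<noteq> 0" if t: "t \<in> W" for t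
  proof (rule det_bilinear_form_nz_iff[OF bilinear_symp_form_linear[OF S(1)[OF t]], THEN iffD2], intro allI impI)
    fix h assume "\<forall>h'. symp_form (\<chi> k. a) (w t) (w' t h) (w' t h') = 0"
    then have h0: "(\<Sum>k\<in>UNIV - {i, j}. (X h k * Y h' k - X h' k * Y h k) / Z t k) = 0" for h'
      using form[OF t] a by simp
    have inj_m: "m k b = m l c \<longleftrightarrow> k = l \<and> b = c" if "k \<noteq> i" "k \<noteq> j" "k \<noteq> k0" "l \<noteq> i" "l \<noteq> j" "l \<noteq> k0" for k l b c
    proof
      assume "m k b = m l c"
      then have "\<beta> (m k b) = \<beta> (m l c)" by (rule arg_cong)
      then have "(k, b) = (l, c)" unfolding \<beta>m[OF that(1-3)] \<beta>m[OF that(4-6)] .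
      then show "k = l \<and> b = c" by simp
    qed simp
    have axis: "co c (axis (m l b) 1) k = (if b = c then (if k = k0 then -1 else if k = l then 1 else 0) else 0)"
      if "l \<noteq> i" "l \<noteq> j" "l \<noteq> k0" "k \<noteq> i" "k \<noteq> j" for b c k l
    proof (cases "k = k0")
      case True
      have "(\<Sum>p\<in>UNIV - {i, j, k0}. axis (m l b) (1::real) $ m p c) = (\<Sum>p\<in>UNIV - {i, j, k0}. if p = l then (if b = c then 1 else 0) else 0)"
        using that inj_m by (intro sum.cong) (auto simp: axis_def)
      also have "\<dots> = (if b = c then 1 else 0)" using that by (simp add: sum.delta)
      finally show ?thesis using True by (simp add: co_def)
    next
      case False
      then show ?thesis using that inj_m by (auto simp: co_def axis_def)
    qed
    have ratio: "V k / Z t k = V k0 / Z t k0"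
      if V: "(\<Sum>k\<in>UNIV - {i, j}. V k * co c (axis (m l b) 1) k / Z t k) = 0" "b = c" "k = l" "l \<noteq> i" "l \<noteq> j" "l \<noteq> k0" for V :: "'n \<Rightarrow> real" and k l b c
    proof -
      have "(\<Sum>p\<in>UNIV - {i, j}. V p * co c (axis (m l b) 1) p / Z t p) = (\<Sum>p\<in>{k0, l}. V p * co c (axis (m l b) 1) p / Z t p)"
        using V k0 axis by (intro sum.mono_neutral_right) auto
      also have "\<dots> = - V k0 / Z t k0 + V l / Z t l" using V k0 axis[of l k0] axis[of l l] by simp
      finally show ?thesis using V by simp
    qed
    have X: "X h k / Z t k = X h k0 / Z t k0" if "k \<noteq> i" "k \<noteq> j" for k
    proof (cases "k = k0")
      case False
      have "(\<Sum>p\<in>UNIV - {i, j}. X h p * co False (axis (m k False) 1) p / Z t p) = (\<Sum>p\<in>UNIV - {i, j}. (X h p * Y (axis (m k False) 1) p - X (axis (m k False) 1) p * Y h p) / Z t p)"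
        using axis[OF that False] by (intro sum.cong) (auto simp: X_def Y_def)
      then show ?thesis using h0 ratio[of "X h" False k False k] that False by simp
    qed simp
    have Y: "Y h k / Z t k = Y h k0 / Z t k0" if "k \<noteq> i" "k \<noteq> j" for k
    proof (cases "k = k0")
      case False
      have "(\<Sum>p\<in>UNIV - {i, j}. Y h p * co True (axis (m k True) 1) p / Z t p) = - (\<Sum>p\<in>UNIV - {i, j}. (X h p * Y (axis (m k True) 1) p - X (axis (m k True) 1) p * Y h p) / Z t p)"
        using axis[OF that False] unfolding sum_negf[symmetric] by (intro sum.cong) (auto simp: X_def Y_def)
      then show ?thesis using h0 ratio[of "Y h" True k True k] that False by simp
    qed simp
    have zero: "V k = 0" if V: "\<And>k. k \<noteq> i \<Longrightarrow> k \<noteq> j \<Longrightarrow> V k / Z t k = \<mu>" "(\<Sum>k\<in>UNIV - {i, j}. V k) = 0" and k: "k \<noteq> i" "k \<noteq> j" for V :: "'n \<Rightarrow> real" and \<mu> k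
    proof -
      have VZ: "V k = \<mu> * Z t k" if "k \<noteq> i" "k \<noteq> j" for k using V(1)[OF that] Zn(1)[OF t that] by (simp add: field_simps)
      have "(\<Sum>k\<in>UNIV - {i, j}. V k) = (\<Sum>k\<in>UNIV - {i, j}. \<mu> * Z t k)" by (rule sum.cong) (auto intro: VZ)
      then have "\<mu> * D t = 0" using V(2) by (simp add: D_def sum_distrib_left)
      then have "\<mu> = 0" using DW(1)[OF t] by simp
      then show ?thesis using VZ[OF k] by simp
    qed
    have "h $ p = 0" for p
    proof -
      obtain k b where kb: "k \<noteq> i" "k \<noteq> j" "k \<noteq> k0" "p = m k b" using m\<beta> by blast
      have "X h k = 0" by (rule zero[OF X _ kb(1,2)]) (auto simp: X_def co_sum)
      moreover have "Y h k = 0" by (rule zero[OF Y _ kb(1,2)]) (auto simp: Y_def co_sum)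
      ultimately have "co b h k = 0" unfolding X_def Y_def by (cases b) auto
      then show ?thesis using kb by (simp add: co_def)
    qed
    then show "h = 0" by (simp add: vec_eq_iff)
  qed
  have ne: "t0 \<in> W"
  proof -
    have zz: "1 - z * z > 0" using z mult_strict_mono[of z 1 z 1] by simp
    have m1: "m k b = m k1 True \<longleftrightarrow> k = k1 \<and> b" if "k \<noteq> i" "k \<noteq> j" "k \<noteq> k0" for k b
    proof
      assume "m k b = m k1 True"
      then have "\<beta> (m k b) = \<beta> (m k1 True)" by (rule arg_cong)
      then have "(k, b) = (k1, True)" unfolding \<beta>m[OF that] \<beta>m[OF k1] .
      then show "k = k1 \<and> b" by simp
    qed simp
    have co0: "co b t0 k = (if b then (if k = k0 then - sqrt (1 - z * z) else if k = k1 then sqrt (1 - z * z) else 0) else 0)" if "k \<noteq> i" "k \<noteq> j" for b k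
    proof (cases "k = k0")
      case True
      have "(\<Sum>p\<in>UNIV - {i, j, k0}. t0 $ m p b) = (\<Sum>p\<in>UNIV - {i, j, k0}. if p = k1 then (if b then sqrt (1 - z * z) else 0) else 0)"
        using m1 by (intro sum.cong) (auto simp: t0_def axis_def)
      also have "\<dots> = (if b then sqrt (1 - z * z) else 0)" using k1 by (simp add: sum.delta)
      finally show ?thesis using True by (simp add: co_def)
    next
      case False
      then show ?thesis using that m1 by (auto simp: co_def t0_def axis_def)
    qed
    have Q0: "Q t0 k = (if k = k0 \<or> k = k1 then z * z else 1)" if "k \<noteq> i" "k \<noteq> j" for k
      using zz that by (auto simp: Q_def X_def Y_def co0)
    have Z0: "Z t0 k = (if k = k0 \<or> k = k1 then z else \<sigma> k)" if "k \<noteq> i" "k \<noteq> j" for k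
      using z that \<sigma>01 by (auto simp: Z_def Q0)
    have "D t0 = (\<Sum>k\<in>{k0, k1}. Z t0 k) + (\<Sum>k\<in>UNIV - {i, j, k0, k1}. Z t0 k)"
    proof -
      have "UNIV - {i, j} - {k0, k1} = UNIV - {i, j, k0, k1}" by auto
      then show ?thesis unfolding D_def using k0 k1 by (subst sum.subset_diff[of "{k0, k1}"]) (auto simp: add.commute)
    qed
    also have "(\<Sum>k\<in>UNIV - {i, j, k0, k1}. Z t0 k) = (\<Sum>k\<in>UNIV - {i, j, k0, k1}. \<sigma> k)"
      by (rule sum.cong) (auto simp: Z0)
    also have "\<dots> = 0" by (rule \<sigma>sum)
    finally have "D t0 = 2 * z" using k0 k1 Z0[of k0] Z0[of k1] by simp
    moreover have "t0 \<in> G" using Q0 z by (auto simp: G_def)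
    ultimately show ?thesis using z by (simp add: W_def)
  qed
  show thesis
  proof (rule that[OF L])
    show "liouville_volume (\<chi> k::'n. a) W w w' > 0"
      by (rule liouville_volume_pos[OF L]) (use ne nz in auto)
    show "bounded W" unfolding W_def by (rule bounded_subset[OF bounded_ball]) auto
    show "\<forall>t\<in>W. norm (w t $ i + w t $ j) < \<delta>"
    proof
      fix t assume t: "t \<in> W"
      have "w t $ i + w t $ j = axis 3 (- D t)" unfolding vec_eq_iff forall_3 by (simp add: wi wj axis_def)
      then show "norm (w t $ i + w t $ j) < \<delta>" using DW[OF t] by (simp add: norm_axis)
    qed
  qed
qed

section \<open>Comparison of Euclidean volumes\<close>

text \<open>Monotone convergence. It reduces inequalities between volumes to sections with bounded
  domains.\<close>

lemma liouville_volume_balls_tendsto: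
  fixes r :: "real^'n::finite"
  assumes L: "local_section r U \<phi> \<phi>'"
  shows "(\<lambda>N. liouville_volume r (U \<inter> ball 0 (real N)) \<phi> \<phi>') \<longlonglongrightarrow> liouville_volume r U \<phi> \<phi>'"
proof -
  define g where "g x = ennreal (sqrt \<bar>det (\<chi> a b. symp_form r (\<phi> x) (\<phi>' x (axis a 1)) (\<phi>' x (axis b 1)))\<bar>)" for x
  define f where "f N x = g x * indicator (U \<inter> ball 0 (real N)) x" for N x
  have U: "open U" using L by (simp add: local_section_def)
  have m: "f N \<in> borel_measurable lborel" for N
    unfolding f_def g_def by (rule local_section_density[OF local_section_subset[OF L]]) (use U in auto)
  have inc: "incseq f"
    unfolding incseq_def le_fun_def f_def by (auto intro!: mult_left_mono split: split_indicator)
  have sup: "(SUP N. f N x) = g x * indicator U x" for x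
  proof (cases "x \<in> U")
    case True
    obtain N where N: "norm x < real N" using reals_Archimedean2 by blast
    show ?thesis
    proof (rule antisym)
      show "(SUP N. f N x) \<le> g x * indicator U x" by (rule SUP_least) (auto simp: f_def split: split_indicator)
      have "g x * indicator U x = f N x" using True N by (simp add: f_def)
      also have "\<dots> \<le> (SUP N. f N x)" by (rule SUP_upper) simp
      finally show "g x * indicator U x \<le> (SUP N. f N x)" .
    qed
  qed (simp add: f_def)
  have "(\<integral>\<^sup>+x. (SUP N. f N x) \<partial>lborel) = (SUP N. (\<integral>\<^sup>+x. f N x \<partial>lborel))"
    by (rule nn_integral_monotone_convergence_SUP[OF inc m])
  then have "liouville_volume r U \<phi> \<phi>' = (SUP N. (\<integral>\<^sup>+x. f N x \<partial>lborel))"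
    unfolding sup by (simp add: liouville_volume_def g_def)
  moreover have "incseq (\<lambda>N. (\<integral>\<^sup>+x. f N x \<partial>lborel))"
    using inc by (auto simp: incseq_def le_fun_def intro!: nn_integral_mono)
  ultimately show ?thesis
    using LIMSEQ_SUP[of "\<lambda>N. (\<integral>\<^sup>+x. f N x \<partial>lborel)"] by (simp add: f_def g_def liouville_volume_def)
qed

lemma nn_integral_lborel_translate:
  fixes g :: "'a::euclidean_space \<Rightarrow> ennreal"
  assumes "g \<in> borel_measurable borel"
  shows "(\<integral>\<^sup>+x. g (x - c) \<partial>lborel) = (\<integral>\<^sup>+x. g x \<partial>lborel)"
proof -
  have "(\<integral>\<^sup>+x. g x \<partial>lborel) = (\<integral>\<^sup>+x. g x \<partial>distr lborel borel ((+) (- c)))" by (simp add: lborel_distr_plus)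
  also have "\<dots> = (\<integral>\<^sup>+x. g (- c + x) \<partial>lborel)" by (rule nn_integral_distr) (use assms in auto)
  finally show ?thesis by (simp add: add.commute)
qed

text \<open>The domains may overlap, so the second is translated out of the way, which boundedness
  permits. By \<open>sep\<close>, the combined map is still injective modulo rotations.\<close>

lemma local_section_disjoint_union:
  fixes r :: "real^'n::finite"
  assumes L1: "local_section r U \<phi> \<phi>'" and L2: "local_section r W \<theta> \<theta>'" and bd: "bounded U" "bounded W"
    and sep: "\<And>x y. x \<in> U \<Longrightarrow> y \<in> W \<Longrightarrow> (\<phi> x, \<theta> y) \<notin> so3_rel \<and> (\<theta> y, \<phi> x) \<notin> so3_rel"
  obtains S \<Phi> \<Phi>' where "local_section r S \<Phi> \<Phi>'" "liouville_volume r S \<Phi> \<Phi>' = liouville_volume r U \<phi> \<phi>' + liouville_volume r W \<theta> \<theta>'"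
proof -
  obtain R where R: "\<And>x. x \<in> U \<Longrightarrow> norm x < R" using bd(1) unfolding bounded_pos_less by blast
  obtain B where B: "B > 0" "\<And>x. x \<in> W \<Longrightarrow> norm x < B" using bd(2) unfolding bounded_pos_less by blast
  \<comment> \<open>Translation by this vector moves \<open>W\<close> out of the ball of radius
    \<open>R\<close> that contains \<open>U\<close>.\<close>
  define c :: "real^('n chart_dim)" where "c = (\<bar>R\<bar> + B) *\<^sub>R axis undefined 1"
  have nc: "norm c = \<bar>R\<bar> + B" using B by (simp add: c_def norm_axis)
  define Wc where "Wc = (+) c ` W"
  define \<Phi> where "\<Phi> x = (if x \<in> ball 0 R then \<phi> x else \<theta> (x - c))" for x
  define \<Phi>' where "\<Phi>' x = (if x \<in> ball 0 R then \<phi>' x else \<theta>' (x - c))" for x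
  have inU: "\<Phi> x = \<phi> x" "\<Phi>' x = \<phi>' x" if "x \<in> U" for x using R[OF that] by (simp_all add: \<Phi>_def \<Phi>'_def)
  have inW: "\<Phi> x = \<theta> (x - c)" "\<Phi>' x = \<theta>' (x - c)" "x - c \<in> W" "x \<notin> U" if "x \<in> Wc" for x
  proof -
    obtain y where y: "y \<in> W" "x = c + y" using \<open>x \<in> Wc\<close> by (auto simp: Wc_def)
    have "norm c \<le> norm x + norm y" using norm_triangle_ineq4[of x y] y by simp
    then have nx: "\<not> norm x < R" using B(2)[OF y(1)] nc by linarith
    then show "\<Phi> x = \<theta> (x - c)" "\<Phi>' x = \<theta>' (x - c)" by (simp_all add: \<Phi>_def \<Phi>'_def)
    show "x - c \<in> W" using y by simp
    show "x \<notin> U" using R nx by blast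
  qed
  have o: "open U" "open W" using L1 L2 by (auto simp: local_section_def)
  have oc: "open Wc" unfolding Wc_def by (rule open_translation[OF o(2)])
  have LS: "local_section r (U \<union> Wc) \<Phi> \<Phi>'"
    unfolding local_section_def
  proof (intro conjI)
    show "open (U \<union> Wc)" using o oc by blast
    show "\<Phi> ` (U \<union> Wc) \<subseteq> regular_level r"
      using L1 L2 inU(1) inW(1,3) unfolding local_section_def by (auto simp: image_subset_iff)
    show "\<forall>x\<in>U \<union> Wc. (\<Phi> has_derivative \<Phi>' x) (at x)"
    proof
      fix x assume "x \<in> U \<union> Wc"
      then consider "x \<in> U" | "x \<in> Wc" by blast
      then show "(\<Phi> has_derivative \<Phi>' x) (at x)"
      proof cases
        case 1
        have "(\<phi> has_derivative \<phi>' x) (at x)" using L1 1 by (simp add: local_section_def)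
        then have "(\<Phi> has_derivative \<phi>' x) (at x)"
          by (rule has_derivative_transform_within_open[OF _ o(1) 1]) (simp add: inU)
        then show ?thesis by (simp add: inU 1)
      next
        case 2
        have "(\<theta> has_derivative \<theta>' (x - c)) (at (x - c))" using L2 inW(3)[OF 2] by (simp add: local_section_def)
        moreover have "((\<lambda>x. x - c) has_derivative (\<lambda>h. h)) (at x)" by (auto intro!: derivative_eq_intros)
        ultimately have "((\<lambda>x. \<theta> (x - c)) has_derivative \<theta>' (x - c)) (at x)"
          using has_derivative_compose[of "\<lambda>x. x - c" "\<lambda>h. h" x UNIV \<theta> "\<theta>' (x - c)"] by simp
        then have "(\<Phi> has_derivative \<theta>' (x - c)) (at x)"
          by (rule has_derivative_transform_within_open[OF _ oc 2]) (simp add: inW)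
        then show ?thesis by (simp add: inW[OF 2])
      qed
    qed
    show "\<forall>h. continuous_on (U \<union> Wc) (\<lambda>x. \<Phi>' x h)"
    proof
      fix h
      have "continuous_on U (\<lambda>x. \<phi>' x h)" using L1 by (simp add: local_section_def)
      then have "continuous_on U (\<lambda>x. \<Phi>' x h)" by (subst continuous_on_cong[OF refl, where g = "\<lambda>x. \<phi>' x h"]) (simp_all add: inU)
      moreover have "continuous_on Wc (\<lambda>x. \<theta>' (x - c) h)"
        by (rule continuous_on_compose2[of W "\<lambda>x. \<theta>' x h" Wc "\<lambda>x. x - c"])
           (use L2 inW(3) in \<open>auto simp: local_section_def intro!: continuous_intros\<close>)
      then have "continuous_on Wc (\<lambda>x. \<Phi>' x h)" by (subst continuous_on_cong[OF refl, where g = "\<lambda>x. \<theta>' (x - c) h"]) (simp_all add: inW)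
      ultimately show "continuous_on (U \<union> Wc) (\<lambda>x. \<Phi>' x h)" using o(1) oc by (intro continuous_on_open_Un)
    qed
    show "\<forall>x\<in>U \<union> Wc. \<forall>y\<in>U \<union> Wc. (\<Phi> x, \<Phi> y) \<in> so3_rel \<longrightarrow> x = y"
    proof (intro ballI impI)
      fix x y assume xy: "x \<in> U \<union> Wc" "y \<in> U \<union> Wc" "(\<Phi> x, \<Phi> y) \<in> so3_rel"
      consider "x \<in> U" "y \<in> U" | "x \<in> U" "y \<in> Wc" | "x \<in> Wc" "y \<in> U" | "x \<in> Wc" "y \<in> Wc" using xy by blast
      then show "x = y"
      proof cases
        case 1 then show ?thesis using L1 xy(3) unfolding local_section_def by (simp add: inU)
      next
        case 2 then show ?thesis using sep[of x "y - c"] xy(3) inW[of y] inU[of x] by simp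
      next
        case 3 then show ?thesis using sep[of y "x - c"] xy(3) inW[of x] inU[of y] by simp
      next
        case 4
        then have "(\<theta> (x - c), \<theta> (y - c)) \<in> so3_rel" "x - c \<in> W" "y - c \<in> W" using xy(3) inW[of x] inW[of y] by simp_all
        then have "x - c = y - c" using L2 unfolding local_section_def by blast
        then show ?thesis by simp
      qed
    qed
  qed
  define g where "g x = ennreal (sqrt \<bar>det (\<chi> a b. symp_form r (\<Phi> x) (\<Phi>' x (axis a 1)) (\<Phi>' x (axis b 1)))\<bar>)" for x
  define g2 where "g2 x = ennreal (sqrt \<bar>det (\<chi> a b. symp_form r (\<theta> x) (\<theta>' x (axis a 1)) (\<theta>' x (axis b 1)))\<bar>) * indicator W x" for x
  have mU: "(\<lambda>x. g x * indicator U x) \<in> borel_measurable lborel"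
    unfolding g_def by (rule local_section_density[OF local_section_subset[OF LS o(1)]]) simp
  have mW: "(\<lambda>x. g x * indicator Wc x) \<in> borel_measurable lborel"
    unfolding g_def by (rule local_section_density[OF local_section_subset[OF LS oc]]) simp
  have m2: "g2 \<in> borel_measurable borel"
    using local_section_density[OF L2] by (simp add: g2_def[abs_def])
  have "liouville_volume r (U \<union> Wc) \<Phi> \<Phi>' = (\<integral>\<^sup>+x. g x * indicator U x + g x * indicator Wc x \<partial>lborel)"
    unfolding liouville_volume_def g_def[symmetric]
    by (rule nn_integral_cong) (use inW(4) in \<open>auto split: split_indicator\<close>)
  also have "\<dots> = (\<integral>\<^sup>+x. g x * indicator U x \<partial>lborel) + (\<integral>\<^sup>+x. g x * indicator Wc x \<partial>lborel)"
    by (rule nn_integral_add[OF mU mW])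
  also have "(\<integral>\<^sup>+x. g x * indicator U x \<partial>lborel) = liouville_volume r U \<phi> \<phi>'"
    unfolding liouville_volume_def by (rule nn_integral_cong) (simp add: g_def inU split: split_indicator)
  also have "(\<integral>\<^sup>+x. g x * indicator Wc x \<partial>lborel) = (\<integral>\<^sup>+x. g2 (x - c) \<partial>lborel)"
  proof (rule nn_integral_cong)
    fix x
    have "x \<in> Wc" if "x - c \<in> W" using that unfolding Wc_def by (intro image_eqI[of _ _ "x - c"]) auto
    then show "g x * indicator Wc x = g2 (x - c)"
      using inW[of x] by (cases "x \<in> Wc") (auto simp: g_def g2_def split: split_indicator)
  qed
  also have "\<dots> = liouville_volume r W \<theta> \<theta>'"
    unfolding nn_integral_lborel_translate[OF m2] by (simp add: g2_def[abs_def] liouville_volume_def)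
  finally show thesis using that[OF LS] by blast
qed

section \<open>Comparison of the suprema\<close>

lemma symplectic_volume_Sup:
  fixes r :: "real^'n::finite"
  assumes "CARD('n) \<ge> 4"
  shows "symplectic_volume r = Sup {liouville_volume r U \<phi> \<phi>' | U \<phi> \<phi>'. local_section r U \<phi> \<phi>'}"
  using assms by (simp add: symplectic_volume_def)

lemma liouville_volume_le_symplectic_volume:
  fixes r :: "real^'n::finite"
  assumes "CARD('n) \<ge> 4" "local_section r U \<phi> \<phi>'"
  shows "liouville_volume r U \<phi> \<phi>' \<le> symplectic_volume r"
  unfolding symplectic_volume_Sup[OF assms(1)]
proof (rule Sup_upper, rule CollectI, intro exI conjI)
  show "local_section r U \<phi> \<phi>'" by fact
qed simp

lemma symplectic_volume_leI:
  fixes r :: "real^'n::finite"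
  assumes "CARD('n) \<ge> 4" "\<And>U \<phi> \<phi>'. local_section r U \<phi> \<phi>' \<Longrightarrow> liouville_volume r U \<phi> \<phi>' \<le> c"
  shows "symplectic_volume r \<le> c"
  unfolding symplectic_volume_Sup[OF assms(1)]
proof (rule Sup_least, elim CollectE exE conjE)
  fix v U \<phi> \<phi>' assume "v = liouville_volume r U \<phi> \<phi>'" "local_section r U \<phi> \<phi>'"
  then show "v \<le> c" using assms(2) by simp
qed

text \<open>Parallel edges carry no volume; on the rest of its domain, every section for
  \<open>r\<close> is turned into one for \<open>s\<close> of the same volume.\<close>

lemma symplectic_volume_mono:
  fixes r s :: "real^'n::finite"
  assumes n: "CARD('n) \<ge> 4" and ij: "i \<noteq> j" and r: "\<And>k. r $ k > 0" and s: "\<And>k. s $ k > 0"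
    and so: "\<And>k. k \<noteq> i \<Longrightarrow> k \<noteq> j \<Longrightarrow> s $ k = r $ k"
    and sum: "s $ i + s $ j = r $ i + r $ j" and diff: "\<bar>s $ i - s $ j\<bar> \<le> \<bar>r $ i - r $ j\<bar>"
  shows "symplectic_volume r \<le> symplectic_volume s"
proof (rule symplectic_volume_leI[OF n])
  fix U \<phi> \<phi>' assume L: "local_section r U \<phi> \<phi>'"
  have r0: "r $ k \<noteq> 0" for k using r[of k] by simp
  have L': "local_section r (nonparallel i j \<phi> U) \<phi> \<phi>'"
    by (rule local_section_subset[OF L open_nonparallel[OF L]]) (auto simp: nonparallel_def)
  have np: "nonparallel i j \<phi> (nonparallel i j \<phi> U) = nonparallel i j \<phi> U" by (auto simp: nonparallel_def)
  obtain \<psi> \<psi>' where P: "local_section s (nonparallel i j \<phi> U) \<psi> \<psi>'"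
    "liouville_volume s (nonparallel i j \<phi> U) \<psi> \<psi>' = liouville_volume r (nonparallel i j \<phi> U) \<phi> \<phi>'"
    "\<forall>x \<in> nonparallel i j \<phi> U. s $ i *\<^sub>R \<psi> x $ i + s $ j *\<^sub>R \<psi> x $ j = r $ i *\<^sub>R \<phi> x $ i + r $ j *\<^sub>R \<phi> x $ j"
    using section_transfer[OF ij r s so sum diff L' np] .
  have "liouville_volume r U \<phi> \<phi>' = liouville_volume s (nonparallel i j \<phi> U) \<psi> \<psi>'"
    unfolding P(2) by (rule liouville_volume_nonparallel[OF n ij r0 L])
  also have "\<dots> \<le> symplectic_volume s" by (rule liouville_volume_le_symplectic_volume[OF n P(1)])
  finally show "liouville_volume r U \<phi> \<phi>' \<le> symplectic_volume s" .
qed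

lemma so3_rel_norm_pair:
  assumes "(u, v) \<in> so3_rel" shows "norm (v $ i + v $ j) = norm (u $ i + u $ j)"
proof -
  obtain A where A: "rotation_matrix A" "v = (\<chi> k. A *v u $ k)" using assms by (auto simp: so3_rel_def)
  have "v $ i + v $ j = A *v (u $ i + u $ j)" by (simp add: A(2) matrix_vector_right_distrib)
  then show ?thesis using rotation_matrix_inner[OF A(1)] by (simp add: norm_eq_sqrt_inner)
qed

text \<open>The image of the moduli space of \<open>r\<close> misses the polygons whose diagonal is shorter than
  \<open>\<bar>r\<^sub>i - r\<^sub>j\<bar>\<close>.\<close>

lemma symplectic_volume_strict:
  fixes r :: "real^'n::finite"
  assumes n: "CARD('n) \<ge> 4" "even CARD('n)" and ij: "i \<noteq> j" and r: "\<And>k. r $ k > 0" and a: "a > 0"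
    and ro: "\<And>k. k \<noteq> i \<Longrightarrow> k \<noteq> j \<Longrightarrow> r $ k = a" and sum: "r $ i + r $ j = 2 * a" and ne: "r $ i \<noteq> a"
  shows "symplectic_volume r < symplectic_volume (\<chi> k::'n. a)"
proof -
  let ?s = "\<chi> k::'n. a"
  \<comment> \<open>After the transfer, \<open>a\<close> times the sum of the edges
    \<open>i\<close>, \<open>j\<close> is the old diagonal, whose length is at least
    \<open>\<bar>r $ i - r $ j\<bar>\<close>. The sum therefore has norm at least
    \<open>\<delta>\<close>, in contrast to the polygons over \<open>W\<close>.\<close>
  define \<delta> where "\<delta> = \<bar>r $ i - r $ j\<bar> / a"
  have rij: "r $ i \<noteq> r $ j" using sum ne by linarith
  then have \<delta>: "\<delta> > 0" using a by (simp add: \<delta>_def)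
  obtain W \<theta> \<theta>' where W: "local_section ?s W \<theta> \<theta>'" "liouville_volume ?s W \<theta> \<theta>' > 0" "bounded W"
    "\<forall>t\<in>W. norm (\<theta> t $ i + \<theta> t $ j) < \<delta>"
    using small_diagonal_section[OF n ij \<delta> a] .
  have r0: "r $ k \<noteq> 0" for k using r[of k] by simp
  have le: "liouville_volume r U \<phi> \<phi>' + liouville_volume ?s W \<theta> \<theta>' \<le> symplectic_volume ?s"
    if L: "local_section r U \<phi> \<phi>'" for U \<phi> \<phi>'
  proof -
    define V where "V = nonparallel i j \<phi> U"
    have LV: "local_section r V \<phi> \<phi>'"
      unfolding V_def by (rule local_section_subset[OF L open_nonparallel[OF L]]) (auto simp: nonparallel_def)
    have oV: "open V" using LV by (simp add: local_section_def)
    have vV: "liouville_volume r U \<phi> \<phi>' = liouville_volume r V \<phi> \<phi>'" unfolding V_def by (rule liouville_volume_nonparallel[OF n(1) ij r0 L])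
    have step: "liouville_volume r (V \<inter> ball 0 (real N)) \<phi> \<phi>' + liouville_volume ?s W \<theta> \<theta>' \<le> symplectic_volume ?s" for N
    proof -
      have LN: "local_section r (V \<inter> ball 0 (real N)) \<phi> \<phi>'" by (rule local_section_subset[OF LV]) (use oV in auto)
      have np: "nonparallel i j \<phi> (V \<inter> ball 0 (real N)) = V \<inter> ball 0 (real N)" by (auto simp: nonparallel_def V_def)
      have sp: "?s $ k > 0" for k using a by simp
      have so: "?s $ k = r $ k" if "k \<noteq> i" "k \<noteq> j" for k using ro[OF that] by simp
      have ssum: "?s $ i + ?s $ j = r $ i + r $ j" using sum by simp
      have sdiff: "\<bar>?s $ i - ?s $ j\<bar> \<le> \<bar>r $ i - r $ j\<bar>" by simp
      obtain \<psi> \<psi>' where P: "local_section ?s (V \<inter> ball 0 (real N)) \<psi> \<psi>'"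
        "liouville_volume ?s (V \<inter> ball 0 (real N)) \<psi> \<psi>' = liouville_volume r (V \<inter> ball 0 (real N)) \<phi> \<phi>'"
        "\<forall>x \<in> V \<inter> ball 0 (real N). ?s $ i *\<^sub>R \<psi> x $ i + ?s $ j *\<^sub>R \<psi> x $ j = r $ i *\<^sub>R \<phi> x $ i + r $ j *\<^sub>R \<phi> x $ j"
        using section_transfer[OF ij r sp so ssum sdiff LN np] .
      have big: "norm (\<psi> x $ i + \<psi> x $ j) \<ge> \<delta>" if x: "x \<in> V \<inter> ball 0 (real N)" for x
      proof -
        have "\<bar>r $ i - r $ j\<bar> \<le> norm (r $ i *\<^sub>R \<phi> x $ i + r $ j *\<^sub>R \<phi> x $ j)"
          using norm_triangle_ineq3[of "r $ i *\<^sub>R \<phi> x $ i" "- r $ j *\<^sub>R \<phi> x $ j"] local_section_tangent(3)[OF LN x] r[of i] r[of j]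
          by simp
        also have "r $ i *\<^sub>R \<phi> x $ i + r $ j *\<^sub>R \<phi> x $ j = a *\<^sub>R (\<psi> x $ i + \<psi> x $ j)"
          using P(3) x by (simp add: scaleR_right_distrib)
        finally show ?thesis using a by (simp add: \<delta>_def divide_le_eq mult.commute)
      qed
      have bd: "bounded (V \<inter> ball 0 (real N))" by (rule bounded_subset[OF bounded_ball[of 0 "real N"]]) auto
      have sep: "(\<psi> x, \<theta> y) \<notin> so3_rel \<and> (\<theta> y, \<psi> x) \<notin> so3_rel" if "x \<in> V \<inter> ball 0 (real N)" "y \<in> W" for x y
        using big[OF that(1)] bspec[OF W(4) that(2)] so3_rel_norm_pair[of "\<psi> x" "\<theta> y" i j] so3_rel_norm_pair[of "\<theta> y" "\<psi> x" i j] by auto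
      obtain S \<Phi> \<Phi>' where S: "local_section ?s S \<Phi> \<Phi>'"
        "liouville_volume ?s S \<Phi> \<Phi>' = liouville_volume ?s (V \<inter> ball 0 (real N)) \<psi> \<psi>' + liouville_volume ?s W \<theta> \<theta>'"
        using local_section_disjoint_union[OF P(1) W(1) bd W(3) sep] .
      show ?thesis unfolding P(2)[symmetric] S(2)[symmetric] by (rule liouville_volume_le_symplectic_volume[OF n(1) S(1)])
    qed
    have "(\<lambda>N. liouville_volume r (V \<inter> ball 0 (real N)) \<phi> \<phi>' + liouville_volume ?s W \<theta> \<theta>') \<longlonglongrightarrow>
        liouville_volume r V \<phi> \<phi>' + liouville_volume ?s W \<theta> \<theta>'"
      by (intro tendsto_add liouville_volume_balls_tendsto[OF LV] tendsto_const)
    then show ?thesis unfolding vV by (rule LIMSEQ_le_const2) (use step in blast)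
  qed
  obtain C :: real where C: "\<forall>U \<phi> \<phi>'. local_section r U \<phi> \<phi>' \<longrightarrow> liouville_volume r U \<phi> \<phi>' \<le> ennreal C"
    using liouville_volume_bounded[OF n(1) ij rij r] .
  have "symplectic_volume r \<le> ennreal C" by (rule symplectic_volume_leI[OF n(1) C[rule_format]])
  then have fin: "symplectic_volume r < top" by (rule le_less_trans) simp
  show ?thesis
  \<comment> \<open>The volume over \<open>W\<close> can be subtracted only if the larger supremum
    is finite; if it is infinite, finiteness of the smaller one suffices.\<close>
  proof (cases "symplectic_volume ?s = top")
    case False
    let ?w = "liouville_volume ?s W \<theta> \<theta>'"
    have w: "?w \<le> symplectic_volume ?s" by (rule liouville_volume_le_symplectic_volume[OF n(1) W(1)])
    then have wf: "?w \<noteq> top" using False by (auto simp: top_unique)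
    have "symplectic_volume r \<le> symplectic_volume ?s - ?w"
    proof (rule symplectic_volume_leI[OF n(1)])
      fix U \<phi> \<phi>' assume "local_section r U \<phi> \<phi>'"
      from ennreal_minus_mono[OF le[OF this] order_refl, of ?w]
      show "liouville_volume r U \<phi> \<phi>' \<le> symplectic_volume ?s - ?w" using wf by simp
    qed
    then have "symplectic_volume r + ?w \<le> symplectic_volume ?s - ?w + ?w" by (rule add_right_mono)
    also have "\<dots> = symplectic_volume ?s" by (rule diff_add_cancel_ennreal[OF w])
    finally have sum_le: "symplectic_volume r + ?w \<le> symplectic_volume ?s" .
    have "symplectic_volume r + 0 < symplectic_volume r + ?w"
      unfolding ennreal_add_left_cancel_less using fin W(2) by auto
    then have "symplectic_volume r < symplectic_volume r + ?w" by (simp only: add_0_right)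
    then show ?thesis using sum_le by (rule less_le_trans)
  qed (use fin in simp)
qed

section \<open>Triangles\<close>

lemma so3_rel_sym: assumes "(u, v) \<in> so3_rel" shows "(v, u) \<in> so3_rel"
proof -
  obtain A where A: "rotation_matrix A" "v = (\<chi> i. A *v u $ i)" using assms by (auto simp: so3_rel_def)
  have "transpose A *v (A *v x) = x" for x
    using A(1) unfolding rotation_matrix_def orthogonal_matrix_def by (simp only: matrix_vector_mul_assoc matrix_vector_mul_lid)
  then have "u = (\<chi> i. transpose A *v v $ i)" unfolding A(2) by (simp only: vec_eq_iff[of u] vec_lambda_beta simp_thms)
  moreover have "rotation_matrix (transpose A)"
    using A(1) by (simp add: rotation_matrix_def orthogonal_matrix_transpose det_transpose)
  ultimately show ?thesis unfolding so3_rel_def by blast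
qed

lemma so3_rel_trans: assumes "(u, v) \<in> so3_rel" "(v, w) \<in> so3_rel" shows "(u, w) \<in> so3_rel"
proof -
  obtain A where A: "rotation_matrix A" "v = (\<chi> i. A *v u $ i)" using assms by (auto simp: so3_rel_def)
  obtain B where B: "rotation_matrix B" "w = (\<chi> i. B *v v $ i)" using assms by (auto simp: so3_rel_def)
  have "w = (\<chi> i. (B ** A) *v u $ i)" unfolding B(2) A(2) by (simp add: matrix_vector_mul_assoc)
  moreover have "rotation_matrix (B ** A)"
    using A(1) B(1) by (simp add: rotation_matrix_def orthogonal_matrix_mul det_mul)
  ultimately show ?thesis unfolding so3_rel_def by blast
qed

lemma so3_rel_degenerate: assumes "(u, v) \<in> so3_rel" "degenerate u" shows "degenerate v"
proof -
  obtain A where A: "rotation_matrix A" "v = (\<chi> i. A *v u $ i)" using assms by (auto simp: so3_rel_def)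
  have "collinear ((*v) A ` insert 0 (range (($) u)))"
    using assms(2) unfolding degenerate_def by (rule collinear_linear_image) (rule matrix_vector_mul_linear)
  moreover have "(*v) A ` insert 0 (range (($) u)) = insert 0 (range (($) v))"
    unfolding A(2) by (auto simp: image_image)
  ultimately show ?thesis by (simp add: degenerate_def)
qed

text \<open>If \<open>u\<close>, \<open>v\<close> are parallel, any rotation from \<open>u\<close>
  to \<open>u'\<close> works. Otherwise Gram-Schmidt and a cross product give a frame in which the
  pair has the coordinates \<open>(1, 0, 0)\<close> and \<open>(c, sqrt (1 - c * c), 0)\<close>,
  which depend only on the inner product \<open>c\<close>.\<close>

lemma unit_pair_rotation:
  fixes u v u' v' :: "real^3"
  assumes n: "norm u = 1" "norm v = 1" "norm u' = 1" "norm v' = 1" and eq: "u \<bullet> v = u' \<bullet> v'"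
  obtains A where "rotation_matrix A" "A *v u = u'" "A *v v = v'"
proof (cases "cross3 u v = 0")
  case True
  have uu: "u \<bullet> u = 1" "u' \<bullet> u' = 1" using n by (simp_all add: norm_eq_1)
  obtain \<sigma> where \<sigma>: "\<sigma> = 1 \<or> \<sigma> = -1" "v = \<sigma> *\<^sub>R u"
    using unit_parallel[OF n(1,2) True] by (metis scaleR_minus1_left scaleR_one)
  have "(u' \<bullet> v')\<^sup>2 = 1" unfolding eq[symmetric] \<sigma>(2) using \<sigma>(1) uu by auto
  then have "cross3 u' v' = 0" using norm_cross[of u' v'] n by simp
  then have "v' = u' \<or> v' = - u'" by (rule unit_parallel[OF n(3,4)])
  then have v': "v' = \<sigma> *\<^sub>R u'" using eq uu \<sigma> by auto
  obtain f where f: "orthogonal_transformation f" "det (matrix f) = 1" "f u = u'"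
    using rotation_exists_1[of u u'] n by auto
  have lin: "linear f" using f(1) by (simp add: orthogonal_transformation_def)
  have mf: "matrix f *v x = f x" for x using matrix_works[OF lin[unfolded linear_matrix_vector_mul_eq[symmetric]]] lin by (simp add: matrix_vector_mul)
  show ?thesis
  proof (rule that[of "matrix f"])
    show "rotation_matrix (matrix f)" using f by (simp add: rotation_matrix_def orthogonal_transformation_matrix)
    show "matrix f *v u = u'" using f(3) mf by simp
    show "matrix f *v v = v'" unfolding mf \<sigma>(2) v' using f(3) linear_cmul[OF lin] by simp
  qed
next
  case False
  define c where "c = u \<bullet> v"
  have c: "\<bar>c\<bar> < 1" unfolding c_def by (rule abs_inner_less_1[OF n(1,2) False])
  then have c1: "1 - c * c > 0" using abs_square_less_1[of c] by (simp add: power2_eq_square)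
  define b where "b u v = (\<lambda>p::3. if p = 1 then u else if p = 2 then (1 / sqrt (1 - c * c)) *\<^sub>R (v - c *\<^sub>R u)
     else cross3 u ((1 / sqrt (1 - c * c)) *\<^sub>R (v - c *\<^sub>R u)))" for u v :: "real^3"
  define B where "B u v = (\<chi> p. b u v p)" for u v
  have fr: "rotation_matrix (B u v) \<and> B u v *v u = axis 1 1 \<and> B u v *v v = (\<chi> p. if p = 1 then c else if p = 2 then sqrt (1 - c * c) else 0)"
    if n: "norm u = 1" "norm v = 1" "u \<bullet> v = c" for u v
  proof -
    have uu: "u \<bullet> u = 1" "v \<bullet> v = 1" using n by (simp_all add: norm_eq_1)
    have o: "b u v 1 \<bullet> b u v 2 = 0" using uu n(3) by (simp add: b_def inner_diff_right)
    have "(v - c *\<^sub>R u) \<bullet> (v - c *\<^sub>R u) = 1 - c * c"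
      using uu n(3) by (simp add: inner_diff_left inner_diff_right inner_commute)
    then have n2: "norm (b u v 2) = 1" using c1 by (simp add: b_def norm_eq_sqrt_inner)
    have n1: "norm (b u v 1) = 1" using n by (simp add: b_def)
    have c3: "cross3 (b u v 1) (b u v 2) = b u v 3" by (simp add: b_def)
    note F = orthonormal_frame_matrix[OF c3 o n1 n2]
    have u1: "u = b u v 1" by (simp add: b_def)
    have "B u v *v u = axis 1 1"
      unfolding B_def frame_matrix_mult vec_eq_iff
      using F(5)[of 1] F(6)[of 1] u1 by (auto simp: axis_def)
    moreover have "v \<bullet> b u v 3 = 0"
      by (simp add: b_def cross_mult_right Cross3.right_diff_distrib dot_cross_self)
    moreover have "v \<bullet> b u v 2 = sqrt (1 - c * c)"
    proof -
      have "v \<bullet> b u v 2 = (1 - c * c) / sqrt (1 - c * c)" using uu n(3) by (simp add: b_def inner_diff_right inner_commute)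
      then show ?thesis using c1 by (simp add: real_div_sqrt)
    qed
    moreover have "v \<bullet> b u v 1 = c" using n(3) by (simp add: b_def inner_commute)
    ultimately show ?thesis using F(1) unfolding B_def frame_matrix_mult by (simp add: vec_eq_iff forall_3)
  qed
  note f1 = fr[OF n(1,2) c_def[symmetric]] and f2 = fr[OF n(3,4) eq[symmetric, folded c_def]]
  have inv: "transpose (B u' v') *v (B u' v' *v x) = x" for x
    using f2 unfolding rotation_matrix_def orthogonal_matrix_def by (simp only: matrix_vector_mul_assoc matrix_vector_mul_lid)
  show ?thesis
  proof (rule that[of "transpose (B u' v') ** B u v"])
    show "rotation_matrix (transpose (B u' v') ** B u v)"
      using f1 f2 by (simp add: rotation_matrix_def orthogonal_matrix_mul orthogonal_matrix_transpose det_mul det_transpose)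
    have "(transpose (B u' v') ** B u v) *v u = transpose (B u' v') *v (B u' v' *v u')"
      using f1 f2 by (simp only: matrix_vector_mul_assoc[symmetric])
    then show "(transpose (B u' v') ** B u v) *v u = u'" by (simp only: inv)
    have "(transpose (B u' v') ** B u v) *v v = transpose (B u' v') *v (B u' v' *v v')"
      using f1 f2 by (simp only: matrix_vector_mul_assoc[symmetric])
    then show "(transpose (B u' v') ** B u v) *v v = v'" by (simp only: inv)
  qed
qed

text \<open>The law of cosines determines the angle between the edges \<open>i\<close>,
  \<open>j\<close>, and the closing condition gives the third edge. Mirror images are no exception,
  since a reflection of a plane is induced by a rotation of space.\<close>

lemma triangle_congruence:
  fixes r :: "real^'n::finite"
  assumes n: "CARD('n) = 3" and r: "\<And>k. r $ k > 0" and u: "u \<in> zero_level r" and v: "v \<in> zero_level r"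
  shows "(u, v) \<in> so3_rel"
proof -
  obtain i j k :: 'n where ijk: "i \<noteq> j" "i \<noteq> k" "j \<noteq> k" "UNIV = {i, j, k}"
    using n by (auto simp: card_3_iff)
  have nu: "norm (w $ l) = 1" and s: "r $ k *\<^sub>R w $ k = - (r $ i *\<^sub>R w $ i + r $ j *\<^sub>R w $ j)" if "w \<in> zero_level r" for w l
  proof -
    show "norm (w $ l) = 1" using that by (simp add: zero_level_def)
    have "(\<Sum>l\<in>{i, j, k}. r $ l *\<^sub>R w $ l) = 0"
      using that unfolding ijk(4)[symmetric] by (simp add: zero_level_def moment_map_def)
    then have "r $ i *\<^sub>R w $ i + r $ j *\<^sub>R w $ j + r $ k *\<^sub>R w $ k = 0" using ijk(1-3) by (simp add: add.assoc)
    then show "r $ k *\<^sub>R w $ k = - (r $ i *\<^sub>R w $ i + r $ j *\<^sub>R w $ j)"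
      by (simp only: eq_neg_iff_add_eq_0 add.commute)
  qed
  have c: "2 * (r $ i * r $ j) * (w $ i \<bullet> w $ j) = (r $ k)\<^sup>2 - (r $ i)\<^sup>2 - (r $ j)\<^sup>2" if w: "w \<in> zero_level r" for w
  proof -
    have "(r $ k *\<^sub>R w $ k) \<bullet> (r $ k *\<^sub>R w $ k) = (r $ i *\<^sub>R w $ i + r $ j *\<^sub>R w $ j) \<bullet> (r $ i *\<^sub>R w $ i + r $ j *\<^sub>R w $ j)"
      unfolding s[OF w] inner_minus_left inner_minus_right minus_minus ..
    moreover have "w $ l \<bullet> w $ l = 1" for l using nu[OF w, of l] by (simp add: norm_eq_1)
    ultimately show ?thesis
      by (simp add: inner_add_left inner_add_right inner_commute power2_eq_square algebra_simps)
  qed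
  have "2 * (r $ i * r $ j) * (u $ i \<bullet> u $ j) = 2 * (r $ i * r $ j) * (v $ i \<bullet> v $ j)" using c[OF u] c[OF v] by simp
  then have "u $ i \<bullet> u $ j = v $ i \<bullet> v $ j" using r[of i] r[of j] by simp
  then obtain A where A: "rotation_matrix A" "A *v u $ i = v $ i" "A *v u $ j = v $ j"
    using unit_pair_rotation[OF nu[OF u] nu[OF u] nu[OF v] nu[OF v]] by metis
  have "r $ k *\<^sub>R (A *v u $ k) = A *v (- (r $ i *\<^sub>R u $ i + r $ j *\<^sub>R u $ j))"
    unfolding s[OF u, symmetric] by (simp add: matrix_vector_mult_scaleR)
  also have "\<dots> = - (A *v (r $ i *\<^sub>R u $ i + r $ j *\<^sub>R u $ j))"
    using linear_neg[OF matrix_vector_mul_linear[of A]] by blast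
  also have "\<dots> = r $ k *\<^sub>R v $ k" unfolding rotation_matrix_lin A(2,3) s[OF v] ..
  finally have Ak: "A *v u $ k = v $ k" using r[of k] by simp
  have "v $ l = A *v u $ l" for l
    using A(2,3) Ak UNIV_I[of l] unfolding ijk(4) by auto
  then have "v = (\<chi> l. A *v u $ l)" by (simp add: vec_eq_iff)
  then show ?thesis using A(1) by (auto simp: so3_rel_def)
qed

lemma quotient_subset_singleton:
  assumes "\<And>v. v \<in> X \<Longrightarrow> (u, v) \<in> so3_rel"
  shows "X // so3_rel \<subseteq> {so3_rel `` {u}}"
proof -
  have "so3_rel `` {v} = so3_rel `` {u}" if "v \<in> X" for v
    using assms[OF that] so3_rel_sym so3_rel_trans by blast
  then show ?thesis by (auto simp: quotient_def)
qed

lemma emeasure_count_singleton_le: "X \<subseteq> {c} \<Longrightarrow> emeasure (count_space UNIV) X \<le> 1"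
  using emeasure_mono[of X "{c}" "count_space UNIV"] by simp

text \<open>All triangles with the given sides form at most one class, so at most one of the two
  summands is nonzero, and it is 1 or \<open>1 / 2\<close>.\<close>

lemma symplectic_volume_triangle_le:
  fixes r :: "real^'n::finite"
  assumes n: "CARD('n) = 3" and r: "\<And>k. r $ k > 0"
  shows "symplectic_volume r \<le> 1"
proof (cases "regular_level r = {}")
  case False
  then obtain u where u: "u \<in> regular_level r" by blast
  then have uz: "u \<in> zero_level r" and un: "\<not> degenerate u" by (simp_all add: regular_level_def)
  have rel: "(u, v) \<in> so3_rel" if "v \<in> zero_level r" for v by (rule triangle_congruence[OF n r uz that])
  have emp: "{v \<in> zero_level r. degenerate v} = {}" using rel so3_rel_sym so3_rel_degenerate un by blast
  have "emeasure (count_space UNIV) (regular_level r // so3_rel) \<le> 1"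
    by (rule emeasure_count_singleton_le[OF quotient_subset_singleton]) (use rel in \<open>auto simp: regular_level_def\<close>)
  then show ?thesis unfolding symplectic_volume_def emp using n by simp
next
  case True
  have le1: "emeasure (count_space UNIV) ({v \<in> zero_level r. degenerate v} // so3_rel) \<le> 1"
  proof (cases "zero_level r = {}")
    case False
    then obtain u where u: "u \<in> zero_level r" by blast
    show ?thesis
      by (rule emeasure_count_singleton_le[OF quotient_subset_singleton[of _ u]]) (use triangle_congruence[OF n r u] in auto)
  qed simp
  have "emeasure (count_space UNIV) ({v \<in> zero_level r. degenerate v} // so3_rel) / 2 \<le> 1"
  proof (intro divide_le_posI_ennreal)
    note le1
    also have "(1 :: ennreal) \<le> 2 * 1" by simp
    finally show "emeasure (count_space UNIV) ({v \<in> zero_level r. degenerate v} // so3_rel) \<le> 2 * 1" .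
  qed simp
  then show ?thesis using n True by (simp add: symplectic_volume_def)
qed

lemma symplectic_volume_regular_triangle:
  assumes n: "CARD('n::finite) = 3" and a: "a > 0"
  shows "1 \<le> symplectic_volume (\<chi> k::'n. a)"
proof -
  obtain i j k :: 'n where ijk: "i \<noteq> j" "i \<noteq> k" "j \<noteq> k" "UNIV = {i, j, k}"
    using n by (auto simp: card_3_iff)
  \<comment> \<open>Three directions in a plane at mutual angles of 120 degrees.\<close>
  define u :: "(real^3)^'n" where "u = (\<chi> l. if l = i then vector [1, 0, 0]
     else if l = j then vector [-1/2, sqrt 3 / 2, 0] else vector [-1/2, - sqrt 3 / 2, 0])"
  have ui: "u $ i = vector [1, 0, 0]" "u $ j = vector [-1/2, sqrt 3 / 2, 0]" "u $ k = vector [-1/2, - sqrt 3 / 2, 0]"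
    using ijk by (auto simp: u_def)
  have "norm (u $ l) = 1" for l
    by (auto simp: u_def norm_eq_1 inner_vec_def sum_3)
  moreover have "moment_map (\<chi> k::'n. a) u = 0"
  proof -
    have "moment_map (\<chi> k::'n. a) u = (\<Sum>l\<in>{i, j, k}. a *\<^sub>R u $ l)" unfolding moment_map_def ijk(4)[symmetric] by simp
    also have "\<dots> = 0" using ijk(1-3) by (simp add: ui vec_eq_iff forall_3)
    finally show ?thesis .
  qed
  moreover have "\<not> degenerate u"
  proof (rule not_degenerateI[of u i j])
    have "cross3 (u $ i) (u $ j) $ 3 \<noteq> 0" unfolding ui cross_components by simp
    then show "cross3 (u $ i) (u $ j) \<noteq> 0" by auto
  qed
  ultimately have "u \<in> regular_level (\<chi> k::'n. a)" by (simp add: regular_level_def zero_level_def)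
  then have "{so3_rel `` {u}} \<subseteq> regular_level (\<chi> k::'n. a) // so3_rel" by (auto simp: quotient_def)
  then have "emeasure (count_space UNIV) {so3_rel `` {u}} \<le> emeasure (count_space UNIV) (regular_level (\<chi> k::'n. a) // so3_rel)"
    by (rule emeasure_mono) simp
  then have "1 \<le> emeasure (count_space UNIV) (regular_level (\<chi> k::'n. a) // so3_rel)" by simp
  also have "\<dots> \<le> symplectic_volume (\<chi> k::'n. a)" using n by (simp add: symplectic_volume_def)
  finally show ?thesis .
qed

section \<open>The regular polygon is the most flexible\<close>

theorem theorem1p1:
  assumes "CARD('n::finite) \<ge> 3"
  shows
    "(\<forall>(P::real) (r::real^'n).
        0 < P \<longrightarrow> P < real CARD('n) * pi \<longrightarrow>
        (\<forall>i. 0 < r $ i \<and> r $ i < pi) \<longrightarrow> (\<Sum>i\<in>UNIV. r $ i) = P \<longrightarrow>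
        V_S3 r \<le> V_S3 (\<chi> i::'n. P / real CARD('n)) \<and>
        (even CARD('n) \<longrightarrow>
           V_S3 r = V_S3 (\<chi> i::'n. P / real CARD('n)) \<longrightarrow>
           r = (\<chi> i. P / real CARD('n)))) \<and>
     (\<forall>(P::real) (r::real^'n).
        0 < P \<longrightarrow>
        (\<forall>i. 0 < r $ i) \<longrightarrow> (\<Sum>i\<in>UNIV. r $ i) = P \<longrightarrow>
        V_E3 r \<le> V_E3 (\<chi> i::'n. P / real CARD('n)) \<and>
        (even CARD('n) \<longrightarrow>
           V_E3 r = V_E3 (\<chi> i::'n. P / real CARD('n)) \<longrightarrow>
           r = (\<chi> i. P / real CARD('n))))"
proof (intro conjI; intro allI impI)
  fix P :: real and r :: "real^'n"
  assume P: "0 < P" "P < real CARD('n) * pi" and r: "\<forall>i. 0 < r $ i \<and> r $ i < pi" and sum: "(\<Sum>i\<in>UNIV. r $ i) = P"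
  define a where "a = P / real CARD('n)"
  have A: "is_interval {0<..<pi}" by (rule is_interval_oo)
  have rA: "\<forall>k. r $ k \<in> {0<..<pi}" using r by simp
  have suma: "(\<Sum>k\<in>UNIV. r $ k) = real CARD('n) * a" using sum by (simp add: a_def)
  have le: "suminf (witten_term r) \<le> suminf (witten_term (\<chi> k::'n. a))"
    by (rule robin_hood_chain(1)[OF A _ rA suma]) (rule suminf_witten_term_mono[OF assms])
  have "V_S3 r \<le> V_S3 (\<chi> k::'n. a)" unfolding V_S3_witten_term by (intro mult_left_mono le) simp
  moreover have "r = (\<chi> k. a)" if ev: "even CARD('n)" and eq: "V_S3 r = V_S3 (\<chi> k::'n. a)"
  proof (rule ccontr)
    assume ne: "r \<noteq> (\<chi> k. a)"
    have "suminf (witten_term r) < suminf (witten_term (\<chi> k::'n. a))"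
    proof (rule robin_hood_chain(2)[OF A _ rA suma _ ne])
      show "suminf (witten_term s) < suminf (witten_term (\<chi> k::'n. a))"
        if "i \<noteq> j" "\<forall>k. s $ k \<in> {0<..<pi}" "a \<in> {0<..<pi}" "s $ i \<noteq> a" "s $ i + s $ j = 2 * a"
          "\<forall>k. k \<noteq> i \<longrightarrow> k \<noteq> j \<longrightarrow> s $ k = a" for s :: "real^'n" and i j
        by (rule suminf_witten_term_strict[OF assms ev that(1,2,3,6,5,4)])
    qed (rule suminf_witten_term_mono[OF assms])
    then show False using eq unfolding V_S3_witten_term by simp
  qed
  ultimately show "V_S3 r \<le> V_S3 (\<chi> i::'n. P / real CARD('n)) \<and>
        (even CARD('n) \<longrightarrow> V_S3 r = V_S3 (\<chi> i::'n. P / real CARD('n)) \<longrightarrow> r = (\<chi> i. P / real CARD('n)))"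
    by (simp add: a_def)
next
  fix P :: real and r :: "real^'n"
  assume P: "0 < P" and r: "\<forall>i. 0 < r $ i" and sum: "(\<Sum>i\<in>UNIV. r $ i) = P"
  define a where "a = P / real CARD('n)"
  have a: "a > 0" using P by (simp add: a_def)
  have A: "is_interval {0::real<..}" by (auto simp: is_interval_1)
  have rA: "\<forall>k. r $ k \<in> {0<..}" using r by simp
  have suma: "(\<Sum>k\<in>UNIV. r $ k) = real CARD('n) * a" using sum by (simp add: a_def)
  define c where "c = ennreal ((2 * pi) ^ (CARD('n) - 3))"
  have c: "c \<noteq> 0" "c \<noteq> top" by (simp_all add: c_def)
  have mono: "symplectic_volume q \<le> symplectic_volume s"
    if "CARD('n) \<ge> 4" "i \<noteq> j" "\<forall>k. q $ k \<in> {0<..}" "\<forall>k. s $ k \<in> {0<..}" "\<forall>k. k \<noteq> i \<longrightarrow> k \<noteq> j \<longrightarrow> s $ k = q $ k"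
      "s $ i + s $ j = q $ i + q $ j" "\<bar>s $ i - s $ j\<bar> \<le> \<bar>q $ i - q $ j\<bar>" for q s :: "real^'n" and i j
    by (rule symplectic_volume_mono[OF that(1,2) _ _ _ that(6,7)]) (use that in auto)
  have le: "symplectic_volume r \<le> symplectic_volume (\<chi> k::'n. a)"
  proof (cases "CARD('n) = 3")
    case True
    have "symplectic_volume r \<le> 1" by (rule symplectic_volume_triangle_le[OF True]) (use r in simp)
    also have "1 \<le> symplectic_volume (\<chi> k::'n. a)" by (rule symplectic_volume_regular_triangle[OF True a])
    finally show ?thesis .
  next
    case False
    then have n: "CARD('n) \<ge> 4" using assms by linarith
    show ?thesis by (rule robin_hood_chain(1)[OF A _ rA suma]) (rule mono[OF n])
  qed
  then have "V_E3 r \<le> V_E3 (\<chi> k::'n. a)" unfolding V_E3_def by (rule divide_right_mono_ennreal)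
  moreover have "r = (\<chi> k. a)" if ev: "even CARD('n)" and eq: "V_E3 r = V_E3 (\<chi> k::'n. a)"
  proof (rule ccontr)
    assume ne: "r \<noteq> (\<chi> k. a)"
    have "CARD('n) \<noteq> 3" using ev by auto
    then have n: "CARD('n) \<ge> 4" using assms by linarith
    have "symplectic_volume r < symplectic_volume (\<chi> k::'n. a)"
    proof (rule robin_hood_chain(2)[OF A _ rA suma _ ne])
      show "symplectic_volume s < symplectic_volume (\<chi> k::'n. a)"
        if "i \<noteq> j" "\<forall>k. s $ k \<in> {0<..}" "a \<in> {0<..}" "s $ i \<noteq> a" "s $ i + s $ j = 2 * a"
          "\<forall>k. k \<noteq> i \<longrightarrow> k \<noteq> j \<longrightarrow> s $ k = a" for s :: "real^'n" and i j
        by (rule symplectic_volume_strict[OF n ev that(1) _ a _ that(5,4)]) (use that in auto)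
    qed (rule mono[OF n])
    \<comment> \<open>The normalizing constant is finite and nonzero, so dividing by it preserves
      the strict inequality.\<close>
    then have "symplectic_volume r * inverse c < symplectic_volume (\<chi> k::'n. a) * inverse c"
      by (rule ennreal_mult_strict_right_mono) (use c in \<open>auto simp: top.not_eq_extremum[symmetric] ennreal_inverse_eq_top_iff zero_less_iff_neq_zero\<close>)
    then show False using eq unfolding V_E3_def c_def divide_ennreal_def by simp
  qed
  ultimately show "V_E3 r \<le> V_E3 (\<chi> i::'n. P / real CARD('n)) \<and>
        (even CARD('n) \<longrightarrow> V_E3 r = V_E3 (\<chi> i::'n. P / real CARD('n)) \<longrightarrow> r = (\<chi> i. P / real CARD('n)))"
    by (simp add: a_def)
qed

end
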